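(* Let $X$ be a linear model of dimension $d$ in $\mathbb{P}^n$. If the tropical data vector $w=(w_0,\dots,w_n)$ is sufficiently generic, then there are exactly $\mathrm{MLdegree}(X)$ many distinct tropical critical points. They are given by the intersection $$\hat q\in \mathrm{trop}(X)\cap\bigl(w-\mathrm{trop}(X^\perp)\bigr),$$ that is, the set of tropical critical points is exactly this intersection.
   Context: A linear model $X$ is a $d$-dimensional linear subspace of $\mathbb{P}^n$, defined by homogeneous linear equations with real coefficients, that meets the open simplex $\Delta_n$ of points with all coordinates positive. For data $u=(u_0,\dots,u_n)$ the log-likelihood function is $\mathcal{L}_u=\sum_{i=0}^n u_i\log(p_i)-(\sum_{i=0}^n u_i)\log(\sum_{i=0}^n p_i)$, viewed on $X^\circ=X\setminus\{p_0p_1\cdots p_n(p_0+\cdots+p_n)=0\}$. $\mathrm{MLdegree}(X)$ is the number of complex critical points of $\mathcal{L}_u$ on $X^\circ$ for generic complex $u$. Augmenting the equations of $X$ by $p_0+\cdots+p_n=1$, we identify $X$ with the resulting $d$-dimensional affine-linear subspace of $\mathbb{R}^{n+1}$ (and its extension to larger fields). $X^\perp\subset\mathbb{R}^{n+1}$ is the linear subspace, of dimension $n-d+1$, of all vectors orthogonal (for the standard dot product) to all differences of points of this affine space. Let $R=\mathbb{R}\{\!\{t\}\!\}$ be the field of real Puiseux series, $K=\mathbb{C}\{\!\{t\}\!\}$ its algebraic closure, and $\mathrm{val}_t$ the $t$-adic valuation. Let $u_0,\dots,u_n\in R$ be nonzero, with $w_i=\mathrm{val}_t(u_i)$; $w$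 is the tropical data vector. For each critical point $\hat p$ of $\mathcal{L}_u$ on $X^\circ$ over $K$, normalized by $\sum\hat p_i=1$, the vector $\hat q=(\mathrm{val}_t(\hat p_0),\dots,\mathrm{val}_t(\hat p_n))$ is called a tropical critical point. $\mathrm{trop}(X)$ and $\mathrm{trop}(X^\perp)$ are the tropicalizations (min convention, closures in $\mathbb{R}^{n+1}$ of the sets of coordinatewise valuations of the points over $K$ with all coordinates nonzero) of the affine space $X$ and the linear space $X^\perp$; they are pure polyhedral fans of dimensions $d$ and $n-d+1$. Sufficiently generic means outside a suitable finite union of proper linear subspaces of $\mathbb{R}^{n+1}$ depending only on $X$. *)

theory Defs
  imports
    "HOL-Analysis.Analysis"
    "HOL-Computational_Algebra.Formal_Laurent_Series"
begin

unbundle no fps_syntax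

section \<open>Puiseux series\<close>

lemma fls_compose_power_compose_power:
  assumes "a > 0" "b > 0"
  shows "fls_compose_power (fls_compose_power f a) b = fls_compose_power f (a * b)"
proof (rule fls_eqI)
  fix n :: int
  have "int (a * b) dvd n \<longleftrightarrow> int b dvd n \<and> int a dvd n div int b"
    using assms by (auto simp: dvd_div_iff_mult mult.commute dest: dvd_mult_left dvd_mult_right)
  moreover have "n div int b div int a = n div int (a * b)"
    using assms by (simp add: zdiv_zmult2_eq[symmetric] mult.commute)
  ultimately show "fls_nth (fls_compose_power (fls_compose_power f a) b) n = fls_nth (fls_compose_power f (a * b)) n"
    using assms by (simp add: fls_nth_compose_power)
qed

lemma fls_compose_power_inject:
  assumes "d > 0"
  shows "fls_compose_power f d = fls_compose_power g d \<longleftrightarrow> f = g"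
proof
  assume eq: "fls_compose_power f d = fls_compose_power g d"
  show "f = g"
  proof (rule fls_eqI)
    fix n :: int
    have "fls_nth (fls_compose_power f d) (int d * n) = fls_nth (fls_compose_power g d) (int d * n)"
      using eq by simp
    thus "fls_nth f n = fls_nth g n" using assms by (simp add: fls_nth_compose_power)
  qed
qed auto

lemma fls_compose_power_eq_0_iff:
  "d > 0 \<Longrightarrow> fls_compose_power f d = 0 \<longleftrightarrow> f = 0"
  using fls_compose_power_inject[of d f 0] by simp

lemma fls_compose_power_inverse:
  fixes f :: "'a::field fls"
  assumes "d > 0"
  shows "fls_compose_power (inverse f) d = inverse (fls_compose_power f d)"
proof (cases "f = 0")
  case False
  have "fls_compose_power f d * fls_compose_power (inverse f) d = 1"
    using False assms by (simp flip: fls_compose_power_mult)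
  thus ?thesis by (metis inverse_unique)
qed auto

lemma fls_subdegree_compose_power:
  assumes "d > 0"
  shows "fls_subdegree (fls_compose_power f d) = int d * fls_subdegree f"
proof (cases "f = 0")
  case False
  show ?thesis
  proof (rule fls_subdegree_eqI)
    show "fls_nth (fls_compose_power f d) (int d * fls_subdegree f) \<noteq> 0"
      using False assms by (simp add: fls_nth_compose_power)
    fix k assume "k < int d * fls_subdegree f"
    hence "int d dvd k \<Longrightarrow> k div int d < fls_subdegree f"
      using assms by (auto elim!: dvdE)
    thus "fls_nth (fls_compose_power f d) k = 0"
      using assms by (auto simp: fls_nth_compose_power)
  qed
qed auto

text \<open>
  The field of Puiseux series over \<open>'a\<close> is the union over \<open>n \<ge> 1\<close> of the fields of Laurent
  series in \<open>t\<^bsup>1/n\<^esup>\<close>. The pair \<open>(n, f)\<close> stands for the series \<open>f(t\<^bsup>1/n\<^esup>)\<close>, and \<open>(n, f)\<close> and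
  \<open>(m, g)\<close> are identified when \<open>f(s\<^sup>m) = g(s\<^sup>n)\<close>, where \<open>s = t\<^bsup>1/(nm)\<^esup>\<close>.
\<close>

definition puiseux_rel :: "nat \<times> 'a::zero fls \<Rightarrow> nat \<times> 'a fls \<Rightarrow> bool" where
  "puiseux_rel x y \<longleftrightarrow> fst x > 0 \<and> fst y > 0 \<and>
     fls_compose_power (snd x) (fst y) = fls_compose_power (snd y) (fst x)"

quotient_type (overloaded) 'a puiseux = "nat \<times> 'a::zero fls" / partial: puiseux_rel
proof (rule part_equivpI)
  show "\<exists>x::nat \<times> 'a fls. puiseux_rel x x"
    by (rule exI[of _ "(1, 0)"]) (simp add: puiseux_rel_def)
  show "symp (puiseux_rel :: nat \<times> 'a fls \<Rightarrow> _)"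
    by (auto simp: symp_def puiseux_rel_def)
  show "transp (puiseux_rel :: nat \<times> 'a fls \<Rightarrow> _)"
  proof (rule transpI)
    fix x y z :: "nat \<times> 'a fls"
    assume "puiseux_rel x y" "puiseux_rel y z"
    then obtain n f m g k h where xyz: "x = (n, f)" "y = (m, g)" "z = (k, h)"
      and pos: "n > 0" "m > 0" "k > 0"
      and 1: "fls_compose_power f m = fls_compose_power g n"
      and 2: "fls_compose_power g k = fls_compose_power h m"
      by (cases x; cases y; cases z) (auto simp: puiseux_rel_def)
    have "fls_compose_power (fls_compose_power f k) m = fls_compose_power (fls_compose_power f m) k"
      using pos by (simp add: fls_compose_power_compose_power mult.commute)
    also have "\<dots> = fls_compose_power (fls_compose_power g k) n"
      using pos by (simp add: 1 fls_compose_power_compose_power mult.commute)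
    also have "\<dots> = fls_compose_power (fls_compose_power h n) m"
      using pos by (simp add: 2 fls_compose_power_compose_power mult.commute)
    finally show "puiseux_rel x z"
      using pos by (simp add: xyz puiseux_rel_def fls_compose_power_inject)
  qed
qed

lemma puiseux_rel_aux:
  assumes "fls_compose_power f n' = fls_compose_power f' n" "n > 0" "n' > 0" "m > 0" "m' > 0"
  shows "fls_compose_power f (m * (n' * m')) = fls_compose_power f' (m' * (n * m))"
proof -
  have "fls_compose_power f (n' * (m * m')) = fls_compose_power f' (n * (m * m'))"
    using assms by (simp flip: fls_compose_power_compose_power)
  thus ?thesis by (simp add: mult_ac)
qed

instantiation puiseux :: (field) field
begin

lift_definition zero_puiseux :: "'a puiseux" is "(1, 0)"
  by (simp add: puiseux_rel_def)

lift_definition one_puiseux :: "'a puiseux" is "(1, 1)"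
  by (simp add: puiseux_rel_def)

lift_definition plus_puiseux :: "'a puiseux \<Rightarrow> 'a puiseux \<Rightarrow> 'a puiseux" is
  "\<lambda>(n, f) (m, g). (n * m, fls_compose_power f m + fls_compose_power g n)"
proof -
  fix x y z w :: "nat \<times> 'a fls"
  assume "puiseux_rel x y" "puiseux_rel z w"
  then obtain n f n' f' m g m' g'
    where xyzw: "x = (n, f)" "y = (n', f')" "z = (m, g)" "w = (m', g')"
      and pos: "n > 0" "n' > 0" "m > 0" "m' > 0"
      and f: "fls_compose_power f n' = fls_compose_power f' n"
      and g: "fls_compose_power g m' = fls_compose_power g' m"
    by (cases x; cases y; cases z; cases w) (auto simp: puiseux_rel_def)
  show "puiseux_rel ((case x of (n, f) \<Rightarrow> \<lambda>(m, g). (n * m, fls_compose_power f m + fls_compose_power g n)) z)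
      ((case y of (n, f) \<Rightarrow> \<lambda>(m, g). (n * m, fls_compose_power f m + fls_compose_power g n)) w)"
    using pos puiseux_rel_aux[OF f, of m m'] puiseux_rel_aux[OF g, of n n']
    by (simp add: xyzw puiseux_rel_def fls_compose_power_compose_power mult_ac)
qed

lift_definition uminus_puiseux :: "'a puiseux \<Rightarrow> 'a puiseux" is
  "\<lambda>(n, f). (n, - f)"
  by (auto simp: puiseux_rel_def)

lift_definition times_puiseux :: "'a puiseux \<Rightarrow> 'a puiseux \<Rightarrow> 'a puiseux" is
  "\<lambda>(n, f) (m, g). (n * m, fls_compose_power f m * fls_compose_power g n)"
proof -
  fix x y z w :: "nat \<times> 'a fls"
  assume "puiseux_rel x y" "puiseux_rel z w"
  then obtain n f n' f' m g m' g'
    where xyzw: "x = (n, f)" "y = (n', f')" "z = (m, g)" "w = (m', g')"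
      and pos: "n > 0" "n' > 0" "m > 0" "m' > 0"
      and f: "fls_compose_power f n' = fls_compose_power f' n"
      and g: "fls_compose_power g m' = fls_compose_power g' m"
    by (cases x; cases y; cases z; cases w) (auto simp: puiseux_rel_def)
  show "puiseux_rel ((case x of (n, f) \<Rightarrow> \<lambda>(m, g). (n * m, fls_compose_power f m * fls_compose_power g n)) z)
      ((case y of (n, f) \<Rightarrow> \<lambda>(m, g). (n * m, fls_compose_power f m * fls_compose_power g n)) w)"
    using pos puiseux_rel_aux[OF f, of m m'] puiseux_rel_aux[OF g, of n n']
    by (simp add: xyzw puiseux_rel_def fls_compose_power_compose_power mult_ac)
qed

lift_definition inverse_puiseux :: "'a puiseux \<Rightarrow> 'a puiseux" is
  "\<lambda>(n, f). (n, inverse f)"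
  by (auto simp: puiseux_rel_def fls_compose_power_inverse)

definition minus_puiseux :: "'a puiseux \<Rightarrow> 'a puiseux \<Rightarrow> 'a puiseux" where
  "minus_puiseux x y = x + (- y)"

definition divide_puiseux :: "'a puiseux \<Rightarrow> 'a puiseux \<Rightarrow> 'a puiseux" where
  "divide_puiseux x y = x * inverse y"

instance
proof
  fix a b c :: "'a puiseux"
  show "a + b + c = a + (b + c)"
    by transfer (auto simp: puiseux_rel_def fls_compose_power_compose_power mult_ac add_ac)
  show "a + b = b + a"
    by transfer (auto simp: puiseux_rel_def mult_ac add_ac)
  show "0 + a = a"
    by transfer (auto simp: puiseux_rel_def fls_compose_power_compose_power)
  show "- a + a = 0"
    by transfer (auto simp: puiseux_rel_def)
  show "a - b = a + - b" by (simp add: minus_puiseux_def)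
  show "a * b * c = a * (b * c)"
    by transfer (auto simp: puiseux_rel_def fls_compose_power_compose_power mult_ac)
  show "a * b = b * a"
    by transfer (auto simp: puiseux_rel_def mult_ac)
  show "1 * a = a"
    by transfer (auto simp: puiseux_rel_def fls_compose_power_compose_power)
  show "(a + b) * c = a * c + b * c"
    by transfer (auto simp: puiseux_rel_def fls_compose_power_compose_power algebra_simps)
  show "(0::'a puiseux) \<noteq> 1"
    by transfer (auto simp: puiseux_rel_def)
  show "inverse a * a = 1" if "a \<noteq> 0"
    using that
    by transfer (auto simp: puiseux_rel_def fls_compose_power_compose_power
                            fls_compose_power_inverse fls_compose_power_eq_0_iff)
  show "a div b = a * inverse b" by (simp add: divide_puiseux_def)
  show "inverse (0::'a puiseux) = 0"
    by transfer (auto simp: puiseux_rel_def)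
qed

end


instantiation puiseux :: (real_field) real_field
begin

lift_definition scaleR_puiseux :: "real \<Rightarrow> 'a puiseux \<Rightarrow> 'a puiseux" is
  "\<lambda>r (n, f). (n, fls_const (of_real r) * f)"
  by (auto simp: puiseux_rel_def)

instance
proof
  fix r s :: real and a b :: "'a puiseux"
  show "r *\<^sub>R (a + b) = r *\<^sub>R a + r *\<^sub>R b"
    by transfer (auto simp: puiseux_rel_def algebra_simps)
  show "(r + s) *\<^sub>R a = r *\<^sub>R a + s *\<^sub>R a"
    by transfer (auto simp: puiseux_rel_def fls_compose_power_compose_power algebra_simps
                      simp flip: fls_plus_const)
  show "r *\<^sub>R s *\<^sub>R a = (r * s) *\<^sub>R a"
    by transfer (auto simp: puiseux_rel_def algebra_simps simp flip: fls_const_mult_const)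
  show "1 *\<^sub>R a = a"
    by transfer (auto simp: puiseux_rel_def)
  show "r *\<^sub>R a * b = r *\<^sub>R (a * b)"
    by transfer (auto simp: puiseux_rel_def algebra_simps)
  show "a * r *\<^sub>R b = r *\<^sub>R (a * b)"
    by transfer (auto simp: puiseux_rel_def algebra_simps)
qed

end

text \<open>
  The \<open>t\<close>-adic valuation. It is only meaningful on nonzero series: here \<open>puiseux_val 0 = 0\<close>.
\<close>
lift_definition puiseux_val :: "'a::zero puiseux \<Rightarrow> real" is
  "\<lambda>(n, f). real_of_int (fls_subdegree f) / real n"
proof -
  fix x y :: "nat \<times> 'a fls"
  assume "puiseux_rel x y"
  then obtain n f m g where xy: "x = (n, f)" "y = (m, g)" and pos: "n > 0" "m > 0"
    and eq: "fls_compose_power f m = fls_compose_power g n"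
    by (cases x; cases y) (auto simp: puiseux_rel_def)
  have "int m * fls_subdegree f = int n * fls_subdegree g"
    using arg_cong[OF eq, of fls_subdegree] pos by (simp add: fls_subdegree_compose_power)
  hence "real_of_int (int m * fls_subdegree f) = real_of_int (int n * fls_subdegree g)"
    by (rule arg_cong)
  thus "(case x of (n, f) \<Rightarrow> real_of_int (fls_subdegree f) / real n) =
        (case y of (n, f) \<Rightarrow> real_of_int (fls_subdegree f) / real n)"
    using pos by (simp add: xy field_simps)
qed

lift_definition fls_of_real :: "real fls \<Rightarrow> 'a::real_algebra_1 fls" is
  "\<lambda>f n. of_real (f n)"
  by simp

lemma fls_compose_power_fls_of_real:
  "fls_compose_power (fls_of_real f) d = fls_of_real (fls_compose_power f d)"
  by transfer (auto simp: fun_eq_iff)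

lift_definition puiseux_of_real :: "real puiseux \<Rightarrow> 'a::real_algebra_1 puiseux" is
  "\<lambda>(n, f). (n, fls_of_real f)"
  by (auto simp: puiseux_rel_def fls_compose_power_fls_of_real)


section \<open>Linear models\<close>

text \<open>
  Projective space of dimension \<open>n\<close> has homogeneous coordinates indexed by a finite type \<open>'n\<close>
  with \<open>n + 1\<close> elements. A linear model is given by its cone, so a model of projective
  dimension \<open>d\<close> is a linear subspace of dimension \<open>d + 1\<close>.
\<close>

definition linear_model :: "nat \<Rightarrow> (real ^ 'n) set \<Rightarrow> bool" where
  "linear_model d X \<longleftrightarrow> subspace X \<and> dim X = d + 1 \<and> (\<exists>p\<in>X. \<forall>i. p $ i > 0)"

definition affine_model :: "(real ^ 'n) set \<Rightarrow> (real ^ 'n) set" where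
  "affine_model X = {p \<in> X. (\<Sum>i\<in>UNIV. p $ i) = 1}"

definition model_perp :: "(real ^ 'n) set \<Rightarrow> (real ^ 'n) set" where
  "model_perp X = {v. \<forall>p\<in>affine_model X. \<forall>q\<in>affine_model X. v \<bullet> (p - q) = 0}"

text \<open>
  The points over a larger field of a real affine-linear (or linear) subspace \<open>S\<close>, that is, the
  common solutions of all affine-linear equations with real coefficients that hold on \<open>S\<close>.
\<close>
definition extend_field :: "(real ^ 'n) set \<Rightarrow> ('a::real_field ^ 'n) set" where
  "extend_field S = {p. \<forall>a c. (\<forall>x\<in>S. a \<bullet> x = c) \<longrightarrow>
                              (\<Sum>i\<in>UNIV. of_real (a $ i) * p $ i) = of_real c}"


section \<open>Critical points of the log-likelihood function\<close>

text \<open>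
  The formal gradient of
  \<open>L\<^sub>u = (\<Sum>i. u\<^sub>i log p\<^sub>i) - (\<Sum>i. u\<^sub>i) log (\<Sum>i. p\<^sub>i)\<close>.
\<close>
definition loglik_gradient :: "'a::field ^ 'n \<Rightarrow> 'a ^ 'n \<Rightarrow> 'a ^ 'n" where
  "loglik_gradient u p =
     (\<chi> i. u $ i / p $ i - (\<Sum>j\<in>UNIV. u $ j) / (\<Sum>j\<in>UNIV. p $ j))"

text \<open>
  The point of \<open>X\<close> minus the hyperplanes \<open>p\<^sub>i = 0\<close> and \<open>\<Sum>i. p\<^sub>i = 0\<close> with homogeneous coordinates
  \<open>p\<close> is critical. Since \<open>L\<^sub>u\<close> is homogeneous of degree 0, this does not depend on the scaling
  of \<open>p\<close>, and the differential can be tested on the whole cone over \<open>X\<close>.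
\<close>
definition is_critical_point :: "(real ^ 'n) set \<Rightarrow> 'a::real_field ^ 'n \<Rightarrow> 'a ^ 'n \<Rightarrow> bool" where
  "is_critical_point X u p \<longleftrightarrow>
     p \<in> extend_field X \<and> (\<forall>i. p $ i \<noteq> 0) \<and> (\<Sum>i\<in>UNIV. p $ i) \<noteq> 0 \<and>
     (\<forall>v\<in>extend_field X. (\<Sum>i\<in>UNIV. loglik_gradient u p $ i * v $ i) = 0)"

text \<open>
  Every point of \<open>X\<close> off the hyperplane \<open>\<Sum>i. p\<^sub>i = 0\<close> has exactly one representative with
  coordinate sum 1, so this set is in bijection with the set of critical points.
\<close>
definition critical_points :: "(real ^ 'n) set \<Rightarrow> 'a::real_field ^ 'n \<Rightarrow> ('a ^ 'n) set" where
  "critical_points X u = {p. is_critical_point X u p \<and> (\<Sum>i\<in>UNIV. p $ i) = 1}"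

inductive complex_polynomial :: "(complex ^ 'n \<Rightarrow> complex) \<Rightarrow> bool" where
  const: "complex_polynomial (\<lambda>_. c)"
| coord: "complex_polynomial (\<lambda>u. u $ i)"
| add: "complex_polynomial f \<Longrightarrow> complex_polynomial g \<Longrightarrow> complex_polynomial (\<lambda>u. f u + g u)"
| mult: "complex_polynomial f \<Longrightarrow> complex_polynomial g \<Longrightarrow> complex_polynomial (\<lambda>u. f u * g u)"

definition for_generic :: "(complex ^ 'n \<Rightarrow> bool) \<Rightarrow> bool" where
  "for_generic P \<longleftrightarrow>
     (\<exists>f. complex_polynomial f \<and> (\<exists>u. f u \<noteq> 0) \<and> (\<forall>u. f u \<noteq> 0 \<longrightarrow> P u))"

definition MLdegree :: "(real ^ 'n) set \<Rightarrow> nat" where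
  "MLdegree X = (THE N. for_generic (\<lambda>u. finite (critical_points X u) \<and>
                                         card (critical_points X u) = N))"


section \<open>Tropicalization\<close>

definition val_vec :: "'a::zero puiseux ^ 'n \<Rightarrow> real ^ 'n" where
  "val_vec p = (\<chi> i. puiseux_val (p $ i))"

definition tropicalization :: "(real ^ 'n) set \<Rightarrow> (real ^ 'n) set" where
  "tropicalization S =
     closure {val_vec p | p. p \<in> (extend_field S :: (complex puiseux ^ 'n) set) \<and> (\<forall>i. p $ i \<noteq> 0)}"

definition tropical_critical_points :: "(real ^ 'n) set \<Rightarrow> real puiseux ^ 'n \<Rightarrow> (real ^ 'n) set" where
  "tropical_critical_points X u =
     val_vec ` critical_points X (\<chi> i. (puiseux_of_real (u $ i) :: complex puiseux))"

end

theory Submission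
  imports Defs
begin

text \<open>
  Critical points are the pairs \<open>p \<in> X\<close>, \<open>q \<in> X\<^sup>\<bottom>\<close> with \<open>p\<^sub>i q\<^sub>i = u\<^sub>i\<close>. For positive real \<open>u\<close> they are all
  real, and strict concavity gives exactly one in each bounded region of the arrangement \<open>p\<^sub>i = 0\<close>.
  The map \<open>(p, q) \<mapsto> pq\<close> is a polynomial map between complex affine spaces of the same dimension; it is
  proper and etale outside a hypersurface, whose complement is connected, so the ML degree is the
  number of bounded regions.

  A point of the tropical intersection splits \<open>w\<close> as \<open>a + b\<close>. The level sets of \<open>a\<close> and \<open>b\<close> form a
  bipartite graph with one edge per coordinate, and for generic \<open>w\<close> a dimension count shows that it is
  a tree. Hence the leading coefficients of a critical point with valuation \<open>a\<close> can be solved for, and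
  Hensel lifting yields the critical point, so the intersection consists of tropical critical points.

  Its points correspond to the bounded regions: a tropical point lifts to a critical point over the
  real Puiseux series, whose signs determine it by the concavity argument; conversely, the real
  critical point in a bounded region for \<open>u = t\<^sup>w\<close> has a tropical limit as \<open>t\<close> tends to 0, and as the
  graph is connected, this limit determines the signs.
\<close>

no_notation fps_nth (infixl "$" 75)

section \<open>Linear models over extension fields\<close>

lemma subspace_projection_coeffs:
  fixes S :: "(real ^ 'i) set"
  assumes "subspace S"
  obtains P :: "'i \<Rightarrow> 'i \<Rightarrow> real" where
    "\<And>i j. P i j = P j i"
    "\<And>j. (\<chi> i. P i j) \<in> S"
    "\<And>x i. x \<in> S \<Longrightarrow> x $ i = (\<Sum>j\<in>UNIV. P i j * x $ j)"
proof -
  obtain B where B: "B \<subseteq> S" "pairwise orthogonal B" "\<And>x. x \<in> B \<Longrightarrow> norm x = 1"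
      "independent B" "span B = S"
    using orthonormal_basis_subspace[OF assms] by metis
  have fin: "finite B" using B(4) by (rule independent_imp_finite)
  define P where "P = (\<lambda>i j. \<Sum>b\<in>B. b $ i * b $ j)"
  have col: "(\<chi> i. P i j) = (\<Sum>b\<in>B. b $ j *\<^sub>R b)" for j
    by (simp add: P_def vec_eq_iff mult.commute)
  have lin: "(\<Sum>j\<in>UNIV. P i j * x $ j) = (\<Sum>b\<in>B. (b \<bullet> x) * b $ i)" for i x
    by (simp add: P_def inner_vec_def sum_distrib_right sum_distrib_left sum.swap[of _ B] mult_ac)
  have "x $ i = (\<Sum>j\<in>UNIV. P i j * x $ j)" if "x \<in> S" for x i
  proof -
    have "x = (\<Sum>b\<in>B. (b \<bullet> x) *\<^sub>R b)"
    proof -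
      have "x \<in> span B" using that B(5) by blast
      then obtain c where c: "x = (\<Sum>b\<in>B. c b *\<^sub>R b)"
        using span_finite[OF fin] by auto
      have "b \<bullet> x = c b" if b: "b \<in> B" for b
      proof -
        have "b \<bullet> x = (\<Sum>b'\<in>B. c b' * (b \<bullet> b'))" by (simp add: c inner_sum_right)
        also have "\<dots> = (\<Sum>b'\<in>B. if b' = b then c b else 0)"
          using B(2,3) b by (intro sum.cong) (auto simp: pairwise_def orthogonal_def norm_eq_1)
        finally show ?thesis using b fin by simp
      qed
      then show ?thesis using c by (metis (no_types, lifting) sum.cong)
    qed
    from arg_cong[OF this, of "\<lambda>y. y $ i"]
    show ?thesis unfolding lin by simp
  qed
  moreover have "(\<chi> i. P i j) \<in> S" for j
    unfolding col using B(1) assms by (intro subspace_sum subspace_scale) auto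
  moreover have "P i j = P j i" for i j by (simp add: P_def mult.commute)
  ultimately show ?thesis using that by blast
qed

lemma extend_field_subspace_iff:
  fixes S :: "(real ^ 'i) set" and p :: "'a::real_field ^ 'i"
  assumes "subspace S"
  shows "p \<in> extend_field S \<longleftrightarrow> (\<forall>a. (\<forall>x\<in>S. a \<bullet> x = 0) \<longrightarrow> (\<Sum>i\<in>UNIV. of_real (a $ i) * p $ i) = 0)"
proof -
  have "c = 0" if "\<forall>x\<in>S. a \<bullet> x = c" for a c
    using that subspace_0[OF assms] by (metis inner_zero_right)
  then have "(\<forall>a c. (\<forall>x\<in>S. a \<bullet> x = c) \<longrightarrow> Q a c) \<longleftrightarrow> (\<forall>a. (\<forall>x\<in>S. a \<bullet> x = 0) \<longrightarrow> Q a 0)"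
    for Q :: "real ^ 'i \<Rightarrow> real \<Rightarrow> bool" by blast
  then show ?thesis unfolding extend_field_def by simp
qed

lemma in_extend_fieldD:
  assumes "p \<in> extend_field S" "\<And>x. x \<in> S \<Longrightarrow> a \<bullet> x = c"
  shows "(\<Sum>i\<in>UNIV. of_real (a $ i) * p $ i) = of_real c"
  using assms unfolding extend_field_def by blast

lemma extend_field_combination:
  fixes S :: "(real ^ 'i) set"
  assumes "subspace S" "\<And>k. k \<in> K \<Longrightarrow> z k \<in> S"
  shows "(\<chi> i. \<Sum>k\<in>K. c k * of_real (z k $ i)) \<in> (extend_field S :: ('a::real_field ^ 'i) set)"
proof -
  have "(\<Sum>i\<in>UNIV. of_real (a $ i) * (\<Sum>k\<in>K. c k * of_real (z k $ i))) = (0::'a)"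
    if a: "\<forall>x\<in>S. a \<bullet> x = 0" for a
  proof -
    have "(\<Sum>i\<in>UNIV. of_real (a $ i) * (\<Sum>k\<in>K. c k * of_real (z k $ i)))
        = (\<Sum>k\<in>K. c k * of_real (a \<bullet> z k))"
      by (simp add: inner_vec_def sum_distrib_left sum.swap[of _ K] mult_ac)
    also have "\<dots> = 0" using a assms(2) by (intro sum.neutral) auto
    finally show ?thesis .
  qed
  then show ?thesis by (simp add: extend_field_subspace_iff[OF assms(1)])
qed

lemma extend_field_expand:
  fixes S :: "(real ^ 'i) set" and P :: "'i \<Rightarrow> 'i \<Rightarrow> real" and p :: "'a::real_field ^ 'i"
  assumes "\<And>x i. x \<in> S \<Longrightarrow> x $ i = (\<Sum>j\<in>UNIV. P i j * x $ j)" "p \<in> extend_field S"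
  shows "p $ i = (\<Sum>j\<in>UNIV. of_real (P i j) * p $ j)"
proof -
  let ?a = "(\<chi> j. P i j) - axis i 1"
  have "?a \<bullet> x = 0" if "x \<in> S" for x
    using assms(1)[OF that, of i] by (simp add: inner_diff_left inner_axis') (simp add: inner_vec_def)
  from in_extend_fieldD[OF assms(2) this]
  have "(\<Sum>j\<in>UNIV. of_real (P i j) * p $ j - of_real (axis i 1 $ j) * p $ j) = 0"
    by (simp add: algebra_simps)
  moreover have "(\<Sum>j\<in>UNIV. of_real (axis i 1 $ j) * p $ j) = p $ i"
    by (subst sum.cong[OF refl, of _ _ "\<lambda>j. if j = i then p $ j else 0"]) (auto simp: axis_def)
  ultimately show ?thesis by (simp add: sum_subtractf)
qed

lemma real_linear_image_extend_field:
  fixes S :: "(real ^ 'i) set" and p :: "'a::real_field ^ 'i" and \<phi> :: "'a \<Rightarrow> real"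
  assumes "subspace S" "linear \<phi>" "p \<in> extend_field S"
  shows "(\<chi> i. \<phi> (p $ i)) \<in> S"
proof -
  obtain P :: "'i \<Rightarrow> 'i \<Rightarrow> real" where P: "\<And>j. (\<chi> i. P i j) \<in> S"
      "\<And>x i. x \<in> S \<Longrightarrow> x $ i = (\<Sum>j\<in>UNIV. P i j * x $ j)"
    using subspace_projection_coeffs[OF assms(1)] by metis
  have eq: "\<phi> (p $ i) = (\<Sum>j\<in>UNIV. \<phi> (p $ j) * P i j)" for i
  proof -
    have "p $ i = (\<Sum>j\<in>UNIV. P i j *\<^sub>R p $ j)"
      using extend_field_expand[OF P(2) assms(3), of i] by (simp add: scaleR_conv_of_real)
    from arg_cong[OF this, of \<phi>] show ?thesis
      by (simp add: linear_sum[OF assms(2)] linear_cmul[OF assms(2)] mult.commute)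
  qed
  have "(\<chi> i. \<phi> (p $ i)) = (\<Sum>j\<in>UNIV. \<phi> (p $ j) *\<^sub>R (\<chi> i. P i j))"
  proof (unfold vec_eq_iff, rule allI)
    fix i show "(\<chi> i. \<phi> (p $ i)) $ i = (\<Sum>j\<in>UNIV. \<phi> (p $ j) *\<^sub>R (\<chi> i. P i j)) $ i"
      using eq[of i] by simp
  qed
  then show ?thesis using P(1) assms(1)
    by (simp add: subspace_scale subspace_sum)
qed

definition model_directions :: "(real ^ 'n) set \<Rightarrow> (real ^ 'n) set" where
  "model_directions X = {x \<in> X. (\<Sum>i\<in>UNIV. x $ i) = 0}"

text \<open>The extra coordinate \<open>None\<close> is the coordinate sum, so that the affine model is the slice where
  \<open>None\<close> has value 1 and a tropical point of the affine model is one with valuation 0 at \<open>None\<close>.\<close>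

definition model_cone :: "(real ^ 'n) set \<Rightarrow> (real ^ ('n option)) set" where
  "model_cone X = {x. (\<chi> i. x $ Some i) \<in> X \<and> x $ None = (\<Sum>i\<in>UNIV. x $ Some i)}"

lemma inner_const_vec: "(\<chi> i. c) \<bullet> x = c * (\<Sum>i\<in>UNIV. x $ i)"
  by (simp add: inner_vec_def sum_distrib_left)

lemma sum_option_UNIV:
  "(\<Sum>i\<in>UNIV. f i) = f None + (\<Sum>i\<in>UNIV. f (Some (i :: 'n::finite)))"
  by (simp add: UNIV_option_conv sum.reindex)

locale linear_model_loc =
  fixes X :: "(real ^ 'n) set" and d :: nat
  assumes linear_model: "linear_model d X"
begin

abbreviation "A \<equiv> affine_model X"
abbreviation "X0 \<equiv> model_directions X"
abbreviation "Y \<equiv> model_perp X"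

lemma subspace_X: "subspace X" using linear_model by (simp add: linear_model_def)

lemma subspace_X0: "subspace X0"
  using subspace_X unfolding model_directions_def subspace_def
  by (auto simp: sum.distrib simp flip: sum_distrib_left)

lemma subspace_model_cone: "subspace (model_cone X)"
proof -
  have "(\<chi> i. x $ Some i + y $ Some i) \<in> X" if "(\<chi> i. x $ Some i) \<in> X" "(\<chi> i. y $ Some i) \<in> X" for x y
    using subspace_add[OF subspace_X that] by (simp add: plus_vec_def)
  moreover have "(\<chi> i. c * x $ Some i) \<in> X" if "(\<chi> i. x $ Some i) \<in> X" for x c
    using subspace_scale[OF subspace_X that] by (simp add: scaleR_vec_def)
  moreover have "(\<chi> i. 0) \<in> X" using subspace_0[OF subspace_X] by (simp add: zero_vec_def)
  ultimately show ?thesis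
    unfolding model_cone_def subspace_def
    by (auto simp: sum.distrib simp flip: sum_distrib_left)
qed

lemma positive_point: obtains p where "p \<in> A" "\<And>i. p $ i > 0"
proof -
  obtain p where p: "p \<in> X" "\<And>i. p $ i > 0" using linear_model by (auto simp: linear_model_def)
  let ?s = "\<Sum>i\<in>UNIV. p $ i"
  have s: "?s > 0" using p(2) by (intro sum_pos) auto
  have "(1 / ?s) *\<^sub>R p \<in> A"
    using subspace_scale[OF subspace_X p(1)] s
    by (auto simp: affine_model_def simp flip: sum_divide_distrib)
  then show ?thesis using that[of "(1 / ?s) *\<^sub>R p"] p s by simp
qed

lemma diff_affine: "p \<in> A \<Longrightarrow> q \<in> A \<Longrightarrow> p - q \<in> X0"
  using subspace_diff[OF subspace_X] by (auto simp: affine_model_def model_directions_def sum_subtractf)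

lemma add_affine: "p \<in> A \<Longrightarrow> x \<in> X0 \<Longrightarrow> p + x \<in> A"
  using subspace_add[OF subspace_X] by (auto simp: affine_model_def model_directions_def sum.distrib)

lemma model_perp_eq: "Y = {v. \<forall>x\<in>X0. v \<bullet> x = 0}"
proof -
  obtain p where p: "p \<in> A" using positive_point by blast
  have "v \<bullet> x = 0" if "v \<in> Y" "x \<in> X0" for v x
    using that p add_affine[OF p, of x] unfolding model_perp_def
    by (metis (mono_tags, lifting) add_diff_cancel_left' mem_Collect_eq)
  moreover have "v \<in> Y" if "\<forall>x\<in>X0. v \<bullet> x = 0" for v
    using that diff_affine by (auto simp: model_perp_def)
  ultimately show ?thesis by blast
qed

lemma subspace_Y: "subspace Y"
  unfolding model_perp_eq subspace_def by (auto simp: inner_add_left)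

lemma perp_Y: assumes "\<And>y. y \<in> Y \<Longrightarrow> a \<bullet> y = 0" shows "a \<in> X0"
proof -
  have "a \<in> orthogonal_comp (orthogonal_comp X0)"
    using assms unfolding orthogonal_comp_def model_perp_eq
    by (auto simp: orthogonal_def inner_commute)
  then show ?thesis by (simp add: orthogonal_comp_self subspace_X0)
qed

lemma extend_affine_iff:
  fixes p :: "'a::real_field ^ 'n"
  shows "p \<in> extend_field A \<longleftrightarrow> p \<in> extend_field X \<and> (\<Sum>i\<in>UNIV. p $ i) = 1"
proof
  assume p: "p \<in> extend_field A"
  have "(\<Sum>i\<in>UNIV. of_real ((\<chi> i. 1) $ i) * p $ i) = of_real 1"
    by (rule in_extend_fieldD[OF p]) (simp add: affine_model_def inner_vec_def)
  then have "(\<Sum>i\<in>UNIV. p $ i) = 1" by simp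
  moreover have "p \<in> extend_field X"
    unfolding extend_field_subspace_iff[OF subspace_X]
    using in_extend_fieldD[OF p, where c = 0] by (auto simp: affine_model_def)
  ultimately show "p \<in> extend_field X \<and> (\<Sum>i\<in>UNIV. p $ i) = 1" by simp
next
  assume p: "p \<in> extend_field X \<and> (\<Sum>i\<in>UNIV. p $ i) = 1"
  obtain p0 where p0: "p0 \<in> A" using positive_point by blast
  have "(\<Sum>i\<in>UNIV. of_real (a $ i) * p $ i) = of_real c" if a: "\<forall>x\<in>A. a \<bullet> x = c" for a c
  proof -
    let ?a = "a - (\<chi> i. c)"
    have "?a \<bullet> x = 0" if x: "x \<in> X" for x
    proof -
      let ?s = "\<Sum>i\<in>UNIV. x $ i"
      have "x - ?s *\<^sub>R p0 \<in> X0"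
        using p0 x subspace_diff[OF subspace_X x subspace_scale[OF subspace_X, of p0 ?s]]
        by (auto simp: affine_model_def model_directions_def sum_subtractf simp flip: sum_distrib_left)
      then have "a \<bullet> (p0 + (x - ?s *\<^sub>R p0)) = c" using add_affine[OF p0] a by blast
      moreover have "a \<bullet> p0 = c" using a p0 by blast
      ultimately have "a \<bullet> x = ?s * c" by (simp add: inner_add_right inner_diff_right)
      then show ?thesis by (simp add: inner_diff_left inner_const_vec)
    qed
    from in_extend_fieldD[OF conjunct1[OF p] this]
    have "(\<Sum>i\<in>UNIV. of_real (a $ i) * p $ i - of_real c * p $ i) = 0"
      by (simp add: algebra_simps)
    then show ?thesis using p by (simp add: sum_subtractf flip: sum_distrib_left)
  qed
  then show "p \<in> extend_field A" unfolding extend_field_def by blast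
qed

lemma extend_cone_iff:
  fixes p :: "'a::real_field ^ 'n"
  shows "p \<in> extend_field A \<longleftrightarrow>
    (\<chi> k. case k of None \<Rightarrow> 1 | Some i \<Rightarrow> p $ i) \<in> extend_field (model_cone X)"
    (is "_ \<longleftrightarrow> ?p \<in> _")
proof
  assume p: "p \<in> extend_field A"
  show "?p \<in> extend_field (model_cone X)"
    unfolding extend_field_subspace_iff[OF subspace_model_cone]
  proof (intro allI impI)
    fix a :: "real ^ 'n option" assume a: "\<forall>x\<in>model_cone X. a \<bullet> x = 0"
    have "(\<chi> i. a $ Some i) \<bullet> x = - (a $ None)" if "x \<in> A" for x
    proof -
      have "(\<chi> k. case k of None \<Rightarrow> 1 | Some i \<Rightarrow> x $ i) \<in> model_cone X"
        using that by (simp add: affine_model_def model_cone_def)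
      from bspec[OF a this] show ?thesis by (simp add: inner_vec_def sum_option_UNIV)
    qed
    from in_extend_fieldD[OF p this]
    show "(\<Sum>i\<in>UNIV. of_real (a $ i) * ?p $ i) = 0" by (simp add: sum_option_UNIV)
  qed
next
  assume p: "?p \<in> extend_field (model_cone X)"
  have "(\<Sum>i\<in>UNIV. of_real ((\<chi> k. case k of None \<Rightarrow> - 1 | Some i \<Rightarrow> 1) $ i) * ?p $ i) = of_real 0"
    by (rule in_extend_fieldD[OF p]) (simp add: model_cone_def inner_vec_def sum_option_UNIV)
  then have "(\<Sum>i\<in>UNIV. p $ i) = 1" by (simp add: sum_option_UNIV)
  moreover have "p \<in> extend_field X"
    unfolding extend_field_subspace_iff[OF subspace_X]
  proof (intro allI impI)
    fix a :: "real ^ 'n" assume a: "\<forall>x\<in>X. a \<bullet> x = 0"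
    have "(\<Sum>i\<in>UNIV. of_real ((\<chi> k. case k of None \<Rightarrow> 0 | Some i \<Rightarrow> a $ i) $ i) * ?p $ i) = of_real 0"
    proof (rule in_extend_fieldD[OF p])
      fix x assume "x \<in> model_cone X"
      then show "(\<chi> k. case k of None \<Rightarrow> 0 | Some i \<Rightarrow> a $ i) \<bullet> x = 0"
        using bspec[OF a, of "\<chi> i. x $ Some i"]
        by (simp add: model_cone_def inner_vec_def sum_option_UNIV)
    qed
    then show "(\<Sum>i\<in>UNIV. of_real (a $ i) * p $ i) = 0" by (simp add: sum_option_UNIV)
  qed
  ultimately show "p \<in> extend_field A" by (simp add: extend_affine_iff)
qed

lemma pairing_zero:
  fixes v q :: "'a::real_field ^ 'n"
  assumes "v \<in> extend_field X0" "q \<in> extend_field Y"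
  shows "(\<Sum>i\<in>UNIV. q $ i * v $ i) = 0"
proof -
  obtain P :: "'n \<Rightarrow> 'n \<Rightarrow> real" where P: "\<And>j. (\<chi> i. P i j) \<in> X0"
      "\<And>x i. x \<in> X0 \<Longrightarrow> x $ i = (\<Sum>j\<in>UNIV. P i j * x $ j)"
    using subspace_projection_coeffs[OF subspace_X0] by metis
  have "(\<Sum>i\<in>UNIV. q $ i * v $ i) = (\<Sum>i\<in>UNIV. \<Sum>j\<in>UNIV. of_real (P i j) * q $ i * v $ j)"
    by (subst extend_field_expand[OF P(2) assms(1)]) (simp_all add: sum_distrib_left mult_ac)
  also have "\<dots> = (\<Sum>j\<in>UNIV. (\<Sum>i\<in>UNIV. of_real ((\<chi> i. P i j) $ i) * q $ i) * v $ j)"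
    by (subst sum.swap) (simp add: sum_distrib_right)
  also have "\<dots> = 0"
  proof (intro sum.neutral ballI)
    fix j
    have "(\<Sum>i\<in>UNIV. of_real ((\<chi> i. P i j) $ i) * q $ i) = of_real 0"
      by (rule in_extend_fieldD[OF assms(2)]) (use P(1)[of j] in \<open>auto simp: model_perp_eq inner_commute\<close>)
    then show "(\<Sum>i\<in>UNIV. of_real ((\<chi> i. P i j) $ i) * q $ i) * v $ j = 0" by simp
  qed
  finally show ?thesis .
qed

lemma in_extend_YI:
  fixes q :: "'a::real_field ^ 'n"
  assumes "\<And>x. x \<in> X0 \<Longrightarrow> (\<Sum>i\<in>UNIV. of_real (x $ i) * q $ i) = 0"
  shows "q \<in> extend_field Y"
  unfolding extend_field_subspace_iff[OF subspace_Y] using assms perp_Y by blast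

lemma extend_X0_iff:
  fixes p :: "'a::real_field ^ 'n"
  shows "p \<in> extend_field X0 \<longleftrightarrow> p \<in> extend_field X \<and> (\<Sum>i\<in>UNIV. p $ i) = 0"
proof
  assume p: "p \<in> extend_field X0"
  have "(\<Sum>i\<in>UNIV. of_real ((\<chi> i. 1) $ i) * p $ i) = of_real 0"
    by (rule in_extend_fieldD[OF p]) (simp add: model_directions_def inner_vec_def)
  moreover have "p \<in> extend_field X"
    unfolding extend_field_subspace_iff[OF subspace_X]
    using in_extend_fieldD[OF p, where c = 0] by (auto simp: model_directions_def)
  ultimately show "p \<in> extend_field X \<and> (\<Sum>i\<in>UNIV. p $ i) = 0" by simp
next
  assume p: "p \<in> extend_field X \<and> (\<Sum>i\<in>UNIV. p $ i) = 0"
  obtain p0 where p0: "p0 \<in> A" using positive_point by blast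
  have "(\<Sum>i\<in>UNIV. of_real (a $ i) * p $ i) = 0" if a: "\<forall>x\<in>X0. a \<bullet> x = 0" for a
  proof -
    let ?c = "a \<bullet> p0"
    let ?a = "a - (\<chi> i. ?c)"
    have "?a \<bullet> x = 0" if x: "x \<in> X" for x
    proof -
      let ?s = "\<Sum>i\<in>UNIV. x $ i"
      have "x - ?s *\<^sub>R p0 \<in> X0"
        using p0 x subspace_diff[OF subspace_X x subspace_scale[OF subspace_X, of p0 ?s]]
        by (auto simp: affine_model_def model_directions_def sum_subtractf simp flip: sum_distrib_left)
      then have "a \<bullet> x = ?s * ?c" using a by (auto simp: inner_diff_right)
      then show ?thesis by (simp add: inner_diff_left inner_const_vec)
    qed
    from in_extend_fieldD[OF conjunct1[OF p] this]
    have "(\<Sum>i\<in>UNIV. of_real (a $ i) * p $ i - of_real ?c * p $ i) = 0"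
      by (simp add: algebra_simps)
    then show ?thesis using p by (simp add: sum_subtractf flip: sum_distrib_left)
  qed
  then show "p \<in> extend_field X0" by (simp add: extend_field_subspace_iff[OF subspace_X0])
qed

lemma extend_field_diff:
  fixes p q :: "'a::real_field ^ 'i"
  assumes "subspace S" "p \<in> extend_field S" "q \<in> extend_field S"
  shows "p - q \<in> extend_field S"
  using assms by (simp add: extend_field_subspace_iff sum_subtractf right_diff_distrib)

lemma extend_field_scale:
  fixes p :: "'a::real_field ^ 'i"
  assumes "subspace S" "p \<in> extend_field S"
  shows "(\<chi> i. c * p $ i) \<in> extend_field S"
  using assms by (simp add: extend_field_subspace_iff mult.left_commute[of _ c] flip: sum_distrib_left)

lemma diff_extend_affine:
  fixes p q :: "'a::real_field ^ 'n"
  shows "p \<in> extend_field A \<Longrightarrow> q \<in> extend_field A \<Longrightarrow> p - q \<in> extend_field X0"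
  using extend_field_diff[OF subspace_X]
  by (auto simp: extend_affine_iff extend_X0_iff sum_subtractf)

lemma critical_points_iff:
  fixes p u :: "'a::real_field ^ 'n"
  shows "p \<in> critical_points X u \<longleftrightarrow>
     p \<in> extend_field A \<and> (\<forall>i. p $ i \<noteq> 0) \<and> (\<chi> i. u $ i / p $ i) \<in> extend_field Y"
proof
  assume crit: "p \<in> critical_points X u"
  then have p: "p \<in> extend_field A" "\<forall>i. p $ i \<noteq> 0" "(\<Sum>i\<in>UNIV. p $ i) = 1"
    by (auto simp: critical_points_def is_critical_point_def extend_affine_iff)
  have "(\<Sum>i\<in>UNIV. of_real (x $ i) * (u $ i / p $ i)) = 0" if x: "x \<in> X0" for x
  proof -
    let ?v = "(\<chi> i. of_real (x $ i)) :: 'a ^ 'n"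
    have "?v \<in> extend_field X"
      using extend_field_combination[OF subspace_X, of "{()}" "\<lambda>_. x" "\<lambda>_. 1"] x
      by (simp add: model_directions_def)
    moreover have "(\<Sum>i\<in>UNIV. ?v $ i) = 0"
      using x by (simp add: model_directions_def flip: of_real_sum)
    moreover have "(\<Sum>i\<in>UNIV. loglik_gradient u p $ i * ?v $ i) = 0"
      using crit calculation(1) unfolding critical_points_def is_critical_point_def by blast
    ultimately show ?thesis
      using p(3) by (simp add: loglik_gradient_def right_diff_distrib sum_subtractf mult.commute[of _ "of_real _"]
          flip: sum_distrib_right)
  qed
  then have "(\<chi> i. u $ i / p $ i) \<in> extend_field Y" by (intro in_extend_YI) simp
  then show "p \<in> extend_field A \<and> (\<forall>i. p $ i \<noteq> 0) \<and> (\<chi> i. u $ i / p $ i) \<in> extend_field Y"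
    using p by blast
next
  assume p: "p \<in> extend_field A \<and> (\<forall>i. p $ i \<noteq> 0) \<and> (\<chi> i. u $ i / p $ i) \<in> extend_field Y"
  then have p1: "p \<in> extend_field X" "(\<Sum>i\<in>UNIV. p $ i) = 1" by (simp_all add: extend_affine_iff)
  have "(\<Sum>i\<in>UNIV. loglik_gradient u p $ i * v $ i) = 0" if v: "v \<in> extend_field X" for v
  proof -
    let ?s = "\<Sum>i\<in>UNIV. v $ i"
    let ?v = "v - (\<chi> i. ?s * p $ i)"
    have "?v \<in> extend_field X"
      by (intro extend_field_diff extend_field_scale subspace_X v p1)
    moreover have "(\<Sum>i\<in>UNIV. ?v $ i) = 0" using p1 by (simp add: sum_subtractf flip: sum_distrib_left)
    ultimately have "?v \<in> extend_field X0" by (simp add: extend_X0_iff)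
    then have "(\<Sum>i\<in>UNIV. (\<chi> i. u $ i / p $ i) $ i * ?v $ i) = 0"
      using pairing_zero p by blast
    then have "(\<Sum>i\<in>UNIV. u $ i / p $ i * v $ i) = (\<Sum>i\<in>UNIV. u $ i / p $ i * (?s * p $ i))"
      by (simp add: right_diff_distrib sum_subtractf)
    also have "\<dots> = (\<Sum>i\<in>UNIV. u $ i * ?s)" using p by (intro sum.cong) auto
    finally show ?thesis using p1
      by (simp add: loglik_gradient_def left_diff_distrib sum_subtractf
          flip: sum_distrib_left sum_distrib_right)
  qed
  then show "p \<in> critical_points X u"
    using p p1 by (simp add: critical_points_def is_critical_point_def)
qed

lemma extend_field_of_real:
  fixes S :: "(real ^ 'i) set"
  assumes "x \<in> S"
  shows "(\<chi> i. of_real (x $ i)) \<in> (extend_field S :: ('a::real_field ^ 'i) set)"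
proof -
  have "(\<Sum>i\<in>UNIV. of_real (a $ i) * of_real (x $ i)) = (of_real (a \<bullet> x) :: 'a)" for a
    by (simp add: inner_vec_def)
  then show ?thesis using assms by (auto simp: extend_field_def)
qed

lemma dim_model_cone_perp: "dim (model_cone X) + dim Y \<le> CARD('n) + 1"
proof -
  let ?h = "\<lambda>x :: real ^ 'n. (\<chi> k. case k of None \<Rightarrow> \<Sum>i\<in>UNIV. x $ i | Some i \<Rightarrow> x $ i) :: real ^ 'n option"
  have lin: "linear ?h"
    by (intro linearI) (auto simp: vec_eq_iff sum.distrib sum_distrib_left split: option.split)
  have "model_cone X \<subseteq> ?h ` X"
  proof
    fix x assume x: "x \<in> model_cone X"
    then have "x = ?h (\<chi> i. x $ Some i)"
      by (auto simp: vec_eq_iff model_cone_def split: option.split)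
    then show "x \<in> ?h ` X" using x by (auto simp: model_cone_def)
  qed
  then have "dim (model_cone X) \<le> dim (?h ` X)" by (rule dim_subset)
  also have "\<dots> \<le> dim X" by (rule dim_image_le[OF lin])
  finally have 1: "dim (model_cone X) \<le> dim X" .
  obtain p0 where p0: "p0 \<in> A" using positive_point by blast
  have "X \<subseteq> span (insert p0 X0)"
  proof
    fix x assume x: "x \<in> X"
    let ?s = "\<Sum>i\<in>UNIV. x $ i"
    have "x - ?s *\<^sub>R p0 \<in> X0"
      using p0 x subspace_diff[OF subspace_X x subspace_scale[OF subspace_X, of p0 ?s]]
      by (auto simp: affine_model_def model_directions_def sum_subtractf simp flip: sum_distrib_left)
    then have "x - ?s *\<^sub>R p0 \<in> span (insert p0 X0)" by (simp add: span_base)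
    moreover have "?s *\<^sub>R p0 \<in> span (insert p0 X0)" by (simp add: span_base span_scale)
    ultimately have "(x - ?s *\<^sub>R p0) + ?s *\<^sub>R p0 \<in> span (insert p0 X0)" by (rule span_add)
    then show "x \<in> span (insert p0 X0)" by simp
  qed
  then have "dim X \<le> dim (insert p0 X0)" by (metis dim_span dim_subset)
  also have "\<dots> \<le> dim X0 + 1" by (simp add: dim_insert)
  finally have 2: "dim X \<le> dim X0 + 1" .
  have "Y = {y \<in> UNIV. \<forall>x\<in>X0. orthogonal x y}"
    by (auto simp: model_perp_eq orthogonal_def inner_commute)
  then have "dim Y + dim X0 = CARD('n)"
    using dim_subspace_orthogonal_to_vectors[OF subspace_X0 subspace_UNIV] by simp
  then show ?thesis using 1 2 by simp
qed

end

section \<open>Positive real data\<close>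

text \<open>The sign vectors of the bounded regions of the arrangement \<open>p\<^sub>i = 0\<close> in the affine model:
  a region is bounded if and only if some \<open>q\<close> orthogonal to all directions of the model has the
  same signs.\<close>

definition bounded_signs :: "(real ^ 'n) set \<Rightarrow> ('n \<Rightarrow> bool) set" where
  "bounded_signs X = {\<sigma>. \<exists>p\<in>affine_model X. \<exists>q\<in>model_perp X.
     \<forall>i. p $ i \<noteq> 0 \<and> q $ i \<noteq> 0 \<and> (0 < p $ i \<longleftrightarrow> \<sigma> i) \<and> (0 < q $ i \<longleftrightarrow> \<sigma> i)}"

context linear_model_loc
begin

lemma real_critical_unique:
  assumes u: "\<And>i. u $ i > 0"
    and p: "p \<in> A" "\<And>i. p $ i \<noteq> 0" "(\<chi> i. u $ i / p $ i) \<in> Y"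
    and p': "p' \<in> A" "\<And>i. p' $ i \<noteq> 0" "(\<chi> i. u $ i / p' $ i) \<in> Y"
    and signs: "\<And>i. 0 < p $ i \<longleftrightarrow> 0 < p' $ i"
  shows "p = p'"
proof -
  have "((\<chi> i. u $ i / p' $ i) - (\<chi> i. u $ i / p $ i)) \<bullet> (p - p') = 0"
    using subspace_diff[OF subspace_Y p'(3) p(3)] diff_affine[OF p(1) p'(1)]
    by (simp add: model_perp_eq)
  then have sum0: "(\<Sum>i\<in>UNIV. (u $ i / p' $ i - u $ i / p $ i) * (p $ i - p' $ i)) = 0"
    by (simp add: inner_vec_def)
  have eq: "(u $ i / p' $ i - u $ i / p $ i) * (p $ i - p' $ i)
      = u $ i * (p $ i - p' $ i)^2 / (p $ i * p' $ i)" for i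
    using p(2)[of i] p'(2)[of i] by (simp add: field_simps power2_eq_square)
  have pos: "p $ i * p' $ i > 0" for i
    using signs[of i] p(2)[of i] p'(2)[of i] by (auto simp: zero_less_mult_iff linorder_neq_iff)
  have "(u $ i / p' $ i - u $ i / p $ i) * (p $ i - p' $ i) \<ge> 0" for i
    unfolding eq using pos[of i] u[of i] by (intro divide_nonneg_pos mult_nonneg_nonneg) auto
  then have "(u $ i / p' $ i - u $ i / p $ i) * (p $ i - p' $ i) = 0" for i
    using sum0 by (subst (asm) sum_nonneg_eq_0_iff) auto
  then have "u $ i * (p $ i - p' $ i)^2 / (p $ i * p' $ i) = 0" for i
    unfolding eq .
  then have "p $ i = p' $ i" for i
    using u[of i] pos[of i] by (metis divide_eq_0_iff eq_iff_diff_eq_0 less_irrefl mult_eq_0_iff zero_eq_power2)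
  then show ?thesis by (simp add: vec_eq_iff)
qed

lemma real_critical_exists:
  assumes u: "\<And>i. u $ i > 0" and \<sigma>: "\<sigma> \<in> bounded_signs X"
  obtains p where "p \<in> A" "\<And>i. p $ i \<noteq> 0" "\<And>i. 0 < p $ i \<longleftrightarrow> \<sigma> i" "(\<chi> i. u $ i / p $ i) \<in> Y"
proof -
  obtain p0 q0 where p0: "p0 \<in> A" "\<And>i. p0 $ i \<noteq> 0" "\<And>i. 0 < p0 $ i \<longleftrightarrow> \<sigma> i"
    and q0: "q0 \<in> Y" "\<And>i. q0 $ i \<noteq> 0" "\<And>i. 0 < q0 $ i \<longleftrightarrow> \<sigma> i"
    using \<sigma> by (auto simp: bounded_signs_def)
  define s :: "'n \<Rightarrow> real" where "s = (\<lambda>i. if \<sigma> i then 1 else - 1)"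
  have ss: "s i * s i = 1" for i by (simp add: s_def)
  have sp0: "s i * p0 $ i > 0" for i
    using p0(2,3)[of i] by (auto simp: s_def)
  have sq0: "s i * q0 $ i > 0" for i
    using q0(2,3)[of i] by (auto simp: s_def)
  define C where "C = {p \<in> A. \<forall>i. s i * p $ i \<ge> 0}"
  define F where "F = (\<lambda>p :: real ^ 'n. \<Prod>i\<in>UNIV. (s i * p $ i) powr (u $ i))"
  have "C = X \<inter> {p. (\<Sum>i\<in>UNIV. p $ i) = 1} \<inter> (\<Inter>i. {p. s i * p $ i \<ge> 0})"
    by (auto simp: C_def affine_model_def)
  moreover have "closed {p :: real ^ 'n. (\<Sum>i\<in>UNIV. p $ i) = 1}"
    by (intro closed_Collect_eq continuous_intros)
  moreover have "closed {p :: real ^ 'n. s i * p $ i \<ge> 0}" for i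
    by (intro closed_Collect_le continuous_intros)
  ultimately have "closed C" using closed_subspace[OF subspace_X] by auto
  moreover have "bounded C"
  proof -
    have "norm p \<le> (\<Sum>i\<in>UNIV. (q0 \<bullet> p0) / (s i * q0 $ i))" if p: "p \<in> C" for p
    proof -
      have "q0 \<bullet> (p - p0) = 0" using p q0(1) diff_affine[of p p0] p0(1)
        by (simp add: C_def model_perp_eq)
      then have eq: "q0 \<bullet> p0 = (\<Sum>i\<in>UNIV. (s i * q0 $ i) * (s i * p $ i))"
      proof -
        have "(s i * q0 $ i) * (s i * p $ i) = q0 $ i * p $ i" for i
          using ss[of i] by (metis mult.left_commute mult.right_neutral mult.assoc)
        then have "(\<Sum>i\<in>UNIV. (s i * q0 $ i) * (s i * p $ i)) = q0 \<bullet> p"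
          by (simp only: inner_vec_def inner_real_def)
        then show ?thesis using \<open>q0 \<bullet> (p - p0) = 0\<close> by (simp add: inner_diff_right)
      qed
      have "\<bar>p $ i\<bar> \<le> (q0 \<bullet> p0) / (s i * q0 $ i)" for i
      proof -
        have "(s i * q0 $ i) * (s i * p $ i) \<le> q0 \<bullet> p0"
          unfolding eq using p sq0 by (intro member_le_sum) (auto simp: C_def less_imp_le)
        then have "s i * p $ i \<le> (q0 \<bullet> p0) / (s i * q0 $ i)"
          using sq0[of i] by (simp add: field_simps)
        moreover have "s i * p $ i = \<bar>p $ i\<bar>" using p by (auto simp: C_def s_def split: if_splits) 
        ultimately show ?thesis by simp
      qed
      then show ?thesis by (intro order_trans[OF norm_le_l1_cart] sum_mono) auto
    qed
    then show ?thesis by (auto simp: bounded_iff)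
  qed
  ultimately have "compact C" by (simp add: compact_eq_bounded_closed)
  moreover have "p0 \<in> C" using p0(1) sp0 by (auto simp: C_def less_imp_le)
  moreover have "continuous_on C F"
    unfolding F_def by (intro continuous_intros continuous_on_powr') (use u in \<open>auto simp: C_def\<close>)
  ultimately obtain p where p: "p \<in> C" "\<And>y. y \<in> C \<Longrightarrow> F y \<le> F p"
    using continuous_attains_sup[of C F] by auto
  have "F p0 > 0" using sp0 unfolding F_def
    by (intro prod_pos) (metis powr_gt_zero less_irrefl)
  then have "F p > 0" using p(2)[OF \<open>p0 \<in> C\<close>] by simp
  then have "F p \<noteq> 0" by simp
  then have "(s i * p $ i) powr (u $ i) \<noteq> 0" for i unfolding F_def by (subst (asm) prod_zero_iff) auto
  then have sp: "s i * p $ i > 0" for i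
    using p(1) by (auto simp: C_def less_le)
  then have pnz: "p $ i \<noteq> 0" for i by (metis less_irrefl mult_zero_right)
  have "(\<chi> i. u $ i / p $ i) \<bullet> x = 0" if x: "x \<in> X0" for x
  proof -
    have "\<forall>\<^sub>F \<tau> in nhds 0. \<forall>i\<in>UNIV. s i * (p $ i + \<tau> * x $ i) > 0"
    proof (intro eventually_ball_finite ballI)
      fix i
      have "((\<lambda>\<tau>. s i * (p $ i + \<tau> * x $ i)) \<longlongrightarrow> s i * (p $ i + 0 * x $ i)) (nhds 0)"
        by (intro tendsto_intros filterlim_ident)
      then show "\<forall>\<^sub>F \<tau> in nhds 0. s i * (p $ i + \<tau> * x $ i) > 0"
        using sp[of i] by (intro order_tendstoD(1)) auto
    qed simp
    then obtain \<delta> where \<delta>: "\<delta> > 0" "\<And>\<tau> i. \<bar>\<tau>\<bar> < \<delta> \<Longrightarrow> s i * (p $ i + \<tau> * x $ i) > 0"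
      unfolding eventually_nhds_metric by (auto simp: dist_real_def)
    define g where "g = (\<lambda>\<tau>. \<Sum>i\<in>UNIV. u $ i * ln (s i * (p $ i + \<tau> * x $ i)))"
    have gF: "F (p + \<tau> *\<^sub>R x) = exp (g \<tau>)" if "\<bar>\<tau>\<bar> < \<delta>" for \<tau>
    proof -
      have "(s i * (p + \<tau> *\<^sub>R x) $ i) powr u $ i = exp (u $ i * ln (s i * (p $ i + \<tau> * x $ i)))" for i
        using \<delta>(2)[OF that, of i] by (auto simp: powr_def)
      then show ?thesis by (simp add: F_def g_def exp_sum)
    qed
    have "(g has_real_derivative (\<Sum>i\<in>UNIV. u $ i * (s i * x $ i / (s i * p $ i)))) (at 0)"
      unfolding g_def using sp
      by (auto intro!: derivative_eq_intros sum.cong simp: mult.commute)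
    moreover have "\<forall>\<tau>. \<bar>0 - \<tau>\<bar> < \<delta> \<longrightarrow> g \<tau> \<le> g 0"
    proof (intro allI impI)
      fix \<tau> :: real assume "\<bar>0 - \<tau>\<bar> < \<delta>"
      then have \<tau>: "\<bar>\<tau>\<bar> < \<delta>" by simp
      have "\<tau> *\<^sub>R x \<in> X0" using x subspace_scale[OF subspace_X0] by blast
      then have "p + \<tau> *\<^sub>R x \<in> C"
        using p(1) add_affine[of p "\<tau> *\<^sub>R x"] \<delta>(2)[OF \<tau>] by (auto simp: C_def less_imp_le)
      from p(2)[OF this] gF[OF \<tau>] gF[of 0] \<delta>(1) show "g \<tau> \<le> g 0" by simp
    qed
    ultimately have "(\<Sum>i\<in>UNIV. u $ i * (s i * x $ i / (s i * p $ i))) = 0"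
      using DERIV_local_max \<delta>(1) by blast
    moreover have "u $ i * (s i * x $ i / (s i * p $ i)) = u $ i / p $ i * x $ i" for i
      by (simp add: s_def)
    ultimately show ?thesis by (simp add: inner_vec_def)
  qed
  then have "(\<chi> i. u $ i / p $ i) \<in> Y" by (simp add: model_perp_eq)
  moreover have "0 < p $ i \<longleftrightarrow> \<sigma> i" for i using sp[of i] by (auto simp: s_def split: if_splits)
  ultimately show ?thesis using that p(1) pnz by (auto simp: C_def)
qed

lemma critical_point_real:
  fixes u :: "real ^ 'n"
  assumes u: "\<And>i. u $ i > 0" and p: "p \<in> critical_points X (\<chi> i. complex_of_real (u $ i))"
  shows "Im (p $ i) = 0"
proof -
  have p1: "p \<in> extend_field X" "(\<Sum>i\<in>UNIV. p $ i) = 1" "\<And>i. p $ i \<noteq> 0"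
    "(\<chi> i. u $ i / p $ i) \<in> extend_field Y"
    using p by (auto simp: critical_points_iff extend_affine_iff)
  let ?b = "\<chi> i. Im (p $ i)"
  have "linear Im" by (simp add: bounded_linear.linear bounded_linear_Im)
  from real_linear_image_extend_field[OF subspace_X this p1(1)] have "?b \<in> X" .
  moreover have "(\<Sum>i\<in>UNIV. ?b $ i) = 0" using arg_cong[OF p1(2), of Im] by simp
  ultimately have "?b \<in> X0" by (simp add: model_directions_def)
  from pairing_zero[OF extend_field_of_real[OF this] p1(4)]
  have "(\<Sum>i\<in>UNIV. u $ i / p $ i * Im (p $ i)) = 0" by simp
  from arg_cong[OF this, of "\<lambda>z. - Im z"]
  have "(\<Sum>i\<in>UNIV. - Im (u $ i / p $ i * Im (p $ i))) = 0" by (simp add: sum_negf)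
  moreover have "Im (u $ i / p $ i * Im (p $ i)) = Im (u $ i / p $ i) * Im (p $ i)" for i
  proof -
    have "Im (z * complex_of_real b) = Im z * b" for z b by simp
    then show ?thesis .
  qed
  moreover have eq: "- (Im (u $ i / p $ i) * Im (p $ i)) = u $ i * (Im (p $ i))\<^sup>2 / (cmod (p $ i))\<^sup>2" for i
    unfolding cmod_power2 by (simp add: Im_divide power2_eq_square)
  ultimately have "(\<Sum>i\<in>UNIV. u $ i * (Im (p $ i))\<^sup>2 / (cmod (p $ i))\<^sup>2) = 0"
    by (simp only: )
  then have "u $ i * (Im (p $ i))\<^sup>2 / (cmod (p $ i))\<^sup>2 = 0"
    using u by (subst (asm) sum_nonneg_eq_0_iff) (auto simp: less_imp_le)
  then show ?thesis using u[of i] p1(3)[of i] by auto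
qed

lemma card_critical_points_positive:
  fixes u :: "real ^ 'n"
  assumes u: "\<And>i. u $ i > 0"
  shows "finite (critical_points X (\<chi> i. complex_of_real (u $ i)))"
    "card (critical_points X (\<chi> i. complex_of_real (u $ i))) = card (bounded_signs X)"
proof -
  let ?C = "critical_points X (\<chi> i. complex_of_real (u $ i))"
  define R where "R = {p \<in> A. (\<forall>i. p $ i \<noteq> 0) \<and> (\<chi> i. u $ i / p $ i) \<in> Y}"
  let ?re = "\<lambda>p :: complex ^ 'n. \<chi> i. Re (p $ i)"
  have lin: "linear Re" by (simp add: bounded_linear.linear bounded_linear_Re)
  have re: "p = (\<chi> i. complex_of_real (?re p $ i))" if "p \<in> ?C" for p
    using critical_point_real[OF u that] by (simp add: vec_eq_iff complex_eq_iff)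
  have "?re p \<in> R" if p: "p \<in> ?C" for p
  proof -
    have p1: "p \<in> extend_field X" "(\<Sum>i\<in>UNIV. p $ i) = 1" "\<And>i. p $ i \<noteq> 0"
      "(\<chi> i. u $ i / p $ i) \<in> extend_field Y"
      using p by (auto simp: critical_points_iff extend_affine_iff)
    have "?re p \<in> A" using real_linear_image_extend_field[OF subspace_X lin p1(1)] arg_cong[OF p1(2), of Re]
      by (simp add: affine_model_def)
    moreover have "Re (p $ i) \<noteq> 0" for i
      using p1(3)[of i] critical_point_real[OF u p, of i] by (auto simp: complex_eq_iff)
    moreover have "(\<chi> i. Re (u $ i / p $ i)) \<in> Y"
      using real_linear_image_extend_field[OF subspace_Y lin p1(4)] by simp
    moreover have "Re (u $ i / p $ i) = u $ i / Re (p $ i)" for i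
      using critical_point_real[OF u p, of i] by (simp add: Re_divide power2_eq_square)
    ultimately show ?thesis by (simp add: R_def)
  qed
  moreover have "(\<chi> i. complex_of_real (p $ i)) \<in> ?C" if "p \<in> R" for p
    using that extend_field_of_real[of p A, where 'a = complex]
      extend_field_of_real[of "\<chi> i. u $ i / p $ i" Y, where 'a = complex]
    by (simp add: R_def critical_points_iff)
  ultimately have 1: "bij_betw ?re ?C R"
    using re by (intro bij_betw_byWitness[where f' = "\<lambda>p. \<chi> i. complex_of_real (p $ i)"]) (auto simp: vec_eq_iff)
  have 2: "bij_betw (\<lambda>p i. 0 < p $ i) R (bounded_signs X)"
    unfolding bij_betw_def
  proof
    show "inj_on (\<lambda>p i. 0 < p $ i) R"
      using real_critical_unique[OF u] by (auto simp: inj_on_def R_def fun_eq_iff)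
    show "(\<lambda>p i. 0 < p $ i) ` R = bounded_signs X"
    proof
      have "(\<lambda>i. 0 < p $ i) \<in> bounded_signs X" if "p \<in> R" for p
      proof -
        have "(\<chi> i. u $ i / p $ i) $ i \<noteq> 0 \<and> (0 < (\<chi> i. u $ i / p $ i) $ i \<longleftrightarrow> 0 < p $ i)" for i
          using that u[of i] by (auto simp: R_def zero_less_divide_iff less_imp_neq[symmetric])
        then show ?thesis using that unfolding bounded_signs_def R_def by blast
      qed
      then show "(\<lambda>p i. 0 < p $ i) ` R \<subseteq> bounded_signs X" by blast
      show "bounded_signs X \<subseteq> (\<lambda>p i. 0 < p $ i) ` R"
      proof
        fix \<sigma> assume "\<sigma> \<in> bounded_signs X"
        from real_critical_exists[OF u this] obtain p
          where "p \<in> A" "\<And>i. p $ i \<noteq> 0" "\<And>i. 0 < p $ i \<longleftrightarrow> \<sigma> i" "(\<chi> i. u $ i / p $ i) \<in> Y"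
          by metis
        then show "\<sigma> \<in> (\<lambda>p i. 0 < p $ i) ` R"
          by (intro image_eqI[of _ _ p]) (auto simp: R_def)
      qed
    qed
  qed
  have 3: "bij_betw ((\<lambda>p i. 0 < p $ i) \<circ> ?re) ?C (bounded_signs X)"
    using bij_betw_trans[OF 1 2] .
  have "finite (bounded_signs X)" by (rule finite)
  then show "finite ?C" using bij_betw_finite[OF 3] by blast
  show "card ?C = card (bounded_signs X)" using bij_betw_same_card[OF 3] .
qed

end

section \<open>Algebraic dependence of polynomial functions\<close>

lemma homogeneous_system_nontrivial_solution:
  fixes M :: "'j \<Rightarrow> 'i \<Rightarrow> 'a::field"
  assumes "finite J" "finite I" "card J < card I"
  shows "\<exists>c. (\<exists>i\<in>I. c i \<noteq> 0) \<and> (\<forall>j\<in>J. (\<Sum>i\<in>I. M j i * c i) = 0)"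
  using assms
proof (induction J arbitrary: I M rule: finite_induct)
  case empty
  then obtain i where "i \<in> I" by fastforce
  then show ?case by (intro exI[of _ "\<lambda>_. 1"]) auto
next
  case (insert j J)
  show ?case
  proof (cases "\<forall>i\<in>I. M j i = 0")
    case True
    obtain c where "\<exists>i\<in>I. c i \<noteq> 0" "\<forall>j\<in>J. (\<Sum>i\<in>I. M j i * c i) = 0"
      using insert.IH[of I M] insert.prems insert.hyps by auto
    then show ?thesis using True by (intro exI[of _ c]) auto
  next
    case False
    then obtain i0 where i0: "i0 \<in> I" "M j i0 \<noteq> 0" by blast
    let ?I = "I - {i0}"
    have "card J < card ?I" using insert.prems insert.hyps i0 by simp
    then obtain c where c: "\<exists>i\<in>?I. c i \<noteq> 0"
        "\<forall>k\<in>J. (\<Sum>i\<in>?I. (M k i - M k i0 * M j i / M j i0) * c i) = 0"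
      using insert.IH[of ?I "\<lambda>k i. M k i - M k i0 * M j i / M j i0"] insert.prems by auto
    define s where "s = (\<Sum>i\<in>?I. M j i * c i)"
    define c' where "c' = c(i0 := - s / M j i0)"
    have split: "(\<Sum>i\<in>I. M k i * c' i) = M k i0 * (- s / M j i0) + (\<Sum>i\<in>?I. M k i * c i)" for k
      using insert.prems i0 by (subst sum.remove[of I i0]) (auto simp: c'_def)
    have "(\<Sum>i\<in>I. M k i * c' i) = 0" if "k \<in> J" for k
    proof -
      have "(\<Sum>i\<in>?I. (M k i - M k i0 * M j i / M j i0) * c i) =
          (\<Sum>i\<in>?I. M k i * c i) - M k i0 / M j i0 * s"
        unfolding s_def sum_distrib_left sum_subtractf[symmetric]
        by (intro sum.cong refl) (simp add: algebra_simps)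
      then show ?thesis using c(2) that by (simp add: split)
    qed
    moreover have "(\<Sum>i\<in>I. M j i * c' i) = 0"
      using i0 by (simp add: split s_def)
    moreover have "\<exists>i\<in>I. c' i \<noteq> 0" using c(1) by (auto simp: c'_def)
    ultimately show ?thesis by auto
  qed
qed

lemma complex_polynomial_sum:
  "finite I \<Longrightarrow> (\<And>i. i \<in> I \<Longrightarrow> complex_polynomial (f i)) \<Longrightarrow> complex_polynomial (\<lambda>x. \<Sum>i\<in>I. f i x)"
  by (induction I rule: finite_induct) (auto intro: complex_polynomial.intros)

lemma complex_polynomial_prod:
  "finite I \<Longrightarrow> (\<And>i. i \<in> I \<Longrightarrow> complex_polynomial (f i)) \<Longrightarrow> complex_polynomial (\<lambda>x. \<Prod>i\<in>I. f i x)"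
  by (induction I rule: finite_induct) (auto intro: complex_polynomial.intros)

lemma complex_polynomial_power:
  "complex_polynomial f \<Longrightarrow> complex_polynomial (\<lambda>x. f x ^ k)"
  by (induction k) (auto intro: complex_polynomial.intros)

lemma complex_polynomial_on_line:
  assumes "complex_polynomial f"
  shows "\<exists>P. \<forall>s. f (\<chi> i. a i + s * b i) = poly P s"
  using assms
proof induction
  case (const c)
  show ?case by (intro exI[of _ "[:c:]"]) simp
next
  case (coord i)
  show ?case by (intro exI[of _ "[:a i, b i:]"]) simp
next
  case (add f g)
  then obtain P Q where "\<forall>s. f (\<chi> i. a i + s * b i) = poly P s" "\<forall>s. g (\<chi> i. a i + s * b i) = poly Q s"
    by blast
  then show ?case by (intro exI[of _ "P + Q"]) simp
next
  case (mult f g)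
  then obtain P Q where "\<forall>s. f (\<chi> i. a i + s * b i) = poly P s" "\<forall>s. g (\<chi> i. a i + s * b i) = poly Q s"
    by blast
  then show ?case by (intro exI[of _ "P * Q"]) simp
qed

lemma complex_polynomial_common_nonzero:
  fixes f g :: "complex ^ 'n \<Rightarrow> complex"
  assumes "complex_polynomial f" "complex_polynomial g" "f a \<noteq> 0" "g b \<noteq> 0"
  shows "\<exists>x. f x \<noteq> 0 \<and> g x \<noteq> 0"
proof -
  obtain P where P: "\<And>s. f (\<chi> i. a $ i + s * (b $ i - a $ i)) = poly P s"
    using complex_polynomial_on_line[OF assms(1), of "\<lambda>i. a $ i" "\<lambda>i. b $ i - a $ i"] by blast
  obtain Q where Q: "\<And>s. g (\<chi> i. a $ i + s * (b $ i - a $ i)) = poly Q s"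
    using complex_polynomial_on_line[OF assms(2), of "\<lambda>i. a $ i" "\<lambda>i. b $ i - a $ i"] by blast
  have "poly P 0 \<noteq> 0" "poly Q 1 \<noteq> 0" using P[of 0] Q[of 1] assms by simp_all
  then have "P * Q \<noteq> 0" by auto
  then obtain s where "poly (P * Q) s \<noteq> 0" using poly_all_0_iff_0 by blast
  then have "poly P s \<noteq> 0" "poly Q s \<noteq> 0" by auto
  then show ?thesis unfolding P[symmetric] Q[symmetric] by blast
qed

lemma complex_polynomial_positive_nonzero:
  fixes f :: "complex ^ 'n \<Rightarrow> complex"
  assumes "complex_polynomial f" "f a \<noteq> 0"
  shows "\<exists>x :: real ^ 'n. (\<forall>i. x $ i > 0) \<and> f (\<chi> i. of_real (x $ i)) \<noteq> 0"
proof -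
  have "\<exists>a. f a \<noteq> 0 \<and> (\<forall>i\<in>S. a $ i \<in> \<real> \<and> Re (a $ i) > 0)" if "finite S" for S :: "'n set"
    using that
  proof (induction S rule: finite_induct)
    case empty
    then show ?case using assms by blast
  next
    case (insert e S)
    then obtain a where a: "f a \<noteq> 0" "\<forall>i\<in>S. a $ i \<in> \<real> \<and> Re (a $ i) > 0" by blast
    obtain P where P: "\<And>s. f (\<chi> i. a $ i + s * (if i = e then 1 else 0)) = poly P s"
      using complex_polynomial_on_line[OF assms(1), of "\<lambda>i. a $ i" "\<lambda>i. if i = e then 1 else 0"] by blast
    have "poly P 0 \<noteq> 0" using P[of 0] a by simp
    then have "P \<noteq> 0" by auto
    then have "finite {s. poly P s = 0}" by (rule poly_roots_finite)
    moreover have "infinite ((\<lambda>r. complex_of_real r - a $ e) ` {0<..})"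
      by (subst finite_image_iff) (auto simp: inj_on_def infinite_Ioi)
    ultimately have "\<not> (\<lambda>r. complex_of_real r - a $ e) ` {0<..} \<subseteq> {s. poly P s = 0}"
      using finite_subset by blast
    then obtain r where r: "r > 0" "poly P (complex_of_real r - a $ e) \<noteq> 0" by blast
    let ?b = "\<chi> i. a $ i + (complex_of_real r - a $ e) * (if i = e then 1 else 0)"
    have "f ?b \<noteq> 0" using r(2) unfolding P[symmetric] .
    moreover have "\<forall>i\<in>insert e S. ?b $ i \<in> \<real> \<and> Re (?b $ i) > 0"
      using a(2) r(1) by auto
    ultimately show ?case by blast
  qed
  from this[of UNIV] obtain a where a: "f a \<noteq> 0" "\<forall>i. a $ i \<in> \<real> \<and> Re (a $ i) > 0" by auto
  have "(\<chi> i. complex_of_real ((\<chi> i. Re (a $ i)) $ i)) = a" using a(2) by (simp add: vec_eq_iff)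
  then show ?thesis using a by (intro exI[of _ "\<chi> i. Re (a $ i)"]) auto
qed

definition multi_monom :: "('n \<Rightarrow> nat) \<Rightarrow> complex ^ 'n \<Rightarrow> complex" where
  "multi_monom \<alpha> x = (\<Prod>i\<in>UNIV. (x $ i) ^ \<alpha> i)"

definition exponents_le :: "nat \<Rightarrow> ('n::finite \<Rightarrow> nat) set" where
  "exponents_le k = {\<alpha>. \<forall>i. \<alpha> i \<le> k}"

definition degree_le :: "nat \<Rightarrow> (complex ^ 'n \<Rightarrow> complex) \<Rightarrow> bool" where
  "degree_le k f \<longleftrightarrow> (\<exists>c. \<forall>x. f x = (\<Sum>\<alpha>\<in>exponents_le k. c \<alpha> * multi_monom \<alpha> x))"

lemma exponents_le_eq: "exponents_le k = PiE UNIV (\<lambda>_. {..k})"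
  by (auto simp: exponents_le_def PiE_def)

lemma finite_exponents_le [simp]: "finite (exponents_le k)"
  unfolding exponents_le_eq by (intro finite_PiE) auto

lemma card_exponents_le: "card (exponents_le k :: ('n::finite \<Rightarrow> nat) set) = (k + 1) ^ CARD('n)"
  unfolding exponents_le_eq by (subst card_PiE) auto

lemma exponents_le_mono: "k \<le> l \<Longrightarrow> exponents_le k \<subseteq> exponents_le l"
  by (auto simp: exponents_le_def intro: order_trans)

lemma degree_leI:
  "(\<And>x. f x = (\<Sum>\<alpha>\<in>exponents_le k. c \<alpha> * multi_monom \<alpha> x)) \<Longrightarrow> degree_le k f"
  unfolding degree_le_def by blast

lemma degree_le_mono: assumes "degree_le k f" "k \<le> l" shows "degree_le l f"
proof -
  obtain c where c: "\<And>x. f x = (\<Sum>\<alpha>\<in>exponents_le k. c \<alpha> * multi_monom \<alpha> x)"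
    using assms by (auto simp: degree_le_def)
  have "f x = (\<Sum>\<alpha>\<in>exponents_le l. (if \<alpha> \<in> exponents_le k then c \<alpha> else 0) * multi_monom \<alpha> x)" for x
    unfolding c by (intro sum.mono_neutral_cong_left exponents_le_mono assms) auto
  then show ?thesis by (rule degree_leI)
qed

lemma degree_le_const: "degree_le 0 (\<lambda>_ :: complex ^ 'n. c)"
proof -
  have "exponents_le 0 = {\<lambda>_ :: 'n. 0}" by (auto simp: exponents_le_def)
  then have "(\<Sum>\<alpha>\<in>exponents_le 0. c * multi_monom \<alpha> x) = c" for x :: "complex ^ 'n"
    by (simp only:) (simp add: multi_monom_def)
  then show ?thesis by (intro degree_leI[where c = "\<lambda>_. c"]) simp
qed

lemma degree_le_coord: "degree_le 1 (\<lambda>x. x $ i)"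
proof -
  have m: "multi_monom (\<lambda>j. if j = i then 1 else 0) x = x $ i" for x
    unfolding multi_monom_def
    by (subst prod.cong[OF refl, of _ _ "\<lambda>j. if j = i then x $ j else 1"]) auto
  have "(\<Sum>\<alpha>\<in>exponents_le 1. (if \<alpha> = (\<lambda>j. if j = i then 1 else 0) then 1 else 0) * multi_monom \<alpha> x)
      = (\<Sum>\<alpha>\<in>exponents_le 1. if \<alpha> = (\<lambda>j. if j = i then 1 else 0) then x $ i else 0)" for x
    using m by (intro sum.cong) auto
  also have "\<dots> x = x $ i" for x by (subst sum.delta[OF finite_exponents_le]) (auto simp: exponents_le_def)
  finally show ?thesis
    by (intro degree_leI[where c = "\<lambda>\<alpha>. if \<alpha> = (\<lambda>j. if j = i then 1 else 0) then 1 else 0"]) simp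
qed

lemma degree_le_add: assumes "degree_le k f" "degree_le k g" shows "degree_le k (\<lambda>x. f x + g x)"
proof -
  obtain c d where "\<And>x. f x = (\<Sum>\<alpha>\<in>exponents_le k. c \<alpha> * multi_monom \<alpha> x)"
     "\<And>x. g x = (\<Sum>\<alpha>\<in>exponents_le k. d \<alpha> * multi_monom \<alpha> x)"
    using assms by (auto simp: degree_le_def)
  then show ?thesis unfolding degree_le_def
    by (intro exI[of _ "\<lambda>\<alpha>. c \<alpha> + d \<alpha>"]) (simp add: distrib_right sum.distrib)
qed

lemma degree_le_mult: assumes "degree_le k f" "degree_le l g" shows "degree_le (k + l) (\<lambda>x. f x * g x)"
proof -
  obtain c d where c: "\<And>x. f x = (\<Sum>\<alpha>\<in>exponents_le k. c \<alpha> * multi_monom \<alpha> x)"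
     and d: "\<And>x. g x = (\<Sum>\<alpha>\<in>exponents_le l. d \<alpha> * multi_monom \<alpha> x)"
    using assms by (auto simp: degree_le_def)
  let ?E = "exponents_le k \<times> exponents_le l :: (('a \<Rightarrow> nat) \<times> ('a \<Rightarrow> nat)) set"
  let ?s = "\<lambda>p. (\<lambda>i. fst p i + snd p i) :: 'a \<Rightarrow> nat"
  have "f x * g x = (\<Sum>\<gamma>\<in>exponents_le (k + l). (\<Sum>p\<in>{p\<in>?E. ?s p = \<gamma>}. c (fst p) * d (snd p)) * multi_monom \<gamma> x)" for x
  proof -
    have "f x * g x = (\<Sum>p\<in>?E. c (fst p) * d (snd p) * multi_monom (?s p) x)"
      unfolding c d sum_product sum.cartesian_product
      by (intro sum.cong) (auto simp: multi_monom_def power_add prod.distrib)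
    also have "\<dots> = (\<Sum>\<gamma>\<in>exponents_le (k + l). \<Sum>p\<in>{p\<in>?E. ?s p = \<gamma>}. c (fst p) * d (snd p) * multi_monom (?s p) x)"
      by (rule sum.group[symmetric]) (simp_all add: image_subset_iff, auto simp: exponents_le_def add_mono)
    also have "\<dots> = (\<Sum>\<gamma>\<in>exponents_le (k + l). (\<Sum>p\<in>{p\<in>?E. ?s p = \<gamma>}. c (fst p) * d (snd p)) * multi_monom \<gamma> x)"
      unfolding sum_distrib_right by (intro sum.cong) auto
    finally show ?thesis .
  qed
  then show ?thesis by (rule degree_leI)
qed

lemma degree_le_power: "degree_le k f \<Longrightarrow> degree_le (j * k) (\<lambda>x. f x ^ j)"
  using degree_le_mult[of k f] by (induction j) (auto simp: degree_le_const)

lemma degree_le_prod: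
  "finite I \<Longrightarrow> (\<And>i. i \<in> I \<Longrightarrow> degree_le k (f i)) \<Longrightarrow> degree_le (card I * k) (\<lambda>x. \<Prod>i\<in>I. f i x)"
proof (induction I rule: finite_induct)
  case (insert i I)
  then show ?case using degree_le_mult[of k "f i" "card I * k" "\<lambda>x. \<Prod>i\<in>I. f i x"] by simp
qed (simp add: degree_le_const)

lemma complex_polynomial_degree_le:
  assumes "complex_polynomial f" shows "\<exists>k. degree_le k f"
  using assms
proof induction
  case (add f g)
  then obtain k l where "degree_le k f" "degree_le l g" by blast
  then have "degree_le (max k l) (\<lambda>x. f x + g x)"
    by (intro degree_le_add) (auto elim: degree_le_mono)
  then show ?case ..
qed (use degree_le_const degree_le_coord degree_le_mult in blast)+

lemma digits_unique:
  fixes a b :: "nat \<Rightarrow> nat"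
  assumes "\<And>k. a k < B" "\<And>k. b k < B" "(\<Sum>k<m. a k * B ^ k) = (\<Sum>k<m. b k * B ^ k)" "k < m"
  shows "a k = b k"
  using assms
proof (induction m arbitrary: a b k)
  case (Suc m)
  have shift: "(\<Sum>k<Suc m. c k * B ^ k) = c 0 + B * (\<Sum>k<m. c (Suc k) * B ^ k)" for c :: "nat \<Rightarrow> nat"
    by (simp add: sum.lessThan_Suc_shift sum_distrib_left mult_ac del: sum.lessThan_Suc)
  have eq: "a 0 + B * (\<Sum>k<m. a (Suc k) * B ^ k) = b 0 + B * (\<Sum>k<m. b (Suc k) * B ^ k)"
    using Suc.prems(3) unfolding shift .
  have B: "B > 0" using Suc.prems(1)[of 0] by simp
  have "a 0 = b 0" using arg_cong[OF eq, of "\<lambda>n. n mod B"] Suc.prems(1,2) by simp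
  moreover have "(\<Sum>k<m. a (Suc k) * B ^ k) = (\<Sum>k<m. b (Suc k) * B ^ k)"
    using eq \<open>a 0 = b 0\<close> B by simp
  from Suc.IH[of "\<lambda>k. a (Suc k)" "\<lambda>k. b (Suc k)", OF _ _ this] Suc.prems(1,2)
  have "a (Suc k) = b (Suc k)" if "k < m" for k using that by blast
  ultimately show ?case using Suc.prems(4) by (cases k) auto
qed simp

text \<open>Kronecker substitution \<open>x\<^sub>i = s\<^bsup>B\<^sup>i\<^esup>\<close> with a base \<open>B\<close> exceeding all exponents.\<close>

lemma multi_monom_independent:
  assumes "\<And>x :: complex ^ 'n. (\<Sum>\<alpha>\<in>exponents_le D. c \<alpha> * multi_monom \<alpha> x) = 0"
    and "\<beta> \<in> exponents_le D"
  shows "c \<beta> = 0"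
proof -
  obtain h :: "'n \<Rightarrow> nat" where h: "bij_betw h UNIV {..<CARD('n)}"
    using ex_bij_betw_finite_nat[of "UNIV :: 'n set"] by (auto simp: atLeast0LessThan)
  define N where "N = (\<lambda>\<alpha>. \<Sum>i\<in>UNIV. \<alpha> i * (D + 1) ^ h i)"
  have N_inj: "\<alpha> = \<beta>" if "\<alpha> \<in> exponents_le D" "\<beta> \<in> exponents_le D" "N \<alpha> = N \<beta>" for \<alpha> \<beta>
  proof -
    let ?g = "inv_into UNIV h"
    have N: "N \<alpha> = (\<Sum>k<CARD('n). \<alpha> (?g k) * (D + 1) ^ k)" for \<alpha>
      unfolding N_def using h
      by (subst sum.reindex_bij_betw[OF h, symmetric]) (simp add: bij_betw_def)
    have "\<alpha> (?g k) = \<beta> (?g k)" if "k < CARD('n)" for k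
      using digits_unique[of "\<lambda>k. \<alpha> (?g k)" "D + 1" "\<lambda>k. \<beta> (?g k)" "CARD('n)" k] that
        \<open>N \<alpha> = N \<beta>\<close> \<open>\<alpha> \<in> _\<close> \<open>\<beta> \<in> _\<close>
      unfolding N by (auto simp: exponents_le_def less_Suc_eq_le)
    moreover have "h i < CARD('n)" "?g (h i) = i" for i using h by (auto simp: bij_betw_def)
    ultimately show ?thesis by (metis ext)
  qed
  define P where "P = (\<Sum>\<alpha>\<in>exponents_le D. monom (c \<alpha>) (N \<alpha>))"
  have "poly P s = 0" for s
  proof -
    have "multi_monom \<alpha> (\<chi> i. s ^ ((D + 1) ^ h i)) = s ^ N \<alpha>" for \<alpha>
      by (simp add: multi_monom_def N_def power_sum mult.commute flip: power_mult)
    then show ?thesis using assms(1)[of "\<chi> i. s ^ ((D + 1) ^ h i)"]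
      by (simp add: P_def poly_sum poly_monom)
  qed
  then have "P = 0" using poly_all_0_iff_0 by blast
  moreover have "coeff P (N \<beta>) = (\<Sum>\<alpha>\<in>exponents_le D. if \<alpha> = \<beta> then c \<alpha> else 0)"
    unfolding P_def coeff_sum coeff_monom using N_inj assms(2) by (intro sum.cong) auto
  ultimately show ?thesis using assms(2) by simp
qed

proposition polynomial_relation:
  fixes \<phi> :: "complex ^ 'n \<Rightarrow> complex ^ 'n" and g :: "complex ^ 'n \<Rightarrow> complex"
  assumes "\<And>i. complex_polynomial (\<lambda>x. \<phi> x $ i)" "complex_polynomial g"
  obtains D C where "\<And>j. complex_polynomial (C j)" "\<exists>j\<le>D. \<exists>u. C j u \<noteq> 0"
    "\<And>x. (\<Sum>j\<le>D. C j (\<phi> x) * g x ^ j) = 0"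
proof -
  define m where "m = CARD('n)"
  have "\<exists>k. \<forall>i. degree_le k (\<lambda>x. \<phi> x $ i)"
  proof -
    obtain k where "\<And>i. degree_le (k i) (\<lambda>x. \<phi> x $ i)"
      using complex_polynomial_degree_le[OF assms(1)] by metis
    then have "\<forall>i. degree_le (Max (range k)) (\<lambda>x. \<phi> x $ i)"
      by (meson Max_ge degree_le_mono finite finite_imageI rangeI)
    then show ?thesis ..
  qed
  then obtain k0 where k0: "\<And>i. degree_le k0 (\<lambda>x. \<phi> x $ i)" by blast
  obtain k1 where k1: "degree_le k1 g" using complex_polynomial_degree_le[OF assms(2)] by blast
  define k where "k = max k0 k1 + 1"
  have k: "degree_le k (\<lambda>x. \<phi> x $ i)" "degree_le k g" for i
    using degree_le_mono[OF k0, of k] degree_le_mono[OF k1, of k] by (auto simp: k_def)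
  define D where "D = (k * (m + 1)) ^ m"
  define K where "K = k * (m + 1) * D"
  let ?T = "\<lambda>p x. multi_monom (fst p) (\<phi> x) * g x ^ (snd p)"
  define I where "I = (exponents_le D :: ('n \<Rightarrow> nat) set) \<times> {..D}"
  have "degree_le K (?T p)" if "p \<in> I" for p
  proof -
    have a: "fst p i \<le> D" "snd p \<le> D" for i using that by (auto simp: I_def exponents_le_def)
    have "degree_le (D * k) (\<lambda>x. (\<phi> x $ i) ^ fst p i)" for i
      using a by (intro degree_le_mono[OF degree_le_power[OF k(1)]] mult_right_mono) auto
    then have "degree_le (card (UNIV :: 'n set) * (D * k)) (\<lambda>x. multi_monom (fst p) (\<phi> x))"
      unfolding multi_monom_def by (intro degree_le_prod) auto
    moreover have "degree_le (D * k) (\<lambda>x. g x ^ snd p)"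
      using a by (intro degree_le_mono[OF degree_le_power[OF k(2)]] mult_right_mono) auto
    ultimately have "degree_le (m * (D * k) + D * k) (?T p)"
      unfolding m_def by (rule degree_le_mult)
    then show ?thesis by (simp add: K_def algebra_simps)
  qed
  then have "\<forall>p. \<exists>M. p \<in> I \<longrightarrow> (\<forall>x. ?T p x = (\<Sum>\<beta>\<in>exponents_le K. M \<beta> * multi_monom \<beta> x))"
    unfolding degree_le_def by blast
  then obtain M where M: "\<And>p x. p \<in> I \<Longrightarrow> ?T p x = (\<Sum>\<beta>\<in>exponents_le K. M p \<beta> * multi_monom \<beta> x)"
    by metis
  have "card (exponents_le K :: ('n \<Rightarrow> nat) set) < card I"
  proof -
    have "K + 1 \<le> k * (m + 1) * (D + 1)" by (simp add: K_def k_def)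
    then have "(K + 1) ^ m \<le> (k * (m + 1) * (D + 1)) ^ m" by (rule power_mono) simp
    also have "\<dots> = D * (D + 1) ^ m" by (simp only: power_mult_distrib D_def)
    also have "\<dots> < (D + 1) ^ m * (D + 1)" by simp
    finally show ?thesis by (simp add: card_exponents_le I_def card_cartesian_product m_def)
  qed
  then obtain c where c: "\<exists>p\<in>I. c p \<noteq> 0" "\<forall>\<beta>\<in>exponents_le K. (\<Sum>p\<in>I. M p \<beta> * c p) = 0"
    using homogeneous_system_nontrivial_solution[of "exponents_le K" I "\<lambda>\<beta> p. M p \<beta>"]
    by (auto simp: I_def)
  define C where "C = (\<lambda>j u. \<Sum>\<alpha>\<in>exponents_le D. c (\<alpha>, j) * multi_monom \<alpha> u)"
  have "complex_polynomial (C j)" for j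
    unfolding C_def multi_monom_def
    by (intro complex_polynomial_sum complex_polynomial.mult complex_polynomial_prod
        complex_polynomial_power complex_polynomial.const complex_polynomial.coord) auto
  moreover have "\<exists>j\<le>D. \<exists>u. C j u \<noteq> 0"
  proof -
    obtain \<alpha> j where "\<alpha> \<in> exponents_le D" "j \<le> D" "c (\<alpha>, j) \<noteq> 0" using c(1) by (auto simp: I_def)
    then show ?thesis using multi_monom_independent[of "\<lambda>\<alpha>. c (\<alpha>, j)" D \<alpha>] by (auto simp: C_def)
  qed
  moreover have "(\<Sum>j\<le>D. C j (\<phi> x) * g x ^ j) = 0" for x
  proof -
    have "(\<Sum>j\<le>D. C j (\<phi> x) * g x ^ j) = (\<Sum>p\<in>I. c p * ?T p x)"
      unfolding I_def sum.cartesian_product'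
      by (subst sum.swap) (simp add: C_def sum_distrib_right mult.assoc)
    also have "\<dots> = (\<Sum>p\<in>I. \<Sum>\<beta>\<in>exponents_le K. M p \<beta> * c p * multi_monom \<beta> x)"
      using M by (intro sum.cong refl) (simp add: sum_distrib_left mult_ac)
    also have "\<dots> = (\<Sum>\<beta>\<in>exponents_le K. (\<Sum>p\<in>I. M p \<beta> * c p) * multi_monom \<beta> x)"
      by (subst sum.swap) (simp add: sum_distrib_right)
    also have "\<dots> = 0" using c(2) by simp
    finally show ?thesis .
  qed
  ultimately show ?thesis using that by blast
qed

lemma continuous_complex_polynomial:
  "complex_polynomial f \<Longrightarrow> continuous_on UNIV f"
  by (induction rule: complex_polynomial.induct) (auto intro!: continuous_intros)

lemma polynomial_value_bound:
  fixes \<phi> :: "complex ^ 'n \<Rightarrow> complex ^ 'n" and g :: "complex ^ 'n \<Rightarrow> complex"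
  assumes "\<And>i. complex_polynomial (\<lambda>x. \<phi> x $ i)" "complex_polynomial g"
  obtains h B where "complex_polynomial h" "\<exists>u. h u \<noteq> 0" "continuous_on UNIV B"
    "\<And>x. h (\<phi> x) \<noteq> 0 \<Longrightarrow> cmod (g x) * cmod (h (\<phi> x)) \<le> B (\<phi> x)"
proof -
  obtain D C where C: "\<And>j. complex_polynomial (C j)" "\<exists>j\<le>D. \<exists>u. C j u \<noteq> 0"
    "\<And>x. (\<Sum>j\<le>D. C j (\<phi> x) * g x ^ j) = 0"
    using polynomial_relation[OF assms] by metis
  define J where "J = (GREATEST j. j \<le> D \<and> (\<exists>u. C j u \<noteq> 0))"
  have J: "J \<le> D \<and> (\<exists>u. C J u \<noteq> 0)"
    unfolding J_def using C(2) GreatestI_ex_nat[of "\<lambda>j. j \<le> D \<and> (\<exists>u. C j u \<noteq> 0)" D] by blast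
  have Jmax: "j \<le> J" if "j \<le> D" "C j u \<noteq> 0" for j u
    unfolding J_def using that by (intro Greatest_le_nat[where b = D]) auto
  have rel: "C J (\<phi> x) * g x ^ J = - (\<Sum>j<J. C j (\<phi> x) * g x ^ j)" for x
  proof -
    have "(\<Sum>j\<le>D. C j (\<phi> x) * g x ^ j) = (\<Sum>j\<le>J. C j (\<phi> x) * g x ^ j)"
    proof (intro sum.mono_neutral_right ballI)
      fix j assume "j \<in> {..D} - {..J}"
      then have "C j (\<phi> x) = 0" using Jmax[of j "\<phi> x"] by auto
      then show "C j (\<phi> x) * g x ^ j = 0" by simp
    qed (use J in auto)
    then show ?thesis using C(3)[of x]
      by (simp add: lessThan_Suc_atMost[symmetric] eq_neg_iff_add_eq_0 add.commute)
  qed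
  have "cmod (g x) * cmod (C J (\<phi> x)) \<le> (\<Sum>j\<le>D. cmod (C j (\<phi> x)))" if nz: "C J (\<phi> x) \<noteq> 0" for x
  proof (cases "cmod (g x) \<le> 1")
    case True
    then have "cmod (g x) * cmod (C J (\<phi> x)) \<le> cmod (C J (\<phi> x))"
      by (intro mult_left_le_one_le) auto
    also have "\<dots> \<le> (\<Sum>j\<le>D. cmod (C j (\<phi> x)))" using J by (intro member_le_sum) auto
    finally show ?thesis .
  next
    case False
    have "J \<noteq> 0"
    proof
      assume "J = 0"
      with rel[of x] have "C J (\<phi> x) = 0" by simp
      with nz show False ..
    qed
    then obtain J' where J': "J = Suc J'" by (cases J) auto
    have "cmod (g x) ^ J' * (cmod (g x) * cmod (C J (\<phi> x))) = cmod (C J (\<phi> x) * g x ^ J)"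
      by (simp add: norm_mult norm_power J')
    also have "\<dots> \<le> (\<Sum>j<J. cmod (C j (\<phi> x) * g x ^ j))"
      unfolding rel norm_minus_cancel by (rule norm_sum)
    also have "\<dots> \<le> (\<Sum>j<J. cmod (g x) ^ J' * cmod (C j (\<phi> x)))"
    proof (intro sum_mono)
      fix j assume "j \<in> {..<J}"
      then have "cmod (g x) ^ j \<le> cmod (g x) ^ J'"
        using False J' by (intro power_increasing) auto
      then show "cmod (C j (\<phi> x) * g x ^ j) \<le> cmod (g x) ^ J' * cmod (C j (\<phi> x))"
        by (simp add: norm_mult norm_power mult.commute[of "cmod (C j (\<phi> x))"] mult_right_mono)
    qed
    also have "\<dots> = cmod (g x) ^ J' * (\<Sum>j<J. cmod (C j (\<phi> x)))" by (simp add: sum_distrib_left)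
    also have "\<dots> \<le> cmod (g x) ^ J' * (\<Sum>j\<le>D. cmod (C j (\<phi> x)))"
      using J by (intro mult_left_mono sum_mono2) auto
    finally show ?thesis using False by (subst (asm) mult_le_cancel_left_pos) (auto intro!: zero_less_power)
  qed
  moreover have "continuous_on UNIV (\<lambda>u. \<Sum>j\<le>D. cmod (C j u))"
    by (intro continuous_intros continuous_complex_polynomial C)
  ultimately show ?thesis using that[of "C J" "\<lambda>u. \<Sum>j\<le>D. cmod (C j u)"] J C(1) by blast
qed

lemma polynomial_nonvanishing:
  fixes \<phi> :: "complex ^ 'n \<Rightarrow> complex ^ 'n" and g :: "complex ^ 'n \<Rightarrow> complex"
  assumes "\<And>i. complex_polynomial (\<lambda>x. \<phi> x $ i)" "complex_polynomial g" "g a \<noteq> 0"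
  obtains h where "complex_polynomial h" "\<exists>u. h u \<noteq> 0" "\<And>x. g x = 0 \<Longrightarrow> h (\<phi> x) = 0"
proof -
  obtain D C where C: "\<And>j. complex_polynomial (C j)" "\<exists>j\<le>D. \<exists>u. C j u \<noteq> 0"
    "\<And>x. (\<Sum>j\<le>D. C j (\<phi> x) * g x ^ j) = 0"
    using polynomial_relation[OF assms(1,2)] by metis
  define J where "J = (LEAST j. j \<le> D \<and> (\<exists>u. C j u \<noteq> 0))"
  have J: "J \<le> D \<and> (\<exists>u. C J u \<noteq> 0)"
    unfolding J_def using C(2) LeastI_ex[of "\<lambda>j. j \<le> D \<and> (\<exists>u. C j u \<noteq> 0)"] by blast
  have Jmin: "C j u = 0" if "j < J" for j u
    using not_less_Least[of j "\<lambda>j. j \<le> D \<and> (\<exists>u. C j u \<noteq> 0)"] that J unfolding J_def[symmetric]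
    by (meson less_imp_le_nat order_trans)
  define G where "G = (\<lambda>x. \<Sum>j\<in>{J..D}. C j (\<phi> x) * g x ^ (j - J))"
  have poly_comp: "complex_polynomial (\<lambda>x. f (\<phi> x))" if "complex_polynomial f" for f
    using that
  proof induction
    case (coord i)
    then show ?case by (rule assms(1))
  next
    case (const c)
    show ?case by (rule complex_polynomial.const)
  next
    case (add f g)
    then show ?case by (intro complex_polynomial.add[of "\<lambda>x. f (\<phi> x)" "\<lambda>x. g (\<phi> x)"])
  next
    case (mult f g)
    then show ?case by (intro complex_polynomial.mult[of "\<lambda>x. f (\<phi> x)" "\<lambda>x. g (\<phi> x)"])
  qed
  have G: "complex_polynomial G"
    unfolding G_def
    by (rule complex_polynomial_sum)
      (simp_all add: complex_polynomial.mult[OF poly_comp[OF C(1)] complex_polynomial_power[OF assms(2)]])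
  have gG: "g x ^ J * G x = 0" for x
  proof -
    have "g x ^ J * G x = (\<Sum>j\<in>{J..D}. C j (\<phi> x) * g x ^ j)"
      unfolding G_def sum_distrib_left
      by (intro sum.cong) (auto simp: mult.left_commute simp flip: power_add)
    also have "\<dots> = (\<Sum>j\<le>D. C j (\<phi> x) * g x ^ j)"
      using Jmin by (intro sum.mono_neutral_left) auto
    finally show ?thesis using C(3) by simp
  qed
  have "G x = 0" for x
  proof (rule ccontr)
    assume "G x \<noteq> 0"
    then obtain y where "G y \<noteq> 0" "g y \<noteq> 0"
      using complex_polynomial_common_nonzero[OF G assms(2) _ assms(3)] by blast
    then show False using gG[of y] by simp
  qed
  moreover have "G x = C J (\<phi> x)" if "g x = 0" for x
  proof -
    have "{J..D} = insert J {Suc J..D}" using J by auto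
    then show ?thesis using that by (simp add: G_def power_0_left)
  qed
  ultimately have "C J (\<phi> x) = 0" if "g x = 0" for x using that by metis
  then show ?thesis using that[of "C J"] J C(1) by blast
qed

section \<open>Fibres of polynomial maps\<close>

lemma fibre_card_locally_constant:
  fixes \<phi> :: "'a::euclidean_space \<Rightarrow> 'a"
  assumes cont: "continuous_on UNIV \<phi>"
    and loc: "\<And>x. \<phi> x = u \<Longrightarrow> \<exists>N V g. open N \<and> x \<in> N \<and> open V \<and> homeomorphism N V \<phi> g"
    and bdd: "\<forall>\<^sub>F v in nhds u. \<forall>x. \<phi> x = v \<longrightarrow> norm x \<le> R"
  shows "finite {x. \<phi> x = u}" "\<forall>\<^sub>F v in nhds u. card {x. \<phi> x = v} = card {x. \<phi> x = u}"
proof -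
  let ?F = "{x. \<phi> x = u}"
  obtain N V g where N: "\<And>x. \<phi> x = u \<Longrightarrow> open (N x) \<and> x \<in> N x \<and> open (V x) \<and> homeomorphism (N x) (V x) \<phi> (g x)"
    using loc by metis
  have inj: "inj_on \<phi> (N x)" if "\<phi> x = u" for x
    using N[OF that] unfolding homeomorphism_def by (metis inj_on_inverseI)
  have "?F \<subseteq> cball 0 R" using eventually_nhds_x_imp_x[OF bdd] by auto
  moreover have "closed ?F" by (intro closed_Collect_eq continuous_intros cont)
  ultimately have "compact ?F" using bounded_subset[OF bounded_cball] compact_eq_bounded_closed by blast
  then obtain T where T: "T \<subseteq> ?F" "finite T" "?F \<subseteq> (\<Union>x\<in>T. N x)"
    using N by (elim compactE_image[where C = ?F and f = N]) auto
  have "?F \<subseteq> T"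
  proof
    fix y assume y: "y \<in> ?F"
    then obtain x where x: "x \<in> T" "y \<in> N x" using T by blast
    then have "\<phi> x = u" using T by auto
    then have "x = y" using inj[of x] N[of x] x y by (auto dest: inj_onD)
    then show "y \<in> T" using x by simp
  qed
  then show fin: "finite ?F" using T(2) finite_subset by blast
  have "\<exists>\<delta>>0. \<forall>x\<in>?F. \<forall>y\<in>?F. x \<noteq> y \<longrightarrow> 2 * \<delta> \<le> dist x y"
  proof -
    obtain \<delta> where \<delta>: "\<delta> > 0" "\<And>p. p \<in> (\<lambda>(x, y). dist x y) ` (?F \<times> ?F) - {0} \<Longrightarrow> \<delta> \<le> p"
    proof (cases "(\<lambda>(x, y). dist x y) ` (?F \<times> ?F) - {0} = {}")
      case True
      then show ?thesis using that[of 1] by auto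
    next
      case False
      let ?D = "(\<lambda>(x, y). dist x y) ` (?F \<times> ?F) - {0}"
      have finD: "finite ?D" using fin by auto
      have "Min ?D \<in> ?D" using Min_in[OF finD False] .
      then have "Min ?D > 0" by auto
      then show ?thesis using that[of "Min ?D"] Min_le[OF finD] by blast
    qed
    have "2 * (\<delta> / 2) \<le> dist x y" if "x \<in> ?F" "y \<in> ?F" "x \<noteq> y" for x y
      using \<delta>(2)[of "dist x y"] that by force
    then show ?thesis using \<delta>(1) by (intro exI[of _ "\<delta> / 2"]) auto
  qed
  then obtain \<delta> where \<delta>: "\<delta> > 0" "\<And>x y. x \<in> ?F \<Longrightarrow> y \<in> ?F \<Longrightarrow> x \<noteq> y \<Longrightarrow> 2 * \<delta> \<le> dist x y"
    by blast
  define N' where "N' = (\<lambda>x. N x \<inter> ball x \<delta>)"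
  have N'open: "open (N' x)" "x \<in> N' x" "inj_on \<phi> (N' x)" if "x \<in> ?F" for x
    using that N[of x] \<delta>(1) inj[of x] by (auto simp: N'_def inj_on_Int)
  have disj: "x = y" if "x \<in> ?F" "y \<in> ?F" "z \<in> N' x" "z \<in> N' y" for x y z
  proof (rule ccontr)
    assume "x \<noteq> y"
    then have "2 * \<delta> \<le> dist x y" using \<delta>(2) that by blast
    also have "\<dots> \<le> dist x z + dist y z" by (metis dist_commute dist_triangle)
    also have "\<dots> < 2 * \<delta>" using that by (simp add: N'_def)
    finally show False by simp
  qed
  have img: "open (\<phi> ` N' x)" if "x \<in> ?F" for x
  proof -
    have hom: "homeomorphism (N x) (V x) \<phi> (g x)" and V: "open (V x)" and No: "open (N x)"
      using N[of x] that by auto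
    have "openin (top_of_set (N x)) (N' x)"
      using No by (simp add: N'_def openin_open_Int)
    from homeomorphism_imp_open_map[OF hom this] V show ?thesis
      using openin_open_eq by blast
  qed
  let ?K = "cball 0 R - (\<Union>x\<in>?F. N' x)"
  have "compact ?K" using N'open(1) by (intro compact_diff compact_cball open_UN) auto
  then have "closed (\<phi> ` ?K)"
    by (intro compact_imp_closed compact_continuous_image continuous_on_subset[OF cont]) auto
  moreover have "u \<notin> \<phi> ` ?K" using N'open(2) by auto
  ultimately have "\<forall>\<^sub>F v in nhds u. v \<in> - (\<phi> ` ?K)"
    by (intro eventually_nhds_in_open) auto
  moreover have "\<forall>\<^sub>F v in nhds u. \<forall>x\<in>?F. v \<in> \<phi> ` N' x"
    using fin N'open(2) img by (intro eventually_ball_finite ballI eventually_nhds_in_open) auto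
  ultimately show "\<forall>\<^sub>F v in nhds u. card {x. \<phi> x = v} = card ?F"
    using bdd
  proof eventually_elim
    fix v assume v: "v \<in> - (\<phi> ` ?K)" "\<forall>x\<in>?F. v \<in> \<phi> ` N' x" "\<forall>x. \<phi> x = v \<longrightarrow> norm x \<le> R"
    have "\<forall>x\<in>?F. \<exists>y. y \<in> N' x \<and> \<phi> y = v" using v(2) by blast
    from bchoice[OF this] obtain s where s: "\<And>x. x \<in> ?F \<Longrightarrow> s x \<in> N' x \<and> \<phi> (s x) = v"
      by blast
    have "bij_betw s ?F {x. \<phi> x = v}"
      unfolding bij_betw_def
    proof
      show "inj_on s ?F" using s disj by (intro inj_onI) metis
      show "s ` ?F = {x. \<phi> x = v}"
      proof
        show "s ` ?F \<subseteq> {x. \<phi> x = v}" using s by auto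
        show "{x. \<phi> x = v} \<subseteq> s ` ?F"
        proof
          fix y assume y: "y \<in> {x. \<phi> x = v}"
          then have "y \<in> cball 0 R" "y \<notin> ?K" using v by auto
          then obtain x where x: "x \<in> ?F" "y \<in> N' x" by blast
          then have "y = s x" using s[OF x(1)] N'open(3)[OF x(1)] y by (auto dest: inj_onD)
          then show "y \<in> s ` ?F" using x by blast
        qed
      qed
    qed
    then show "card {x. \<phi> x = v} = card ?F" by (metis bij_betw_same_card)
  qed
qed

lemma has_derivative_vec_componentwise:
  fixes f :: "'a::real_normed_vector \<Rightarrow> 'b::euclidean_space ^ 'i"
  assumes "\<And>i. ((\<lambda>x. f x $ i) has_derivative (\<lambda>v. f' v $ i)) (at x)"
  shows "(f has_derivative f') (at x)"
  unfolding has_derivative_componentwise_within[of f f' x UNIV]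
proof
  fix b :: "'b ^ 'i" assume "b \<in> Basis"
  then obtain k c where "b = axis k c" by (auto simp: Basis_vec_def)
  then show "((\<lambda>x. f x \<bullet> b) has_derivative (\<lambda>x. f' x \<bullet> b)) (at x)"
    using bounded_linear.has_derivative[OF bounded_linear_inner_left assms[of k], of c]
    by (simp add: inner_axis)
qed

proposition polynomial_map_generic_fibre:
  fixes \<phi> :: "complex ^ 'n \<Rightarrow> complex ^ 'n" and M :: "complex ^ 'n \<Rightarrow> complex ^ 'n ^ 'n"
  assumes poly\<phi>: "\<And>i. complex_polynomial (\<lambda>x. \<phi> x $ i)"
    and polyM: "\<And>i j. complex_polynomial (\<lambda>x. M x $ i $ j)"
    and deriv: "\<And>x. (\<phi> has_derivative (\<lambda>v. M x *v v)) (at x)"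
    and det: "det (M a) \<noteq> 0"
  obtains h where "complex_polynomial h" "\<exists>u. h u \<noteq> 0"
    "\<And>u. h u \<noteq> 0 \<Longrightarrow> finite {x. \<phi> x = u}"
    "\<And>u v. h u \<noteq> 0 \<Longrightarrow> h v \<noteq> 0 \<Longrightarrow> card {x. \<phi> x = u} = card {x. \<phi> x = v}"
proof -
  have cont: "continuous_on UNIV \<phi>"
    using deriv by (meson continuous_at_imp_continuous_on has_derivative_continuous)
  have "complex_polynomial (\<lambda>x. det (M x))"
    unfolding det_def
    by (rule complex_polynomial_sum)
      (simp_all add: finite_permutations complex_polynomial.mult[OF complex_polynomial.const complex_polynomial_prod[OF _ polyM]])
  from polynomial_nonvanishing[OF poly\<phi> this det] obtain h0 where
    h0: "complex_polynomial h0" "\<exists>u. h0 u \<noteq> 0" "\<And>x. det (M x) = 0 \<Longrightarrow> h0 (\<phi> x) = 0" by metis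
  have "\<exists>h B. complex_polynomial h \<and> (\<exists>u. h u \<noteq> 0) \<and> continuous_on UNIV B \<and>
     (\<forall>x. h (\<phi> x) \<noteq> 0 \<longrightarrow> cmod (x $ i) * cmod (h (\<phi> x)) \<le> B (\<phi> x))" for i
    using polynomial_value_bound[OF poly\<phi> complex_polynomial.coord[of i]] by metis
  then obtain hh B where hB: "\<And>i. complex_polynomial (hh i)" "\<And>i. \<exists>u. hh i u \<noteq> 0"
     "\<And>i. continuous_on UNIV (B i)"
     "\<And>i x. hh i (\<phi> x) \<noteq> 0 \<Longrightarrow> cmod (x $ i) * cmod (hh i (\<phi> x)) \<le> B i (\<phi> x)"
    by metis
  define h where "h = (\<lambda>u. h0 u * (\<Prod>i\<in>UNIV. hh i u))"
  have polyh: "complex_polynomial h"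
    unfolding h_def by (intro complex_polynomial.mult h0 complex_polynomial_prod hB) auto
  have "\<exists>u. (\<Prod>i\<in>S. hh i u) \<noteq> 0" if "finite S" for S
    using that
  proof (induction S rule: finite_induct)
    case (insert i S)
    obtain x where "hh i x \<noteq> 0 \<and> (\<Prod>i\<in>S. hh i x) \<noteq> 0"
      using complex_polynomial_common_nonzero[OF hB(1)[of i]
          complex_polynomial_prod[OF insert.hyps(1), of hh, OF hB(1)]]
        hB(2)[of i] insert.IH by blast
    then show ?case using insert.hyps by (intro exI[of _ x]) simp
  qed simp
  then obtain x where "h0 x \<noteq> 0 \<and> (\<Prod>i\<in>UNIV. hh i x) \<noteq> 0"
    using complex_polynomial_common_nonzero[OF h0(1) complex_polynomial_prod[OF finite[of UNIV], of hh, OF hB(1)]] h0(2)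
    by (metis finite)
  then have hnz: "\<exists>u. h u \<noteq> 0" by (auto simp: h_def)
  have loc: "\<exists>N V g. open N \<and> x \<in> N \<and> open V \<and> homeomorphism N V \<phi> g" if "h (\<phi> x) \<noteq> 0" for x
  proof -
    have lin: "bounded_linear (\<lambda>v. A *v v)" for A :: "complex ^ 'n ^ 'n"
      by (intro linear_conv_bounded_linear[THEN iffD1] linearI)
        (auto simp: vec_eq_iff matrix_vector_mult_def scaleR_sum_right distrib_left sum.distrib)
    define f' where "f' = (\<lambda>x. Blinfun (\<lambda>v. M x *v v))"
    have f': "blinfun_apply (f' x) = (\<lambda>v. M x *v v)" for x
      unfolding f'_def by (rule bounded_linear_Blinfun_apply[OF lin])
    have "det (M x) \<noteq> 0" using h0(3) that by (auto simp: h_def)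
    then obtain Q where Q: "Q ** M x = mat 1"
      unfolding invertible_det_nz[symmetric] invertible_def by blast
    have Qb: "blinfun_apply (Blinfun (\<lambda>v. Q *v v)) = (\<lambda>v. Q *v v)"
      by (rule bounded_linear_Blinfun_apply[OF lin])
    have inv: "Blinfun (\<lambda>v. Q *v v) o\<^sub>L f' x = id_blinfun"
      by (rule blinfun_eqI) (simp add: Qb f' matrix_vector_mul_assoc Q)
    have cf': "continuous_on UNIV f'"
    proof (rule continuous_on_blinfun_componentwise)
      fix b :: "complex ^ 'n"
      have "continuous_on UNIV (\<lambda>x. \<chi> i. \<Sum>j\<in>UNIV. M x $ i $ j * b $ j)"
        by (intro continuous_on_vec_lambda continuous_intros continuous_complex_polynomial polyM)
      then show "continuous_on UNIV (\<lambda>x. blinfun_apply (f' x) b)"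
        by (simp add: f' matrix_vector_mult_def)
    qed
    show ?thesis
      by (rule inverse_function_theorem[OF open_UNIV _ cf' UNIV_I inv, of \<phi>])
        (use deriv in \<open>auto simp: f'\<close>)
  qed
  have bdd: "\<exists>R. \<forall>\<^sub>F v in nhds u. \<forall>x. \<phi> x = v \<longrightarrow> norm x \<le> R" if "h u \<noteq> 0" for u
  proof -
    have hu: "hh i u \<noteq> 0" for i using that by (auto simp: h_def)
    define \<delta> where "\<delta> = (\<lambda>i. cmod (hh i u) / 2)"
    have \<delta>: "\<delta> i > 0" "\<delta> i < cmod (hh i u)" for i using hu by (auto simp: \<delta>_def)
    define R where "R = (\<Sum>i\<in>UNIV. (\<bar>B i u\<bar> + 1) / \<delta> i)"
    have "\<forall>\<^sub>F v in nhds u. \<forall>i\<in>UNIV. \<delta> i < cmod (hh i v)"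
    proof (intro eventually_ball_finite ballI)
      fix i
      have "((\<lambda>v. cmod (hh i v)) \<longlongrightarrow> cmod (hh i u)) (nhds u)"
        using continuous_complex_polynomial[OF hB(1)[of i]]
        by (intro tendsto_norm) (simp add: continuous_on_eq_continuous_at isCont_def tendsto_at_iff_tendsto_nhds)
      then show "\<forall>\<^sub>F v in nhds u. \<delta> i < cmod (hh i v)" using \<delta>(2) by (rule order_tendstoD(1))
    qed simp
    moreover have "\<forall>\<^sub>F v in nhds u. \<forall>i\<in>UNIV. B i v < \<bar>B i u\<bar> + 1"
    proof (intro eventually_ball_finite ballI)
      fix i
      have "(B i \<longlongrightarrow> B i u) (nhds u)"
        using hB(3)[of i]
        by (simp add: continuous_on_eq_continuous_at isCont_def tendsto_at_iff_tendsto_nhds)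
      then show "\<forall>\<^sub>F v in nhds u. B i v < \<bar>B i u\<bar> + 1" by (rule order_tendstoD(2)) auto
    qed simp
    ultimately have "\<forall>\<^sub>F v in nhds u. \<forall>x. \<phi> x = v \<longrightarrow> norm x \<le> R"
    proof eventually_elim
      fix v assume v: "\<forall>i\<in>UNIV. \<delta> i < cmod (hh i v)" "\<forall>i\<in>UNIV. B i v < \<bar>B i u\<bar> + 1"
      have "norm x \<le> R" if x: "\<phi> x = v" for x
      proof -
        have "cmod (x $ i) \<le> (\<bar>B i u\<bar> + 1) / \<delta> i" for i
        proof -
          have "\<delta> i < cmod (hh i v)" using v by blast
          then have "hh i (\<phi> x) \<noteq> 0" using \<delta>(1)[of i] x by auto
          from hB(4)[OF this] have "cmod (x $ i) * cmod (hh i v) \<le> B i v" using x by simp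
          moreover have "cmod (x $ i) * \<delta> i \<le> cmod (x $ i) * cmod (hh i v)"
            using \<open>\<delta> i < cmod (hh i v)\<close> by (intro mult_left_mono) auto
          moreover have "B i v < \<bar>B i u\<bar> + 1" using v by blast
          ultimately show ?thesis using \<delta>(1)[of i] by (simp add: field_simps)
        qed
        then have "(\<Sum>i\<in>UNIV. cmod (x $ i)) \<le> R" unfolding R_def by (intro sum_mono)
        moreover have "norm x \<le> (\<Sum>i\<in>UNIV. cmod (x $ i))"
          unfolding norm_vec_def by (rule L2_set_le_sum) auto
        ultimately show ?thesis by simp
      qed
      then show "\<forall>x. \<phi> x = v \<longrightarrow> norm x \<le> R" by blast
    qed
    then show ?thesis by blast
  qed
  have local: "finite {x. \<phi> x = u}" "\<forall>\<^sub>F v in nhds u. card {x. \<phi> x = v} = card {x. \<phi> x = u}"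
    if u: "h u \<noteq> 0" for u
  proof -
    obtain R where R: "\<forall>\<^sub>F v in nhds u. \<forall>x. \<phi> x = v \<longrightarrow> norm x \<le> R" using bdd[OF u] by blast
    have l: "\<exists>N V g. open N \<and> x \<in> N \<and> open V \<and> homeomorphism N V \<phi> g" if "\<phi> x = u" for x
      using loc[of x] that u by blast
    show "finite {x. \<phi> x = u}" "\<forall>\<^sub>F v in nhds u. card {x. \<phi> x = v} = card {x. \<phi> x = u}"
      using fibre_card_locally_constant[OF cont l R] by blast+
  qed
  have "card {x. \<phi> x = u} = card {x. \<phi> x = v}" if u: "h u \<noteq> 0" and v: "h v \<noteq> 0" for u v
  proof -
    let ?l = "\<lambda>s. \<chi> i. u $ i + s * (v $ i - u $ i)"
    obtain P where P: "\<And>s. h (?l s) = poly P s"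
      using complex_polynomial_on_line[OF polyh, of "\<lambda>i. u $ i" "\<lambda>i. v $ i - u $ i"] by blast
    let ?S = "UNIV - {s. poly P s = 0}"
    have ends: "?l 0 = u" "?l 1 = v" by (simp_all add: vec_eq_iff)
    have "P \<noteq> 0" using P[of 0] ends u by auto
    then have "countable {s. poly P s = 0}" by (intro countable_finite poly_roots_finite)
    then have "connected ?S" by (intro connected_open_diff_countable) auto
    moreover have "0 \<in> ?S" "1 \<in> ?S" using P[of 0] P[of 1] ends u v by auto
    moreover have "\<forall>s\<in>?S. \<forall>\<^sub>F r in at s within ?S. card {x. \<phi> x = ?l s} = card {x. \<phi> x = ?l r}"
    proof
      fix s assume "s \<in> ?S"
      then have "h (?l s) \<noteq> 0" using P by auto
      from local(2)[OF this]
      have "\<forall>\<^sub>F w in nhds (?l s). card {x. \<phi> x = w} = card {x. \<phi> x = ?l s}" .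
      moreover have "filterlim ?l (nhds (?l s)) (at s within ?S)"
        by (intro tendsto_vec_lambda tendsto_intros)
      ultimately have "\<forall>\<^sub>F r in at s within ?S. card {x. \<phi> x = ?l r} = card {x. \<phi> x = ?l s}"
        by (rule eventually_compose_filterlim)
      then show "\<forall>\<^sub>F r in at s within ?S. card {x. \<phi> x = ?l s} = card {x. \<phi> x = ?l r}"
        by eventually_elim simp
    qed
    ultimately have "card {x. \<phi> x = ?l 0} = card {x. \<phi> x = ?l 1}"
      by (rule connected_local_const)
    then show ?thesis unfolding ends .
  qed
  then show ?thesis using that[OF polyh hnz] local(1) by blast
qed

section \<open>The maximum likelihood degree counts bounded regions\<close>

context linear_model_loc
begin

theorem generic_critical_points:
  obtains h where "complex_polynomial h" "\<exists>u. h u \<noteq> 0"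
    "\<And>u. h u \<noteq> 0 \<Longrightarrow> finite (critical_points X u) \<and> card (critical_points X u) = card (bounded_signs X)"
proof -
  obtain p0 where p0: "p0 \<in> A" "\<And>i. p0 $ i > 0" by (rule positive_point) (rule that)
  obtain P :: "'n \<Rightarrow> 'n \<Rightarrow> real" where P: "\<And>i j. P i j = P j i" "\<And>j. (\<chi> i. P i j) \<in> X0"
      "\<And>x i. x \<in> X0 \<Longrightarrow> x $ i = (\<Sum>j\<in>UNIV. P i j * x $ j)"
    by (rule subspace_projection_coeffs[OF subspace_X0]) (rule that)
  define Q where "Q = (\<lambda>(x :: complex ^ 'n) i. \<Sum>j\<in>UNIV. P i j * x $ j)"
  define \<phi> where "\<phi> = (\<lambda>x :: complex ^ 'n. \<chi> i. (p0 $ i + Q x i) * (x $ i - Q x i))"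
  define M where "M = (\<lambda>x :: complex ^ 'n. \<chi> i j. P i j * (x $ i - Q x i) + (p0 $ i + Q x i) * ((if i = j then 1 else 0) - P i j))"
  have Q_X0: "(\<chi> i. Q x i) \<in> extend_field X0" for x
  proof -
    have "(\<chi> i. \<Sum>j\<in>UNIV. x $ j * complex_of_real ((\<chi> i. P i j) $ i)) \<in> extend_field X0"
      by (rule extend_field_combination[OF subspace_X0 P(2)])
    then show ?thesis by (simp add: Q_def mult.commute)
  qed
  have Q_id: "Q v i = v $ i" if "v \<in> extend_field X0" for v i
    using extend_field_expand[OF P(3) that, of i] by (simp add: Q_def)
  have Q_Y: "Q q i = 0" if "q \<in> extend_field Y" for q i
  proof -
    have "(\<Sum>j\<in>UNIV. q $ j * (\<chi> j. complex_of_real ((\<chi> k. P k i) $ j)) $ j) = 0"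
      by (rule pairing_zero[OF extend_field_of_real[OF P(2)] that])
    moreover have "(\<chi> k. P k i) $ j = P i j" for j using P(1) by simp
    ultimately show ?thesis by (simp add: Q_def mult.commute)
  qed
  have Y_Q: "(\<chi> i. x $ i - Q x i) \<in> extend_field Y" for x
  proof (rule in_extend_YI)
    fix y assume y: "y \<in> X0"
    have "(\<Sum>i\<in>UNIV. complex_of_real (y $ i) * Q x i) = (\<Sum>j\<in>UNIV. complex_of_real (\<Sum>i\<in>UNIV. P j i * y $ i) * x $ j)"
      unfolding Q_def sum_distrib_left of_real_sum sum_distrib_right
      by (subst sum.swap, intro sum.cong refl) (metis P(1) mult.assoc mult.commute of_real_mult)
    also have "\<dots> = (\<Sum>j\<in>UNIV. complex_of_real (y $ j) * x $ j)"
      by (simp only: P(3)[OF y, symmetric])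
    finally show "(\<Sum>i\<in>UNIV. complex_of_real (y $ i) * (\<chi> i. x $ i - Q x i) $ i) = 0"
      by (simp add: right_diff_distrib sum_subtractf)
  qed
  have polyQ: "complex_polynomial (\<lambda>x. Q x i)" for i
    unfolding Q_def by (intro complex_polynomial_sum complex_polynomial.mult complex_polynomial.const complex_polynomial.coord) auto
  have polyD: "complex_polynomial (\<lambda>x. x $ i - Q x i)" for i
    using complex_polynomial.add[OF complex_polynomial.coord[of i]
        complex_polynomial.mult[OF complex_polynomial.const[of "-1"] polyQ[of i]]] by simp
  have poly\<phi>: "complex_polynomial (\<lambda>x. \<phi> x $ i)" for i
    unfolding \<phi>_def vec_lambda_beta
    by (intro complex_polynomial.mult complex_polynomial.add[OF complex_polynomial.const] polyQ polyD)
  have polyM: "complex_polynomial (\<lambda>x. M x $ i $ j)" for i j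
    unfolding M_def vec_lambda_beta
    by (rule complex_polynomial.add[OF complex_polynomial.mult[OF complex_polynomial.const polyD]
      complex_polynomial.mult[OF complex_polynomial.add[OF complex_polynomial.const polyQ] complex_polynomial.const]])
  have bl: "bounded_linear (\<lambda>x. Q x i)" for i
    unfolding Q_def by (intro bounded_linear_sum bounded_linear_const_mult bounded_linear_vec_nth)
  have deriv: "(\<phi> has_derivative (\<lambda>v. M x *v v)) (at x)" for x
  proof -
    have "((\<lambda>x. (p0 $ i + Q x i) * (x $ i - Q x i)) has_derivative (\<lambda>v. (M x *v v) $ i)) (at x)" for i
    proof -
      have "((\<lambda>x. (p0 $ i + Q x i) * (x $ i - Q x i)) has_derivative
         (\<lambda>v. (p0 $ i + Q x i) * (v $ i - Q v i) + Q v i * (x $ i - Q x i))) (at x)"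
        by (auto intro!: derivative_eq_intros bounded_linear_imp_has_derivative bl bounded_linear_vec_nth)
      moreover have "(M x *v v) $ i = (p0 $ i + Q x i) * (v $ i - Q v i) + Q v i * (x $ i - Q x i)" for v
      proof -
        have "(M x *v v) $ i = (\<Sum>j\<in>UNIV. (x $ i - Q x i) * (P i j * v $ j) + (p0 $ i + Q x i) * ((if i = j then v $ j else 0) - P i j * v $ j))"
          unfolding matrix_vector_mult_def M_def vec_lambda_beta
          by (intro sum.cong) (auto simp: algebra_simps)
        also have "\<dots> = (p0 $ i + Q x i) * (v $ i - Q v i) + Q v i * (x $ i - Q x i)"
          by (simp add: sum.distrib sum_subtractf Q_def flip: sum_distrib_left)
        finally show ?thesis .
      qed
      ultimately show ?thesis by simp
    qed
    then show ?thesis by (intro has_derivative_vec_componentwise) (simp add: \<phi>_def)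
  qed
  define one :: "complex ^ 'n" where "one = (\<chi> i. 1)"
  have one: "one \<in> extend_field Y"
    by (rule in_extend_YI) (auto simp: one_def model_directions_def simp flip: of_real_sum)
  have det: "det (M one) \<noteq> 0"
  proof -
    have "v = 0" if v: "M one *v v = 0" for v
    proof -
      have "(M one *v v) $ i = p0 $ i * (v $ i - Q v i) + Q v i" for i
      proof -
        have "(M one *v v) $ i = (\<Sum>j\<in>UNIV. (P i j * v $ j) + p0 $ i * ((if i = j then v $ j else 0) - P i j * v $ j))"
          unfolding matrix_vector_mult_def M_def vec_lambda_beta Q_Y[OF one]
          by (intro sum.cong) (auto simp: algebra_simps one_def)
        then show ?thesis
          by (simp add: sum.distrib sum_subtractf Q_def flip: sum_distrib_left)
      qed
      moreover have "(M one *v v) $ i = 0" for i using v by simp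
      ultimately have Qv: "Q v i = - (p0 $ i * (v $ i - Q v i))" for i
        by (metis add_eq_0_iff)
      define w where "w = (\<chi> i. v $ i - Q v i)"
      have "(\<chi> i. cnj (w $ i)) \<in> extend_field Y"
      proof (rule in_extend_YI)
        fix x assume "x \<in> X0"
        then have "(\<Sum>i\<in>UNIV. w $ i * (\<chi> i. complex_of_real (x $ i)) $ i) = 0"
          unfolding w_def by (intro pairing_zero extend_field_of_real Y_Q)
        from arg_cong[OF this, of cnj]
        show "(\<Sum>i\<in>UNIV. complex_of_real (x $ i) * (\<chi> i. cnj (w $ i)) $ i) = 0" by (simp add: mult.commute)
      qed
      from pairing_zero[OF Q_X0[of v] this]
      have "(\<Sum>i\<in>UNIV. cnj (w $ i) * Q v i) = 0" by simp
      moreover have "cnj (w $ i) * Q v i = - complex_of_real (p0 $ i * (cmod (w $ i))\<^sup>2)" for i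
      proof -
        have "Q v i = - (p0 $ i * w $ i)" using Qv[of i] unfolding w_def vec_lambda_beta .
        then show ?thesis by (simp only: of_real_mult complex_norm_square) (simp add: mult_ac)
      qed
      ultimately have "(\<Sum>i\<in>UNIV. - complex_of_real (p0 $ i * (cmod (w $ i))\<^sup>2)) = 0" by (simp only:)
      then have "(\<Sum>i\<in>UNIV. complex_of_real (p0 $ i * (cmod (w $ i))\<^sup>2)) = 0"
        by (simp only: sum_negf neg_equal_0_iff_equal)
      then have "(\<Sum>i\<in>UNIV. p0 $ i * (cmod (w $ i))\<^sup>2) = 0"
        by (simp only: of_real_sum[symmetric] of_real_eq_0_iff)
      then have "p0 $ i * (cmod (w $ i))\<^sup>2 = 0" for i
        using p0(2) by (subst (asm) sum_nonneg_eq_0_iff) (auto simp: less_imp_le)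
      then have w0: "w $ i = 0" for i
        using p0(2)[of i] by (metis less_irrefl mult_eq_0_iff norm_eq_zero zero_eq_power2)
      then have "v $ i - Q v i = 0" for i by (simp add: w_def)
      then have "v $ i = 0" for i using Qv[of i] by (metis diff_eq_eq add_0 mult_zero_right neg_0_equal_iff_equal)
      then show "v = 0" by (simp add: vec_eq_iff)
    qed
    then have "\<exists>B. B ** M one = mat 1" unfolding matrix_left_invertible_ker by blast
    then have "invertible (M one)" by (simp add: invertible_left_inverse)
    then show ?thesis by (simp add: invertible_det_nz)
  qed
  obtain h where h: "complex_polynomial h" "\<exists>u. h u \<noteq> 0"
    "\<And>u. h u \<noteq> 0 \<Longrightarrow> finite {x. \<phi> x = u}"
    "\<And>u v. h u \<noteq> 0 \<Longrightarrow> h v \<noteq> 0 \<Longrightarrow> card {x. \<phi> x = u} = card {x. \<phi> x = v}"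
    using polynomial_map_generic_fibre[of \<phi> M, OF poly\<phi> polyM deriv det] by metis
  have bij: "bij_betw (\<lambda>x. \<chi> i. p0 $ i + Q x i) {x. \<phi> x = u} (critical_points X u)"
    if u: "\<And>i. u $ i \<noteq> 0" for u
  proof (rule bij_betw_byWitness[where f' = "\<lambda>p :: complex ^ 'n. \<chi> i. (p $ i - p0 $ i) + u $ i / p $ i"])
    have fwd: "p0 $ i + Q x i \<noteq> 0" "u $ i / (p0 $ i + Q x i) = x $ i - Q x i" if "\<phi> x = u" for x i
    proof -
      have "(p0 $ i + Q x i) * (x $ i - Q x i) = u $ i" using that by (auto simp: \<phi>_def)
      then show "p0 $ i + Q x i \<noteq> 0" "u $ i / (p0 $ i + Q x i) = x $ i - Q x i"
        using u[of i] by (metis mult_zero_left, metis mult_zero_left nonzero_mult_div_cancel_left)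
    qed
    show "\<forall>x\<in>{x. \<phi> x = u}. (\<chi> i. ((\<chi> i. p0 $ i + Q x i) $ i - p0 $ i) + u $ i / (\<chi> i. p0 $ i + Q x i) $ i) = x"
      using fwd by (simp add: vec_eq_iff)
    have A: "(\<chi> i. p0 $ i + Q x i) \<in> extend_field A" for x
    proof -
      have "(\<chi> i. complex_of_real (p0 $ i)) \<in> extend_field A" by (rule extend_field_of_real[OF p0(1)])
      then have "(\<chi> i. complex_of_real (p0 $ i)) - (\<chi> i. - Q x i) \<in> extend_field X"
        "(\<Sum>i\<in>UNIV. complex_of_real (p0 $ i)) = 1"
        using Q_X0[of x] extend_field_scale[OF subspace_X, of "\<chi> i. Q x i" "-1"]
        by (auto intro!: extend_field_diff[OF subspace_X] simp: extend_affine_iff extend_X0_iff)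
      moreover have "(\<Sum>i\<in>UNIV. Q x i) = 0" using Q_X0[of x] by (simp add: extend_X0_iff)
      moreover have "(\<chi> i. complex_of_real (p0 $ i)) - (\<chi> i. - Q x i) = (\<chi> i. p0 $ i + Q x i)"
        by (simp add: vec_eq_iff)
      ultimately show ?thesis by (simp add: extend_affine_iff sum.distrib)
    qed
    show "(\<lambda>x. \<chi> i. p0 $ i + Q x i) ` {x. \<phi> x = u} \<subseteq> critical_points X u"
      using A fwd Y_Q by (auto simp: critical_points_iff)
    have bwd: "Q (\<chi> i. (p $ i - p0 $ i) + u $ i / p $ i) i = p $ i - p0 $ i" if "p \<in> critical_points X u" for p i
    proof -
      have p: "p \<in> extend_field A" "(\<chi> i. u $ i / p $ i) \<in> extend_field Y"
        using that by (auto simp: critical_points_iff)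
      have "p - (\<chi> i. complex_of_real (p0 $ i)) \<in> extend_field X0"
        by (intro diff_extend_affine p extend_field_of_real p0)
      from Q_id[OF this, of i] Q_Y[OF p(2), of i]
      show ?thesis by (simp add: Q_def distrib_left sum.distrib)
    qed
    show "\<forall>p\<in>critical_points X u. (\<chi> i. p0 $ i + Q (\<chi> i. (p $ i - p0 $ i) + u $ i / p $ i) i) = p"
      using bwd by (simp add: vec_eq_iff)
    show "(\<lambda>p. \<chi> i. (p $ i - p0 $ i) + u $ i / p $ i) ` critical_points X u \<subseteq> {x. \<phi> x = u}"
      using bwd by (auto simp: \<phi>_def vec_eq_iff critical_points_iff)
  qed
  define h' where "h' = (\<lambda>u :: complex ^ 'n. h u * (\<Prod>i\<in>UNIV. u $ i))"
  have polyp: "complex_polynomial (\<lambda>u :: complex ^ 'n. \<Prod>i\<in>UNIV. u $ i)"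
    by (intro complex_polynomial_prod complex_polynomial.coord) auto
  have "complex_polynomial h'" unfolding h'_def by (intro complex_polynomial.mult h polyp)
  moreover have nz: "\<exists>u. h' u \<noteq> 0"
  proof -
    obtain u0 where "h u0 \<noteq> 0" using h(2) by blast
    moreover have "(\<Prod>i\<in>UNIV. one $ i) \<noteq> 0" by (simp add: one_def)
    ultimately show ?thesis
      using complex_polynomial_common_nonzero[OF h(1) polyp] by (auto simp: h'_def)
  qed
  moreover have "finite (critical_points X u) \<and> card (critical_points X u) = card (bounded_signs X)"
    if u: "h' u \<noteq> 0" for u
  proof -
    have eq: "finite (critical_points X u) \<and> card (critical_points X u) = card {x. \<phi> x = u}"
      if "h' u \<noteq> 0" for u
    proof -
      have "\<And>i. u $ i \<noteq> 0" "h u \<noteq> 0" using that by (auto simp: h'_def)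
      then show ?thesis using bij_betw_finite[OF bij] bij_betw_same_card[OF bij] h(3) by metis
    qed
    obtain r :: "real ^ 'n" where r: "\<And>i. r $ i > 0" "h' (\<chi> i. of_real (r $ i)) \<noteq> 0"
      using complex_polynomial_positive_nonzero[OF \<open>complex_polynomial h'\<close>] nz by metis
    have "card {x. \<phi> x = u} = card {x. \<phi> x = (\<chi> i. of_real (r $ i))}"
      using h(4) u r(2) by (auto simp: h'_def)
    then show ?thesis using eq[OF u] eq[OF r(2)] card_critical_points_positive(2)[OF r(1)] by simp
  qed
  ultimately show ?thesis using that by blast
qed

theorem MLdegree_eq: "MLdegree X = card (bounded_signs X)"
proof -
  obtain h where h: "complex_polynomial h" "\<exists>u. h u \<noteq> 0"
    "\<And>u. h u \<noteq> 0 \<Longrightarrow> finite (critical_points X u) \<and> card (critical_points X u) = card (bounded_signs X)"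
    using generic_critical_points by metis
  show ?thesis
    unfolding MLdegree_def
  proof (rule the_equality)
    show "for_generic (\<lambda>u. finite (critical_points X u) \<and> card (critical_points X u) = card (bounded_signs X))"
      unfolding for_generic_def using h by blast
  next
    fix N assume "for_generic (\<lambda>u. finite (critical_points X u) \<and> card (critical_points X u) = N)"
    then obtain f a where f: "complex_polynomial f" "f a \<noteq> 0"
      "\<And>u. f u \<noteq> 0 \<Longrightarrow> finite (critical_points X u) \<and> card (critical_points X u) = N"
      unfolding for_generic_def by blast
    then obtain u where "f u \<noteq> 0" "h u \<noteq> 0"
      using complex_polynomial_common_nonzero[OF f(1) h(1) f(2)] h(2) by blast
    then show "N = card (bounded_signs X)" using f(3) h(3) by metis
  qed
qed

end

section \<open>The combinatorics of tropical linear spaces\<close>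

text \<open>Reading a point over the Puiseux series coefficient by coefficient shows that \<open>a\<close> lies in the
  tropicalization of \<open>L\<close> if and only if, for every coordinate \<open>e\<close>, some vector of \<open>L\<close> is nonzero at
  \<open>e\<close> and vanishes at all coordinates of larger valuation.\<close>

definition tropical_condition :: "(real ^ 'i) set \<Rightarrow> ('i \<Rightarrow> real) \<Rightarrow> bool" where
  "tropical_condition L a \<longleftrightarrow> (\<forall>e. \<exists>z\<in>L. z $ e \<noteq> 0 \<and> (\<forall>f. a e < a f \<longrightarrow> z $ f = 0))"

lemma independent_family:
  fixes z :: "'k \<Rightarrow> 'v::real_vector"
  assumes fin: "finite R" and ind: "\<And>c r. (\<Sum>r\<in>R. c r *\<^sub>R z r) = 0 \<Longrightarrow> r \<in> R \<Longrightarrow> c r = 0"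
  shows "inj_on z R" "independent (z ` R)"
proof -
  show inj: "inj_on z R"
  proof (rule inj_onI, rule ccontr)
    fix r s assume rs: "r \<in> R" "s \<in> R" "z r = z s" "r \<noteq> s"
    have "(\<Sum>k\<in>R. (if k = r then 1 else if k = s then - 1 else 0) *\<^sub>R z k) =
        (\<Sum>k\<in>R. (if k = r then z r else 0) + (if k = s then - z s else 0))"
      using rs by (intro sum.cong) auto
    also have "\<dots> = 0" using rs fin by (simp add: sum.distrib)
    finally show False using ind[of "\<lambda>k. if k = r then 1 else if k = s then - 1 else 0" r] rs by simp
  qed
  show "independent (z ` R)"
  proof
    assume "dependent (z ` R)"
    then obtain u where u: "\<exists>v\<in>z ` R. u v \<noteq> 0" "(\<Sum>v\<in>z ` R. u v *\<^sub>R v) = 0"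
      using dependent_finite[OF finite_imageI[OF fin]] by blast
    then have "(\<Sum>r\<in>R. u (z r) *\<^sub>R z r) = 0" by (simp add: sum.reindex[OF inj])
    then show False using ind[of "\<lambda>r. u (z r)"] u(1) by blast
  qed
qed

lemma linear_functional_relation:
  fixes L :: "(real ^ 'i) set"
  assumes L: "subspace L" and v: "\<And>p. p \<in> L \<Longrightarrow> (\<And>g. g \<in> G \<Longrightarrow> p $ g = 0) \<Longrightarrow> v \<bullet> p = 0"
  shows "\<exists>l. \<forall>p\<in>L. v \<bullet> p = (\<Sum>g\<in>G. l g * p $ g)"
proof -
  let ?Ax = "(\<lambda>g. axis g 1 :: real ^ 'i) ` G"
  let ?W = "span (orthogonal_comp L \<union> ?Ax)"
  have "v \<in> orthogonal_comp (orthogonal_comp ?W)"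
    unfolding orthogonal_comp_def[of "orthogonal_comp ?W"]
  proof (rule CollectI, rule ballI)
    fix p assume p: "p \<in> orthogonal_comp ?W"
    moreover have "orthogonal_comp L \<subseteq> ?W"
      using span_superset[of "orthogonal_comp L \<union> ?Ax"] by blast
    ultimately have "p \<in> orthogonal_comp (orthogonal_comp L)"
      using orthogonal_comp_anti_mono by blast
    then have "p \<in> L" by (simp add: orthogonal_comp_self L)
    moreover have "p $ g = 0" if "g \<in> G" for g
    proof -
      have "axis g 1 \<in> ?W" using that by (intro span_base) auto
      then have "orthogonal (axis g 1) p" using p by (auto simp: orthogonal_comp_def)
      then show ?thesis by (simp add: orthogonal_def inner_axis')
    qed
    ultimately have "v \<bullet> p = 0" by (rule v)
    then show "orthogonal p v" by (simp add: orthogonal_def inner_commute)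
  qed
  then have "v \<in> ?W" by (simp add: orthogonal_comp_self subspace_span)
  then obtain x y where xy: "v = x + y" "x \<in> span (orthogonal_comp L)" "y \<in> span ?Ax"
    unfolding span_Un by blast
  have x: "x \<in> orthogonal_comp L" using xy(2) by (simp add: span_eq_iff[THEN iffD2] subspace_orthogonal_comp)
  have inj: "inj_on (\<lambda>g. axis g 1 :: real ^ 'i) G" by (auto simp: inj_on_def axis_eq_axis)
  obtain k where k: "y = (\<Sum>t\<in>?Ax. k t *\<^sub>R t)" using xy(3) span_finite[of ?Ax] by auto
  have "v \<bullet> p = (\<Sum>g\<in>G. k (axis g 1) * p $ g)" if p: "p \<in> L" for p
  proof -
    have "x \<bullet> p = 0" using x p by (auto simp: orthogonal_comp_def orthogonal_def inner_commute)
    moreover have "y \<bullet> p = (\<Sum>g\<in>G. k (axis g 1) * p $ g)"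
      unfolding k by (simp add: sum.reindex[OF inj] inner_sum_left inner_axis')
    ultimately show ?thesis by (simp add: xy(1) inner_add_left)
  qed
  then show ?thesis by (intro exI[of _ "\<lambda>g. k (axis g 1)"] ballI)
qed

lemma tropical_condition_basis:
  fixes L :: "(real ^ 'i) set"
  assumes L: "subspace L" and trop: "tropical_condition L a"
  shows "card (range a) \<le> dim L"
    and "dim L \<le> card (range a) \<Longrightarrow> \<exists>z. (\<forall>r. z r \<in> L) \<and> (\<forall>r e. r \<in> range a \<longrightarrow> r < a e \<longrightarrow> z r $ e = 0) \<and> (\<forall>e. z (a e) $ e \<noteq> 0) \<and>
      (\<forall>e f. a e = a f \<longrightarrow> (\<exists>l. \<forall>p\<in>L. p $ e = (z (a e) $ e / z (a e) $ f) * p $ f + (\<Sum>g | a e < a g. l g * p $ g)))"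
proof -
  define R where "R = range a"
  have finR: "finite R" by (simp add: R_def)
  define rep where "rep = inv_into UNIV a"
  have rep: "a (rep r) = r" if "r \<in> R" for r
    using that unfolding rep_def R_def by (rule f_inv_into_f)
  have "\<forall>r. \<exists>z. z \<in> L \<and> (r \<in> R \<longrightarrow> z $ rep r \<noteq> 0 \<and> (\<forall>f. r < a f \<longrightarrow> z $ f = 0))"
    using trop rep subspace_0[OF L] unfolding tropical_condition_def by metis
  then obtain z where z: "\<And>r. z r \<in> L" "\<And>r. r \<in> R \<Longrightarrow> z r $ rep r \<noteq> 0"
    "\<And>r f. r \<in> R \<Longrightarrow> r < a f \<Longrightarrow> z r $ f = 0" by metis
  \<comment> \<open>The coefficients of a combination of the \<open>z r\<close> are read off from the top level downwards.\<close>
  have top: "c r = 0" if c: "\<And>g. s < a g \<Longrightarrow> (\<Sum>r\<in>R. c r *\<^sub>R z r) $ g = 0" and r: "r \<in> R" "s < r" for c r s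
  proof (rule ccontr)
    assume "c r \<noteq> 0"
    let ?N = "{r \<in> R. s < r \<and> c r \<noteq> 0}"
    define m where "m = Max ?N"
    have "m \<in> ?N" unfolding m_def using r \<open>c r \<noteq> 0\<close> finR by (intro Max_in) auto
    then have m: "m \<in> R" "s < m" "c m \<noteq> 0" by auto
    have mmax: "c r' = 0" if "r' \<in> R" "m < r'" for r'
    proof (rule ccontr)
      assume "c r' \<noteq> 0"
      then have "r' \<le> m" unfolding m_def using finR that m(2) by (intro Max_ge) auto
      then show False using that by simp
    qed
    have "(\<Sum>r\<in>R. c r *\<^sub>R z r) $ rep m = (\<Sum>r\<in>R. if r = m then c m * z m $ rep m else 0)"
      unfolding sum_component
    proof (intro sum.cong refl)
      fix r' assume r': "r' \<in> R"
      consider "r' < m" | "r' = m" | "m < r'" by linarith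
      then show "(c r' *\<^sub>R z r') $ rep m = (if r' = m then c m * z m $ rep m else 0)"
        using z(3)[OF r', of "rep m"] rep[OF m(1)] mmax[OF r'] by cases auto
    qed
    then have "(\<Sum>r\<in>R. c r *\<^sub>R z r) $ rep m = c m * z m $ rep m" using finR m by simp
    moreover have "(\<Sum>r\<in>R. c r *\<^sub>R z r) $ rep m = 0" using c[of "rep m"] rep[OF m(1)] m(2) by simp
    ultimately show False using z(2)[OF m(1)] m(3) by simp
  qed
  have ind: "c r = 0" if "(\<Sum>r\<in>R. c r *\<^sub>R z r) = 0" "r \<in> R" for c r
    using top[of "r - 1" c r] that by simp
  have fam: "inj_on z R" "independent (z ` R)"
    by (rule independent_family[OF finR], erule (1) ind)+
  have card: "card (z ` R) = card (range a)" using card_image[OF fam(1)] by (simp add: R_def)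
  show "card (range a) \<le> dim L"
    unfolding card[symmetric] using z(1) fam(2) by (intro independent_card_le_dim) auto
  assume "dim L \<le> card (range a)"
  then have "L \<subseteq> span (z ` R)"
    using z(1) fam(2) card by (intro card_ge_dim_independent) auto
  have expand: "\<exists>c. p = (\<Sum>r\<in>R. c r *\<^sub>R z r)" if "p \<in> L" for p
  proof -
    have "p \<in> span (z ` R)" using that \<open>L \<subseteq> span (z ` R)\<close> by blast
    then obtain u where "p = (\<Sum>v\<in>z ` R. u v *\<^sub>R v)"
      using span_finite[OF finite_imageI[OF finR], of z] by auto
    then show ?thesis using sum.reindex[OF fam(1), of "\<lambda>v. u v *\<^sub>R v"]
      by (intro exI[of _ "\<lambda>r. u (z r)"]) simp
  qed
  have lead: "\<exists>c. \<forall>e. a e = s \<longrightarrow> p $ e = c * z s $ e" if p: "p \<in> L" "\<And>g. s < a g \<Longrightarrow> p $ g = 0" for p s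
  proof -
    obtain c where c: "p = (\<Sum>r\<in>R. c r *\<^sub>R z r)" using expand[OF p(1)] by blast
    have c0: "c r = 0" if "r \<in> R" "s < r" for r using top[of s c r] p(2) that c by simp
    have "p $ e = c s * z s $ e" if e: "a e = s" for e
    proof -
      have "p $ e = (\<Sum>r\<in>R. if r = s then c s * z s $ e else 0)"
        unfolding c sum_component
      proof (intro sum.cong refl)
        fix r assume r: "r \<in> R"
        consider "r < s" | "r = s" | "s < r" by linarith
        then show "(c r *\<^sub>R z r) $ e = (if r = s then c s * z s $ e else 0)"
          using z(3)[OF r, of e] e c0[OF r] by cases auto
      qed
      then show ?thesis using finR e by (auto simp: R_def)
    qed
    then show ?thesis by blast
  qed
  have nz: "z (a e) $ e \<noteq> 0" for e
  proof -
    obtain p where p: "p \<in> L" "p $ e \<noteq> 0" "\<And>f. a e < a f \<Longrightarrow> p $ f = 0"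
      using trop unfolding tropical_condition_def by metis
    then show ?thesis using lead[of p "a e"] by auto
  qed
  have rel: "\<exists>l. \<forall>p\<in>L. p $ e = (z (a e) $ e / z (a e) $ f) * p $ f + (\<Sum>g | a e < a g. l g * p $ g)"
    if ef: "a e = a f" for e f
  proof -
    let ?v = "axis e 1 - (z (a e) $ e / z (a e) $ f) *\<^sub>R axis f 1 :: real ^ 'i"
    have v: "?v \<bullet> p = p $ e - (z (a e) $ e / z (a e) $ f) * p $ f" for p
      by (simp add: inner_diff_left inner_axis')
    have "?v \<bullet> p = 0" if "p \<in> L" "\<And>g. g \<in> {g. a e < a g} \<Longrightarrow> p $ g = 0" for p
      using lead[of p "a e"] that nz[of f] ef unfolding v by auto
    then obtain l where l: "\<And>p. p \<in> L \<Longrightarrow> ?v \<bullet> p = (\<Sum>g | a e < a g. l g * p $ g)"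
      using linear_functional_relation[OF L, of "{g. a e < a g}" ?v] by blast
    have "p $ e = (z (a e) $ e / z (a e) $ f) * p $ f + (\<Sum>g | a e < a g. l g * p $ g)" if "p \<in> L" for p
      using l[OF that] unfolding v by simp
    then show ?thesis by blast
  qed
  have "\<forall>r. z r \<in> L" using z(1) by blast
  moreover have "\<forall>r e. r \<in> range a \<longrightarrow> r < a e \<longrightarrow> z r $ e = 0" using z(3) unfolding R_def by blast
  moreover have "\<forall>e. z (a e) $ e \<noteq> 0" using nz by blast
  moreover note rel
  ultimately show "\<exists>z. (\<forall>r. z r \<in> L) \<and> (\<forall>r e. r \<in> range a \<longrightarrow> r < a e \<longrightarrow> z r $ e = 0) \<and> (\<forall>e. z (a e) $ e \<noteq> 0) \<and>
      (\<forall>e f. a e = a f \<longrightarrow> (\<exists>l. \<forall>p\<in>L. p $ e = (z (a e) $ e / z (a e) $ f) * p $ f + (\<Sum>g | a e < a g. l g * p $ g)))"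
    by (intro exI[of _ z] conjI allI impI) simp_all
qed

lemma tropical_condition_closed:
  assumes lim: "\<And>e. (\<lambda>k. q k e) \<longlonglongrightarrow> a e" and q: "\<And>k. tropical_condition L (q k)"
  shows "tropical_condition L a"
  unfolding tropical_condition_def
proof
  fix e
  have "\<forall>\<^sub>F k in sequentially. \<forall>f\<in>{f. a e < a f}. q k e < q k f"
  proof (intro eventually_ball_finite ballI)
    fix f assume "f \<in> {f. a e < a f}"
    then have "0 < a f - a e" by simp
    moreover have "(\<lambda>k. q k f - q k e) \<longlonglongrightarrow> a f - a e" by (intro tendsto_diff lim)
    ultimately have "\<forall>\<^sub>F k in sequentially. 0 < q k f - q k e" by (intro order_tendstoD(1))
    then show "\<forall>\<^sub>F k in sequentially. q k e < q k f" by eventually_elim simp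
  qed simp
  then obtain k where "\<And>f. a e < a f \<Longrightarrow> q k e < q k f"
    by (auto simp: eventually_sequentially)
  then show "\<exists>z\<in>L. z $ e \<noteq> 0 \<and> (\<forall>f. a e < a f \<longrightarrow> z $ f = 0)"
    using q[of k] unfolding tropical_condition_def by blast
qed

section \<open>Generic data\<close>

text \<open>If \<open>w = a + b\<close>, where \<open>a\<close> and \<open>b\<close> have the level sets of \<open>f\<close> and \<open>g\<close>, then \<open>w\<close> lies in this
  space. Data are generic if they avoid those of these finitely many spaces that are proper.\<close>

definition level_space :: "('n::finite option \<Rightarrow> 'n option) \<Rightarrow> ('n \<Rightarrow> 'n) \<Rightarrow> (real ^ 'n) set" where
  "level_space f g = {w. \<exists>\<alpha> \<beta>. \<alpha> (f None) = 0 \<and> (\<forall>e. w $ e = \<alpha> (f (Some e)) + \<beta> (g e))}"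

definition bad_spaces :: "(real ^ 'n::finite) set set" where
  "bad_spaces = {V. V \<noteq> UNIV \<and> (\<exists>f g. V = level_space f g)}"

lemma finite_bad_spaces: "finite (bad_spaces :: (real ^ 'n::finite) set set)"
proof -
  have "(bad_spaces :: (real ^ 'n) set set) \<subseteq> (\<lambda>(f, g). level_space f g) ` UNIV"
    by (auto simp: bad_spaces_def)
  then show ?thesis by (rule finite_subset) simp
qed

lemma subspace_level_space: "subspace (level_space f g)"
  unfolding subspace_def
proof (intro conjI ballI allI)
  show "0 \<in> level_space f g"
    unfolding level_space_def by (auto intro!: exI[of _ "\<lambda>_. 0"])
next
  fix x y assume "x \<in> level_space f g" "y \<in> level_space f g"
  then obtain \<alpha> \<beta> \<alpha>' \<beta>' where "\<alpha> (f None) = 0" "\<And>e. x $ e = \<alpha> (f (Some e)) + \<beta> (g e)"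
    "\<alpha>' (f None) = 0" "\<And>e. y $ e = \<alpha>' (f (Some e)) + \<beta>' (g e)"
    by (auto simp: level_space_def)
  then show "x + y \<in> level_space f g" unfolding level_space_def
    by (auto intro!: exI[of _ "\<lambda>t. \<alpha> t + \<alpha>' t"] exI[of _ "\<lambda>t. \<beta> t + \<beta>' t"])
next
  fix x c assume "x \<in> level_space f g"
  then obtain \<alpha> \<beta> where "\<alpha> (f None) = 0" "\<And>e. x $ e = \<alpha> (f (Some e)) + \<beta> (g e)"
    by (auto simp: level_space_def)
  then show "c *\<^sub>R x \<in> level_space f g" unfolding level_space_def
    by (auto intro!: exI[of _ "\<lambda>t. c * \<alpha> t"] exI[of _ "\<lambda>t. c * \<beta> t"] simp: distrib_left)
qed

lemma level_functions_card:
  fixes a :: "'n::finite option \<Rightarrow> real" and b :: "'n \<Rightarrow> real"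
  assumes "\<And>c :: real ^ 'n. \<exists>\<alpha> \<beta>. (\<forall>x\<in>Z. \<alpha> x = 0) \<and> (\<forall>e. c $ e = \<alpha> (a (Some e)) + \<beta> (b e))"
  shows "CARD('n) \<le> card (range a - Z) + card (range b)"
proof -
  let ?A = "(\<lambda>r. \<chi> e. if a (Some e) = r then 1 else 0) ` (range a - Z) :: (real ^ 'n) set"
  let ?B = "(\<lambda>s. \<chi> e. if b e = s then 1 else 0) ` range b :: (real ^ 'n) set"
  have "c \<in> span (?A \<union> ?B)" for c :: "real ^ 'n"
  proof -
    obtain \<alpha> \<beta> where ab: "\<And>x. x \<in> Z \<Longrightarrow> \<alpha> x = 0" "\<And>e. c $ e = \<alpha> (a (Some e)) + \<beta> (b e)"
      using assms[of c] by blast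
    have 1: "(\<Sum>r\<in>range a - Z. \<alpha> r * (if a (Some e) = r then 1 else 0)) = \<alpha> (a (Some e))" for e
    proof -
      have "(\<Sum>r\<in>range a - Z. \<alpha> r * (if a (Some e) = r then 1 else 0)) =
          (\<Sum>r\<in>range a - Z. if r = a (Some e) then \<alpha> (a (Some e)) else 0)"
        by (intro sum.cong) auto
      then show ?thesis using ab(1) by auto
    qed
    have 2: "(\<Sum>s\<in>range b. \<beta> s * (if b e = s then 1 else 0)) = \<beta> (b e)" for e
    proof -
      have "(\<Sum>s\<in>range b. \<beta> s * (if b e = s then 1 else 0)) =
          (\<Sum>s\<in>range b. if s = b e then \<beta> (b e) else 0)"
        by (intro sum.cong) auto
      then show ?thesis by simp
    qed
    have "c = (\<Sum>r\<in>range a - Z. \<alpha> r *\<^sub>R (\<chi> e. if a (Some e) = r then 1 else 0)) +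
          (\<Sum>s\<in>range b. \<beta> s *\<^sub>R (\<chi> e. if b e = s then 1 else 0))"
      unfolding vec_eq_iff using 1 2 ab(2) by simp
    moreover have "(\<Sum>r\<in>range a - Z. \<alpha> r *\<^sub>R (\<chi> e. if a (Some e) = r then 1 else 0)) +
          (\<Sum>s\<in>range b. \<beta> s *\<^sub>R (\<chi> e. if b e = s then 1 else 0)) \<in> span (?A \<union> ?B)"
      by (intro span_add span_sum span_scale span_base) auto
    ultimately show ?thesis by simp
  qed
  then have "dim (UNIV :: (real ^ 'n) set) \<le> card (?A \<union> ?B)"
    by (intro dim_le_card) auto
  also have "\<dots> \<le> card ?A + card ?B" by (rule card_Un_le)
  also have "\<dots> \<le> card (range a - Z) + card (range b)"
    by (intro add_mono card_image_le) auto
  finally show ?thesis by simp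
qed

locale generic_tropical_point = linear_model_loc X d for X :: "(real ^ 'n) set" and d :: nat +
  fixes a :: "'n option \<Rightarrow> real" and b :: "'n \<Rightarrow> real"
  assumes a_None: "a None = 0"
    and trop_a: "tropical_condition (model_cone X) a"
    and trop_b: "tropical_condition (model_perp X) b"
    and generic: "(\<chi> e. a (Some e) + b e) \<notin> \<Union>bad_spaces"
begin

text \<open>The bipartite graph whose vertices are the level sets of \<open>a\<close> and of \<open>b\<close>, with one edge per
  coordinate, is a tree: its incidence equations are solvable and it is connected.\<close>

lemma level_equations:
  fixes c :: "'n \<Rightarrow> real"
  obtains \<alpha> \<beta> :: "real \<Rightarrow> real" where "\<alpha> 0 = 0" "\<And>e. c e = \<alpha> (a (Some e)) + \<beta> (b e)"
proof -
  let ?f = "\<lambda>e. inv_into UNIV a (a e)" and ?g = "\<lambda>e. inv_into UNIV b (b e)"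
  have af: "a (?f e) = a e" and bg: "b (?g i) = b i" for e i
    by (auto intro: f_inv_into_f)
  have "(\<chi> e. a (Some e) + b e) \<in> level_space ?f ?g"
    unfolding level_space_def using af[of None] af bg a_None
    by (intro CollectI exI[of _ a] exI[of _ b]) simp
  then have "level_space ?f ?g = UNIV"
    using generic unfolding bad_spaces_def by blast
  then have "(\<chi> e. c e) \<in> level_space ?f ?g" by simp
  then obtain \<alpha> \<beta> where "\<alpha> (?f None) = 0" "\<And>e. c e = \<alpha> (?f (Some e)) + \<beta> (?g e)"
    unfolding level_space_def by auto
  then show ?thesis
    using that[of "\<lambda>x. \<alpha> (inv_into UNIV a x)" "\<lambda>x. \<beta> (inv_into UNIV b x)"] a_None by simp
qed

lemma card_levels: "card (range a) + card (range b) = CARD('n) + 1"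
    "dim (model_cone X) = card (range a)" "dim Y = card (range b)"
proof -
  have "CARD('n) \<le> card (range a - {0}) + card (range b)"
    by (rule level_functions_card) (metis level_equations singletonD)
  moreover have "card (range a - {0}) = card (range a) - 1"
    using a_None by (intro card_Diff_singleton) (metis rangeI)
  moreover have "card (range a) > 0" by (simp add: card_gt_0_iff)
  moreover note tropical_condition_basis(1)[OF subspace_model_cone trop_a]
    tropical_condition_basis(1)[OF subspace_Y trop_b] dim_model_cone_perp
  ultimately show "card (range a) + card (range b) = CARD('n) + 1"
    "dim (model_cone X) = card (range a)" "dim Y = card (range b)" by linarith+
qed

lemma connected:
  assumes P0: "P 0" and PQ: "\<And>e. P (a (Some e)) \<longleftrightarrow> Q (b e)"
  shows "P (a k)"
proof (rule ccontr)
  assume k: "\<not> P (a k)"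
  have "\<exists>\<alpha> \<beta>. (\<forall>x\<in>{0, a k}. \<alpha> x = 0) \<and> (\<forall>e. c $ e = \<alpha> (a (Some e)) + \<beta> (b e))" for c :: "real ^ 'n"
  proof -
    obtain \<alpha> \<beta> where ab: "\<alpha> 0 = 0" "\<And>e. c $ e = \<alpha> (a (Some e)) + \<beta> (b e)"
      using level_equations[of "\<lambda>e. c $ e"] by metis
    define \<kappa> where "\<kappa> = \<alpha> (a k)"
    show ?thesis
      using ab k P0 PQ
      by (intro exI[of _ "\<lambda>x. \<alpha> x - (if P x then 0 else \<kappa>)"] exI[of _ "\<lambda>x. \<beta> x + (if Q x then 0 else \<kappa>)"])
        (auto simp: \<kappa>_def)
  qed
  from level_functions_card[of "{0, a k}" a b, OF this]
  have "CARD('n) \<le> card (range a - {0, a k}) + card (range b)" .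
  moreover have sub: "{0, a k} \<subseteq> range a" using a_None by (metis empty_subsetI insert_subset rangeI)
  moreover have "card (range a - {0, a k}) = card (range a) - card {0, a k}"
    using sub by (intro card_Diff_subset) auto
  moreover have "a k \<noteq> 0" using k P0 by metis
  moreover from this have "card {0, a k} = 2" by simp
  moreover have "card {0, a k} \<le> card (range a)"
    using sub by (intro card_mono) auto
  ultimately show False using card_levels(1) by linarith
qed

lemma basis_a:
  obtains z where "\<And>r. z r \<in> model_cone X" "\<And>r e. r \<in> range a \<Longrightarrow> r < a e \<Longrightarrow> z r $ e = 0"
    "\<And>e. z (a e) $ e \<noteq> 0"
    "\<And>e f. a e = a f \<Longrightarrow> \<exists>l. \<forall>p\<in>model_cone X. p $ e = (z (a e) $ e / z (a e) $ f) * p $ f + (\<Sum>g | a e < a g. l g * p $ g)"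
  using tropical_condition_basis(2)[OF subspace_model_cone trop_a card_levels(2)[THEN eq_refl]] that by blast

lemma basis_b:
  obtains z where "\<And>r. z r \<in> Y" "\<And>r e. r \<in> range b \<Longrightarrow> r < b e \<Longrightarrow> z r $ e = 0"
    "\<And>e. z (b e) $ e \<noteq> 0"
    "\<And>e f. b e = b f \<Longrightarrow> \<exists>l. \<forall>p\<in>Y. p $ e = (z (b e) $ e / z (b e) $ f) * p $ f + (\<Sum>g | b e < b g. l g * p $ g)"
  using tropical_condition_basis(2)[OF subspace_Y trop_b card_levels(3)[THEN eq_refl]] that by blast

end

section \<open>Tropical limits of real critical points\<close>

text \<open>The coordinates of the points \<open>p k\<close> behave like \<open>\<plusminus>t\<^bsup>a\<^esup>\<close> for a parameter \<open>t\<close> tending to 0.\<close>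

definition asymptotic_signs :: "(real ^ 'i) set \<Rightarrow> ('i \<Rightarrow> real) \<Rightarrow> ('i \<Rightarrow> bool) \<Rightarrow> bool" where
  "asymptotic_signs L a s \<longleftrightarrow> (\<exists>p :: nat \<Rightarrow> real ^ 'i. (\<forall>k. p k \<in> L) \<and>
     (\<forall>k e. p k $ e \<noteq> 0 \<and> (0 < p k $ e \<longleftrightarrow> s e)) \<and>
     (\<forall>e f. a e < a f \<longrightarrow> (\<lambda>k. p k $ f / p k $ e) \<longlonglongrightarrow> 0))"

lemma asymptotic_signs_tropical_condition:
  assumes L: "subspace L" and "asymptotic_signs L a s"
  shows "tropical_condition L a"
  unfolding tropical_condition_def
proof
  fix e
  obtain p where p: "\<And>k. p k \<in> L" "\<And>k e. p k $ e \<noteq> 0"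
    "\<And>e f. a e < a f \<Longrightarrow> (\<lambda>k. p k $ f / p k $ e) \<longlonglongrightarrow> 0"
    using assms unfolding asymptotic_signs_def by blast
  define \<pi> :: "real ^ 'a \<Rightarrow> real ^ 'a" where "\<pi> = (\<lambda>x. \<chi> f. if f = e \<or> a e < a f then x $ f else 0)"
  have "linear \<pi>" by (intro linearI) (auto simp: \<pi>_def vec_eq_iff)
  then have cl: "closed (\<pi> ` L)" by (intro closed_subspace linear_subspace_image L)
  have mem: "\<pi> ((1 / p k $ e) *\<^sub>R p k) \<in> \<pi> ` L" for k
    by (intro imageI subspace_scale L p)
  have lim: "(\<lambda>k. \<pi> ((1 / p k $ e) *\<^sub>R p k)) \<longlonglongrightarrow> axis e 1"
  proof (rule vec_tendstoI)
    fix f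
    consider "f = e" | "f \<noteq> e" "a e < a f" | "f \<noteq> e" "\<not> a e < a f" by blast
    then show "(\<lambda>k. \<pi> ((1 / p k $ e) *\<^sub>R p k) $ f) \<longlonglongrightarrow> axis e 1 $ f"
      by cases (use p(2,3) in \<open>auto simp: \<pi>_def axis_def\<close>)
  qed
  have "axis e 1 \<in> \<pi> ` L" by (rule closed_sequentially[OF cl mem lim])
  then obtain z where z: "z \<in> L" "axis e 1 = \<pi> z" by blast
  have "z $ e = 1" using arg_cong[OF z(2), of "\<lambda>x. x $ e"] by (simp add: \<pi>_def axis_def)
  moreover have "z $ f = 0" if "a e < a f" for f
  proof -
    have "f \<noteq> e" using that by auto
    then show ?thesis using arg_cong[OF z(2), of "\<lambda>x. x $ f"] that by (simp add: \<pi>_def axis_def)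
  qed
  ultimately show "\<exists>z\<in>L. z $ e \<noteq> 0 \<and> (\<forall>f. a e < a f \<longrightarrow> z $ f = 0)"
    using z(1) by (intro bexI[of _ z]) auto
qed

lemma asymptotic_signs_ratio:
  assumes "asymptotic_signs L a s" "a e = a f" "\<gamma> \<noteq> 0"
    and rel: "\<And>p. p \<in> L \<Longrightarrow> p $ e = \<gamma> * p $ f + (\<Sum>g | a e < a g. l g * p $ g)"
  shows "s e = s f \<longleftrightarrow> \<gamma> > 0"
proof -
  obtain p where p: "\<And>k. p k \<in> L" "\<And>k e. p k $ e \<noteq> 0" "\<And>k e. 0 < p k $ e \<longleftrightarrow> s e"
    "\<And>e f. a e < a f \<Longrightarrow> (\<lambda>k. p k $ f / p k $ e) \<longlonglongrightarrow> 0"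
    using assms unfolding asymptotic_signs_def by blast
  have "(\<lambda>k. \<gamma> + (\<Sum>g | a e < a g. l g * (p k $ g / p k $ f))) \<longlonglongrightarrow> \<gamma> + (\<Sum>g | a e < a g. l g * 0)"
    using p(4) assms(2) by (intro tendsto_intros) auto
  moreover have "\<gamma> + (\<Sum>g | a e < a g. l g * (p k $ g / p k $ f)) = p k $ e / p k $ f" for k
    unfolding rel[OF p(1)] using p(2)[of k f] by (simp add: add_divide_distrib sum_divide_distrib)
  ultimately have lim: "(\<lambda>k. p k $ e / p k $ f) \<longlonglongrightarrow> \<gamma>" by simp
  have pos: "p k $ e / p k $ f > 0 \<longleftrightarrow> (s e = s f)" for k
  proof -
    have "x / y > 0 \<longleftrightarrow> (0 < x \<longleftrightarrow> 0 < y)" if "x \<noteq> 0" "y \<noteq> 0" for x y :: real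
      using that by (cases "0 < x"; cases "0 < y") (auto simp: zero_less_divide_iff)
    then show ?thesis using p(2) p(3) by metis
  qed
  show ?thesis
  proof
    assume "\<gamma> > 0"
    from order_tendstoD(1)[OF lim this] obtain k where "p k $ e / p k $ f > 0"
      by (auto simp: eventually_sequentially)
    then show "s e = s f" using pos by blast
  next
    assume "s e = s f"
    then have "p k $ e / p k $ f > 0" for k using pos by blast
    then have "0 \<le> p k $ e / p k $ f" for k by (rule less_imp_le)
    then have "0 \<le> \<gamma>" by (intro tendsto_lowerbound[OF lim] always_eventually) auto
    then show "\<gamma> > 0" using assms(3) by simp
  qed
qed

lemma (in generic_tropical_point) asymptotic_signs_unique:
  assumes "asymptotic_signs (model_cone X) a (case_option True s)" "asymptotic_signs Y b s"
    "asymptotic_signs (model_cone X) a (case_option True s')" "asymptotic_signs Y b s'"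
  shows "s = s'"
proof -
  let ?s = "case_option True s" and ?s' = "case_option True s'"
  obtain z where z: "\<And>e. z (a e) $ e \<noteq> 0"
    "\<And>e f. a e = a f \<Longrightarrow> \<exists>l. \<forall>p\<in>model_cone X. p $ e = (z (a e) $ e / z (a e) $ f) * p $ f + (\<Sum>g | a e < a g. l g * p $ g)"
    by (rule basis_a) (rule that)
  obtain y where y: "\<And>e. y (b e) $ e \<noteq> 0"
    "\<And>e f. b e = b f \<Longrightarrow> \<exists>l. \<forall>p\<in>Y. p $ e = (y (b e) $ e / y (b e) $ f) * p $ f + (\<Sum>g | b e < b g. l g * p $ g)"
    by (rule basis_b) (rule that)
  have eqa: "?s e = ?s f \<longleftrightarrow> ?s' e = ?s' f" if ef: "a e = a f" for e f
  proof -
    obtain l where l: "\<And>p. p \<in> model_cone X \<Longrightarrow> p $ e = (z (a e) $ e / z (a e) $ f) * p $ f + (\<Sum>g | a e < a g. l g * p $ g)"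
      using z(2)[OF ef] by blast
    have nz: "z (a e) $ e / z (a e) $ f \<noteq> 0" using z(1)[of e] z(1)[of f] ef by simp
    show ?thesis
      using asymptotic_signs_ratio[OF assms(1) ef nz l] asymptotic_signs_ratio[OF assms(3) ef nz l] by simp
  qed
  have eqb: "s e = s f \<longleftrightarrow> s' e = s' f" if ef: "b e = b f" for e f
  proof -
    obtain l where l: "\<And>p. p \<in> Y \<Longrightarrow> p $ e = (y (b e) $ e / y (b e) $ f) * p $ f + (\<Sum>g | b e < b g. l g * p $ g)"
      using y(2)[OF ef] by blast
    have nz: "y (b e) $ e / y (b e) $ f \<noteq> 0" using y(1)[of e] y(1)[of f] ef by simp
    show ?thesis
      using asymptotic_signs_ratio[OF assms(2) ef nz l] asymptotic_signs_ratio[OF assms(4) ef nz l] by simp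
  qed
  have Pa: "(\<forall>f. a f = a e \<longrightarrow> ?s f = ?s' f) \<longleftrightarrow> ?s e = ?s' e" for e using eqa[of e] by metis
  have Pb: "(\<forall>f. b f = b e \<longrightarrow> s f = s' f) \<longleftrightarrow> s e = s' e" for e using eqb[of e] by metis
  have "(\<lambda>r. \<forall>f. a f = r \<longrightarrow> ?s f = ?s' f) (a (Some e))" for e
  proof (rule connected[where Q = "\<lambda>r. \<forall>f. b f = r \<longrightarrow> s f = s' f"])
    show "\<forall>f. a f = 0 \<longrightarrow> ?s f = ?s' f" using Pa[of None] a_None by simp
    show "(\<forall>f. a f = a (Some e) \<longrightarrow> ?s f = ?s' f) \<longleftrightarrow> (\<forall>f. b f = b e \<longrightarrow> s f = s' f)" for e
      using Pa[of "Some e"] Pb[of e] by simp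
  qed
  then show ?thesis unfolding Pa by (auto simp: fun_eq_iff)
qed

definition tropical_points :: "(real ^ 'n) set \<Rightarrow> real ^ 'n \<Rightarrow> (real ^ 'n) set" where
  "tropical_points X w = {q. tropical_condition (model_cone X) (case_option 0 (($) q)) \<and>
     tropical_condition (model_perp X) (\<lambda>i. w $ i - q $ i)}"

context linear_model_loc
begin

lemma sign_bound:
  assumes "p \<in> A" "p' \<in> A" "q \<in> Y" "\<And>i. 0 \<le> q $ i * p $ i"
  shows "\<bar>q $ i\<bar> * \<bar>p $ i\<bar> \<le> q \<bullet> p'"
proof -
  have "q \<bullet> (p - p') = 0" using assms diff_affine by (simp add: model_perp_eq)
  then have "q \<bullet> p' = (\<Sum>i\<in>UNIV. q $ i * p $ i)"
    unfolding inner_diff_right by (simp add: inner_vec_def)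
  moreover have "q $ i * p $ i \<le> (\<Sum>i\<in>UNIV. q $ i * p $ i)"
    using assms(4) by (intro member_le_sum) auto
  moreover have "\<bar>q $ i\<bar> * \<bar>p $ i\<bar> = q $ i * p $ i" using assms(4)[of i] by (simp flip: abs_mult)
  ultimately show ?thesis by simp
qed

lemma bounded_signs_asymptotic:
  assumes \<sigma>: "\<sigma> \<in> bounded_signs X"
  obtains q :: "real ^ 'n" where "asymptotic_signs (model_cone X) (case_option 0 (($) q)) (case_option True \<sigma>)"
    "asymptotic_signs Y (\<lambda>i. w $ i - q $ i) \<sigma>"
proof -
  obtain p0 q0 where p0: "p0 \<in> A" "\<And>i. p0 $ i \<noteq> 0" "\<And>i. 0 < p0 $ i \<longleftrightarrow> \<sigma> i"
    and q0: "q0 \<in> Y" "\<And>i. q0 $ i \<noteq> 0" "\<And>i. 0 < q0 $ i \<longleftrightarrow> \<sigma> i"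
    using \<sigma> by (auto simp: bounded_signs_def)
  define u where "u = (\<lambda>k :: nat. \<chi> i :: 'n. exp (- (real k + 1) * w $ i))"
  have upos: "u k $ i > 0" for k i by (simp add: u_def)
  have "\<forall>k. \<exists>p. p \<in> A \<and> (\<forall>i. p $ i \<noteq> 0) \<and> (\<forall>i. 0 < p $ i \<longleftrightarrow> \<sigma> i) \<and> (\<chi> i. u k $ i / p $ i) \<in> Y"
  proof
    fix k show "\<exists>p. p \<in> A \<and> (\<forall>i. p $ i \<noteq> 0) \<and> (\<forall>i. 0 < p $ i \<longleftrightarrow> \<sigma> i) \<and> (\<chi> i. u k $ i / p $ i) \<in> Y"
      by (rule real_critical_exists[OF upos \<sigma>]) blast
  qed
  then obtain p where p: "\<And>k. p k \<in> A" "\<And>k i. p k $ i \<noteq> 0" "\<And>k i. 0 < p k $ i \<longleftrightarrow> \<sigma> i"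
    "\<And>k. (\<chi> i. u k $ i / p k $ i) \<in> Y" by metis
  define q where "q = (\<lambda>k. \<chi> i. u k $ i / p k $ i)"
  have q: "q k \<in> Y" "q k $ i \<noteq> 0" "0 < q k $ i \<longleftrightarrow> \<sigma> i" "q k $ i * p k $ i = u k $ i" for k i
    using p(4)[of k] p(2,3)[of k i] upos[of k i] by (auto simp: q_def zero_less_divide_iff less_imp_neq[symmetric])
  have same: "0 \<le> x * y" if "x \<noteq> 0" "y \<noteq> 0" "0 < x \<longleftrightarrow> \<sigma> i" "0 < y \<longleftrightarrow> \<sigma> i" for x y :: real and i
    using that by (auto simp: zero_le_mult_iff less_le not_le)
  have bp: "\<bar>p k $ i\<bar> \<le> (q0 \<bullet> p0) / \<bar>q0 $ i\<bar>" for k i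
    using sign_bound[OF p(1)[of k] p0(1) q0(1) same[OF q0(2) p(2) q0(3) p(3)], of i] q0(2)[of i]
    by (simp add: field_simps)
  define W where "W = (\<Sum>i\<in>UNIV. \<bar>w $ i\<bar>)"
  have qp: "q k \<bullet> p k \<le> CARD('n) * exp ((real k + 1) * W)" for k
  proof -
    have "q k \<bullet> p k = (\<Sum>i\<in>UNIV. u k $ i)" by (simp add: inner_vec_def q(4))
    also have "\<dots> \<le> (\<Sum>i\<in>(UNIV :: 'n set). exp ((real k + 1) * W))"
    proof (intro sum_mono)
      fix i :: 'n
      have "\<bar>w $ i\<bar> \<le> W" unfolding W_def by (intro member_le_sum) auto
      then have "- w $ i \<le> W" by linarith
      then have "(real k + 1) * - w $ i \<le> (real k + 1) * W" by (intro mult_left_mono) auto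
      then show "u k $ i \<le> exp ((real k + 1) * W)" by (simp add: u_def algebra_simps)
    qed
    finally show ?thesis by simp
  qed
  have bq: "\<bar>q k $ i\<bar> \<le> CARD('n) * exp ((real k + 1) * W) / \<bar>p0 $ i\<bar>" for k i
  proof -
    have "\<bar>q k $ i\<bar> * \<bar>p0 $ i\<bar> \<le> q k \<bullet> p k"
      by (rule sign_bound[OF p0(1) p(1) q(1) same[OF q(2) p0(2) q(3) p0(3)]])
    with qp[of k] have "\<bar>q k $ i\<bar> * \<bar>p0 $ i\<bar> \<le> CARD('n) * exp ((real k + 1) * W)" by linarith
    then show ?thesis using p0(2)[of i] by (simp add: field_simps)
  qed
  define v where "v = (\<lambda>k. \<chi> i. - ln \<bar>p k $ i\<bar> / (real k + 1))"
  define C where "C = (\<lambda>i. \<bar>ln ((q0 \<bullet> p0) / \<bar>q0 $ i\<bar>)\<bar> + \<bar>ln (CARD('n) / \<bar>p0 $ i\<bar>)\<bar> + W + \<bar>w $ i\<bar>)"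
  have lnq: "ln \<bar>q k $ i\<bar> = - (real k + 1) * w $ i - ln \<bar>p k $ i\<bar>" for k i
  proof -
    have "ln (\<bar>q k $ i\<bar> * \<bar>p k $ i\<bar>) = - (real k + 1) * w $ i"
      using q(4)[of k i] upos[of k i] by (simp flip: abs_mult) (simp add: u_def)
    then show ?thesis using q(2)[of k i] p(2)[of k i] by (simp add: ln_mult)
  qed
  have vb: "\<bar>v k $ i\<bar> \<le> C i" for k i
  proof -
    have W0: "W \<ge> 0" by (simp add: W_def sum_nonneg)
    have "ln \<bar>p k $ i\<bar> \<le> ln ((q0 \<bullet> p0) / \<bar>q0 $ i\<bar>)"
      using bp[of k i] p(2)[of k i] by (intro ln_mono) auto
    then have "ln \<bar>p k $ i\<bar> \<le> \<bar>ln ((q0 \<bullet> p0) / \<bar>q0 $ i\<bar>)\<bar>" by linarith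
    also have "\<dots> \<le> (real k + 1) * \<bar>ln ((q0 \<bullet> p0) / \<bar>q0 $ i\<bar>)\<bar>"
      by (simp add: mult_le_cancel_right1)
    finally have 1: "ln \<bar>p k $ i\<bar> / (real k + 1) \<le> \<bar>ln ((q0 \<bullet> p0) / \<bar>q0 $ i\<bar>)\<bar>"
      by (simp add: field_simps)
    have "ln \<bar>q k $ i\<bar> \<le> ln (CARD('n) / \<bar>p0 $ i\<bar> * exp ((real k + 1) * W))"
      using bq[of k i] q(2)[of k i] by (intro ln_mono) (auto simp: mult_ac)
    also have "\<dots> = ln (CARD('n) / \<bar>p0 $ i\<bar>) + (real k + 1) * W"
      using p0(2)[of i] by (subst ln_mult) auto
    also have "\<dots> \<le> (real k + 1) * \<bar>ln (CARD('n) / \<bar>p0 $ i\<bar>)\<bar> + (real k + 1) * W"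
    proof -
      have "1 * \<bar>ln (CARD('n) / \<bar>p0 $ i\<bar>)\<bar> \<le> (real k + 1) * \<bar>ln (CARD('n) / \<bar>p0 $ i\<bar>)\<bar>"
        by (intro mult_right_mono) auto
      then show ?thesis by linarith
    qed
    finally have "- ln \<bar>p k $ i\<bar> \<le> (real k + 1) * (\<bar>ln (CARD('n) / \<bar>p0 $ i\<bar>)\<bar> + W + w $ i)"
      unfolding lnq by (simp add: algebra_simps)
    then have 2: "- ln \<bar>p k $ i\<bar> / (real k + 1) \<le> \<bar>ln (CARD('n) / \<bar>p0 $ i\<bar>)\<bar> + W + w $ i"
      by (simp add: field_simps)
    show ?thesis using 1 2 W0 unfolding v_def C_def vec_lambda_beta by (simp add: abs_le_iff) linarith
  qed
  have "norm (v k) \<le> (\<Sum>i\<in>UNIV. C i)" for k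
    using vb by (intro order_trans[OF norm_le_l1_cart] sum_mono) auto
  then have "bounded (range v)" by (auto simp: bounded_iff)
  then obtain l r where lr: "strict_mono r" "(v \<circ> r) \<longlonglongrightarrow> l"
    using bounded_imp_convergent_subsequence by blast
  have vlim: "(\<lambda>k. v (r k) $ i) \<longlonglongrightarrow> l $ i" for i
    using tendsto_vec_nth[OF lr(2), of i] by (simp add: o_def)
  have rlim: "filterlim (\<lambda>k. real (r k) + 1) at_top sequentially"
    using filterlim_compose[OF filterlim_real_sequentially filterlim_subseq[OF lr(1)]]
    by (subst add.commute) (intro filterlim_tendsto_add_at_top[OF tendsto_const])
  have ratio: "(\<lambda>k. x k / y k) \<longlonglongrightarrow> 0"
    if xy: "\<And>k. x k \<noteq> 0" "\<And>k. y k \<noteq> 0" and c: "c > 0"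
      "(\<lambda>k. (ln \<bar>y k\<bar> - ln \<bar>x k\<bar>) / (real (r k) + 1)) \<longlonglongrightarrow> c" for x y :: "nat \<Rightarrow> real" and c
  proof -
    have "filterlim (\<lambda>k. (ln \<bar>y k\<bar> - ln \<bar>x k\<bar>) / (real (r k) + 1) * (real (r k) + 1)) at_top sequentially"
      by (rule filterlim_tendsto_pos_mult_at_top[OF c(2,1) rlim])
    moreover have "(ln \<bar>y k\<bar> - ln \<bar>x k\<bar>) / (real (r k) + 1) * (real (r k) + 1) = - (ln \<bar>x k\<bar> - ln \<bar>y k\<bar>)" for k
    proof -
      have "real (r k) + 1 \<noteq> 0" by linarith
      then show ?thesis by simp
    qed
    ultimately have "filterlim (\<lambda>k. - (ln \<bar>x k\<bar> - ln \<bar>y k\<bar>)) at_top sequentially"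
      by (simp only:)
    then have "filterlim (\<lambda>k. ln \<bar>x k\<bar> - ln \<bar>y k\<bar>) at_bot sequentially"
      by (simp add: filterlim_uminus_at_bot)
    then have "(\<lambda>k. exp (ln \<bar>x k\<bar> - ln \<bar>y k\<bar>)) \<longlonglongrightarrow> 0"
      by (rule filterlim_compose[OF exp_at_bot])
    moreover have "exp (ln \<bar>x k\<bar> - ln \<bar>y k\<bar>) = \<bar>x k / y k\<bar>" for k
      using xy[of k] by (simp add: exp_diff)
    ultimately have "(\<lambda>k. \<bar>x k / y k\<bar>) \<longlonglongrightarrow> 0" by (simp only:)
    then show ?thesis by (simp only: tendsto_rabs_zero_iff)
  qed
  have "asymptotic_signs (model_cone X) (case_option 0 (($) l)) (case_option True \<sigma>)"
    unfolding asymptotic_signs_def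
  proof (intro exI[of _ "\<lambda>k. \<chi> j. case j of None \<Rightarrow> 1 | Some i \<Rightarrow> p (r k) $ i"] conjI allI impI)
    let ?P = "\<lambda>k. (\<chi> j. case j of None \<Rightarrow> 1 | Some i \<Rightarrow> p (r k) $ i) :: real ^ 'n option"
    show "?P k \<in> model_cone X" for k
      using p(1)[of "r k"] by (simp add: model_cone_def affine_model_def)
    show "?P k $ e \<noteq> 0" "(0 < ?P k $ e) = case_option True \<sigma> e" for k e
      using p(2,3) by (auto split: option.split)
    fix e f assume ef: "case_option 0 (($) l) e < case_option 0 (($) l) f"
    have V: "(\<lambda>k. - ln \<bar>?P k $ j\<bar> / (real (r k) + 1)) \<longlonglongrightarrow> case_option 0 (($) l) j" for j
      using vlim by (cases j) (auto simp: v_def)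
    have "(\<lambda>k. - ln \<bar>?P k $ f\<bar> / (real (r k) + 1) - - ln \<bar>?P k $ e\<bar> / (real (r k) + 1))
        \<longlonglongrightarrow> case_option 0 (($) l) f - case_option 0 (($) l) e"
      by (intro tendsto_diff V)
    then have "(\<lambda>k. (ln \<bar>?P k $ e\<bar> - ln \<bar>?P k $ f\<bar>) / (real (r k) + 1))
        \<longlonglongrightarrow> case_option 0 (($) l) f - case_option 0 (($) l) e"
      by (simp add: diff_divide_distrib)
    then show "(\<lambda>k. ?P k $ f / ?P k $ e) \<longlonglongrightarrow> 0"
      using ef p(2) by (intro ratio) (auto split: option.split)
  qed
  moreover have "asymptotic_signs Y (\<lambda>i. w $ i - l $ i) \<sigma>"
    unfolding asymptotic_signs_def
  proof (intro exI[of _ "\<lambda>k. q (r k)"] conjI allI impI)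
    show "q (r k) \<in> Y" "q (r k) $ e \<noteq> 0" "(0 < q (r k) $ e) = \<sigma> e" for k e
      using q by auto
    fix e f assume ef: "w $ e - l $ e < w $ f - l $ f"
    have V: "(\<lambda>k. - ln \<bar>q (r k) $ j\<bar> / (real (r k) + 1)) \<longlonglongrightarrow> w $ j - l $ j" for j
    proof -
      have "- ln \<bar>q (r k) $ j\<bar> / (real (r k) + 1) = w $ j - v (r k) $ j" for k
        unfolding lnq by (simp add: v_def field_simps)
      then show ?thesis using vlim[of j] by (auto intro!: tendsto_intros)
    qed
    have "(\<lambda>k. - ln \<bar>q (r k) $ f\<bar> / (real (r k) + 1) - - ln \<bar>q (r k) $ e\<bar> / (real (r k) + 1))
        \<longlonglongrightarrow> (w $ f - l $ f) - (w $ e - l $ e)"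
      by (intro tendsto_diff V)
    then have "(\<lambda>k. (ln \<bar>q (r k) $ e\<bar> - ln \<bar>q (r k) $ f\<bar>) / (real (r k) + 1))
        \<longlonglongrightarrow> (w $ f - l $ f) - (w $ e - l $ e)"
      by (simp add: diff_divide_distrib)
    then show "(\<lambda>k. q (r k) $ f / q (r k) $ e) \<longlonglongrightarrow> 0"
      using ef q(2) by (intro ratio) auto
  qed
  ultimately show ?thesis using that by blast
qed

lemma generic_tropical_pointI:
  assumes "q \<in> tropical_points X w" "w \<notin> \<Union>bad_spaces"
  shows "generic_tropical_point X d (case_option 0 (($) q)) (\<lambda>i. w $ i - q $ i)"
  using assms by unfold_locales (auto simp: tropical_points_def)

proposition card_bounded_signs_le:
  assumes w: "w \<notin> \<Union>bad_spaces" and fin: "finite (tropical_points X w)"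
  shows "card (bounded_signs X) \<le> card (tropical_points X w)"
proof -
  let ?a = "\<lambda>q :: real ^ 'n. case_option 0 (($) q) :: 'n option \<Rightarrow> real" and ?b = "\<lambda>q i. w $ i - q $ i"
  have "\<forall>\<sigma>. \<exists>q. \<sigma> \<in> bounded_signs X \<longrightarrow> asymptotic_signs (model_cone X) (?a q) (case_option True \<sigma>)
      \<and> asymptotic_signs Y (?b q) \<sigma>"
    using bounded_signs_asymptotic[of _ w] by metis
  then obtain Q where Q: "\<And>\<sigma>. \<sigma> \<in> bounded_signs X \<Longrightarrow>
      asymptotic_signs (model_cone X) (?a (Q \<sigma>)) (case_option True \<sigma>) \<and> asymptotic_signs Y (?b (Q \<sigma>)) \<sigma>"
    by metis
  have T: "Q \<sigma> \<in> tropical_points X w" if "\<sigma> \<in> bounded_signs X" for \<sigma>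
    using Q[OF that] asymptotic_signs_tropical_condition[OF subspace_model_cone]
      asymptotic_signs_tropical_condition[OF subspace_Y] by (auto simp: tropical_points_def)
  have "inj_on Q (bounded_signs X)"
  proof (rule inj_onI)
    fix \<sigma> \<sigma>' assume s: "\<sigma> \<in> bounded_signs X" "\<sigma>' \<in> bounded_signs X" "Q \<sigma> = Q \<sigma>'"
    interpret generic_tropical_point X d "?a (Q \<sigma>)" "?b (Q \<sigma>)"
      by (rule generic_tropical_pointI[OF T[OF s(1)] w])
    show "\<sigma> = \<sigma>'" using asymptotic_signs_unique[of \<sigma> \<sigma>'] Q[OF s(1)] Q[OF s(2)] s(3) by simp
  qed
  then show ?thesis using T by (intro card_inj_on_le[OF _ _ fin]) auto
qed

end

section \<open>Puiseux series\<close>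

text \<open>The series \<open>f(t\<^bsup>1/m\<^esup>)\<close>, where \<open>m = 0\<close> is read as \<open>m = 1\<close>.\<close>

definition puiseux_of_fls :: "nat \<Rightarrow> 'a::field fls \<Rightarrow> 'a puiseux" where
  "puiseux_of_fls m f = abs_puiseux (max 1 m, f)"

lemma puiseux_rel_refl: "puiseux_rel (max 1 m, f) (max 1 m, f)"
  by (simp add: puiseux_rel_def)

lemma abs_puiseux_eq_iff:
  "n > 0 \<Longrightarrow> m > 0 \<Longrightarrow> abs_puiseux (n, f) = abs_puiseux (m, g) \<longleftrightarrow>
    fls_compose_power f m = fls_compose_power g n"
  using Quotient3_rel[OF Quotient3_puiseux, of "(n, f)" "(m, g)"] by (auto simp: puiseux_rel_def)

lemma puiseux_of_fls_add: "puiseux_of_fls m f + puiseux_of_fls m g = puiseux_of_fls m (f + g)"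
  unfolding puiseux_of_fls_def plus_puiseux.abs_eq[OF puiseux_rel_refl puiseux_rel_refl]
  by (simp add: abs_puiseux_eq_iff fls_compose_power_compose_power)

lemma puiseux_of_fls_mult: "puiseux_of_fls m f * puiseux_of_fls m g = puiseux_of_fls m (f * g)"
  unfolding puiseux_of_fls_def times_puiseux.abs_eq[OF puiseux_rel_refl puiseux_rel_refl]
  by (simp add: abs_puiseux_eq_iff fls_compose_power_compose_power)

lemma puiseux_of_fls_eq_iff [simp]: "puiseux_of_fls m f = puiseux_of_fls m g \<longleftrightarrow> f = g"
  by (simp add: puiseux_of_fls_def abs_puiseux_eq_iff fls_compose_power_inject)

lemma puiseux_of_fls_0 [simp]: "puiseux_of_fls m 0 = 0"
  by (metis add_cancel_right_right puiseux_of_fls_add add_0)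

lemma puiseux_of_fls_1 [simp]: "puiseux_of_fls m 1 = 1"
  unfolding puiseux_of_fls_def one_puiseux_def by (simp add: abs_puiseux_eq_iff)

lemma puiseux_of_fls_eq_0_iff [simp]: "puiseux_of_fls m f = 0 \<longleftrightarrow> f = 0"
  using puiseux_of_fls_eq_iff[of m f 0] by (simp del: puiseux_of_fls_eq_iff)

lemma puiseux_of_fls_sum: "puiseux_of_fls m (\<Sum>i\<in>I. f i) = (\<Sum>i\<in>I. puiseux_of_fls m (f i))"
  by (induction I rule: infinite_finite_induct) (simp_all flip: puiseux_of_fls_add)

lemma puiseux_of_fls_compose_power:
  "m > 0 \<Longrightarrow> k > 0 \<Longrightarrow> puiseux_of_fls (m * k) (fls_compose_power f k) = puiseux_of_fls m f"
  by (simp add: puiseux_of_fls_def abs_puiseux_eq_iff fls_compose_power_compose_power max_def mult.commute)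

lemma puiseux_cases:
  obtains m f where "m > 0" "x = puiseux_of_fls m f"
proof -
  obtain m f where mf: "rep_puiseux x = (m, f)" by (cases "rep_puiseux x")
  have "puiseux_rel (m, f) (m, f)" using Quotient3_rep_reflp[OF Quotient3_puiseux, of x] mf by simp
  then have "m > 0" by (simp add: puiseux_rel_def)
  moreover have "x = puiseux_of_fls m f"
    using Quotient3_abs_rep[OF Quotient3_puiseux, of x] mf \<open>m > 0\<close> by (simp add: puiseux_of_fls_def max_def)
  ultimately show ?thesis by (rule that)
qed

lemma puiseux_common_denominator:
  fixes x :: "'k \<Rightarrow> 'a::field puiseux"
  assumes "finite I"
  obtains m f where "m > 0" "\<And>i. i \<in> I \<Longrightarrow> x i = puiseux_of_fls m (f i)"
proof -
  obtain M g where Mg: "\<And>i. M i > 0 \<and> x i = puiseux_of_fls (M i) (g i)"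
  proof -
    have "\<forall>i. \<exists>m f. m > 0 \<and> x i = puiseux_of_fls m f"
    proof
      fix i show "\<exists>m f. m > 0 \<and> x i = puiseux_of_fls m f"
        by (rule puiseux_cases[of "x i"]) blast
    qed
    then show ?thesis using that by metis
  qed
  define m where "m = (\<Prod>i\<in>I. M i)"
  have "m > 0" unfolding m_def using Mg by (intro prod_pos) auto
  moreover have "x i = puiseux_of_fls m (fls_compose_power (g i) (m div M i))" if "i \<in> I" for i
  proof -
    have d: "M i dvd m" unfolding m_def using that assms by auto
    then have "m div M i > 0" using \<open>m > 0\<close> Mg by (metis div_greater_zero_iff dvd_imp_le)
    from puiseux_of_fls_compose_power[OF conjunct1[OF Mg] this, of i "g i"] show ?thesis
      using Mg[of i] d by simp
  qed
  ultimately show ?thesis by (rule that)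
qed

lemma puiseux_val_of_fls: "m > 0 \<Longrightarrow> puiseux_val (puiseux_of_fls m f) = fls_subdegree f / m"
  unfolding puiseux_of_fls_def puiseux_val.abs_eq[OF puiseux_rel_refl] by (simp add: max_def)

lemma puiseux_val_mult:
  fixes x y :: "'a::field puiseux"
  assumes "x \<noteq> 0" "y \<noteq> 0"
  shows "puiseux_val (x * y) = puiseux_val x + puiseux_val y"
proof -
  obtain m f where m: "m > 0" "\<And>i. i \<in> UNIV \<Longrightarrow> case_bool x y i = puiseux_of_fls m (f i)"
    by (rule puiseux_common_denominator[of UNIV "case_bool x y"]) auto
  have x: "x = puiseux_of_fls m (f True)" and y: "y = puiseux_of_fls m (f False)"
    using m(2)[of True] m(2)[of False] by simp_all
  then show ?thesis using assms m(1)
    by (simp add: puiseux_of_fls_mult puiseux_val_of_fls fls_subdegree_mult add_divide_distrib)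
qed

lemma puiseux_val_divide:
  fixes x y :: "'a::field puiseux"
  assumes "x \<noteq> 0" "y \<noteq> 0"
  shows "puiseux_val (x / y) = puiseux_val x - puiseux_val y"
  using puiseux_val_mult[of "x / y" y] assms by simp

lemma scaleR_puiseux_of_fls: "r *\<^sub>R puiseux_of_fls m f = puiseux_of_fls m (fls_const (of_real r) * f)"
  unfolding puiseux_of_fls_def scaleR_puiseux.abs_eq[OF puiseux_rel_refl] by simp

lemma of_real_puiseux: "of_real r = puiseux_of_fls m (fls_const (of_real r))"
  using scaleR_puiseux_of_fls[of r m 1] by (simp add: of_real_def)

lemma puiseux_of_real_of_fls: "puiseux_of_real (puiseux_of_fls m f) = puiseux_of_fls m (fls_of_real f)"
  unfolding puiseux_of_fls_def puiseux_of_real.abs_eq[OF puiseux_rel_refl] by simp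

lemma fls_nth_fls_of_real: "fls_nth (fls_of_real f) n = of_real (fls_nth f n)"
  by transfer simp

lemma fls_of_real_eq_0_iff [simp]: "fls_of_real f = (0 :: 'a::real_algebra_1 fls) \<longleftrightarrow> f = 0"
  by (auto simp: fls_eq_iff fls_nth_fls_of_real)

lemma fls_subdegree_fls_of_real: "fls_subdegree (fls_of_real f :: 'a::real_algebra_1 fls) = fls_subdegree f"
proof (cases "f = 0")
  case False
  then show ?thesis by (intro fls_subdegree_eqI) (auto simp: fls_nth_fls_of_real)
next
  case True
  have "fls_of_real 0 = (0 :: 'a fls)" by simp
  then show ?thesis using True by (simp only: fls_zero_subdegree)
qed

lemma puiseux_of_real_nonzero: "x \<noteq> 0 \<Longrightarrow> (puiseux_of_real x :: 'a::real_field puiseux) \<noteq> 0"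
  by (cases x rule: puiseux_cases) (simp add: puiseux_of_real_of_fls)

lemma puiseux_val_of_real: "puiseux_val (puiseux_of_real x :: 'a::real_field puiseux) = puiseux_val x"
  by (cases x rule: puiseux_cases)
    (simp add: puiseux_of_real_of_fls puiseux_val_of_fls fls_subdegree_fls_of_real)

lift_definition puiseux_coeff :: "real \<Rightarrow> 'a::zero puiseux \<Rightarrow> 'a" is
  "\<lambda>r (n, f). if r * real n \<in> \<int> then fls_nth f \<lfloor>r * real n\<rfloor> else 0"
proof -
  fix r :: real and x y :: "nat \<times> 'a fls"
  have key: "(if r * n \<in> \<int> then fls_nth f \<lfloor>r * n\<rfloor> else 0) = fls_nth (fls_compose_power f m) \<lfloor>r * (n * m)\<rfloor>"
    if nm: "n > 0" "m > 0" "r * (n * m) \<in> \<int>" for n m and f :: "'a fls"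
  proof (cases "r * n \<in> \<int>")
    case True
    then obtain k where k: "r * n = of_int k" by (elim Ints_cases)
    then have "r * (n * m) = of_int (int m * k)" by (simp add: mult.assoc[symmetric] mult.commute)
    then have "\<lfloor>r * (n * m)\<rfloor> = int m * k" by (metis floor_of_int)
    then show ?thesis using k nm by (simp add: fls_nth_compose_power)
  next
    case False
    obtain l where l: "r * (n * m) = of_int l" using nm(3) by (elim Ints_cases)
    have "\<not> int m dvd l"
    proof
      assume "int m dvd l"
      then obtain k where "l = int m * k" by (elim dvdE)
      then have "(r * n) * m = of_int k * m" using l by (simp add: mult_ac)
      then have "r * n = of_int k" using nm by simp
      then show False using False by simp
    qed
    moreover have "\<lfloor>r * (n * m)\<rfloor> = l" using l by (metis floor_of_int)
    ultimately show ?thesis using False nm by (simp add: fls_nth_compose_power)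
  qed
  assume "puiseux_rel x y"
  then obtain n f m g where xy: "x = (n, f)" "y = (m, g)" and pos: "n > 0" "m > 0"
    and eq: "fls_compose_power f m = fls_compose_power g n"
    by (cases x; cases y) (auto simp: puiseux_rel_def)
  have int: "r * (real n * real m) \<in> \<int>" if "r * real n \<in> \<int>" for n m :: nat
    using Ints_mult[OF that Ints_of_nat[of m]] by (simp add: mult.assoc)
  have "r * (real n * real m) \<in> \<int>" if "r * real m \<in> \<int>"
    using int[OF that, of n] by (simp add: mult.commute)
  with int[of n m] show "(case x of (n, f) \<Rightarrow> if r * real n \<in> \<int> then fls_nth f \<lfloor>r * real n\<rfloor> else 0) =
      (case y of (n, f) \<Rightarrow> if r * real n \<in> \<int> then fls_nth f \<lfloor>r * real n\<rfloor> else 0)"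
    using key[of n m f] key[of m n g] pos eq unfolding xy
    by (cases "r * (n * m) \<in> \<int>") (auto simp: mult.commute[of "real m"])
qed

lemma puiseux_coeff_of_fls:
  "m > 0 \<Longrightarrow> puiseux_coeff r (puiseux_of_fls m f) = (if r * m \<in> \<int> then fls_nth f \<lfloor>r * m\<rfloor> else 0)"
  unfolding puiseux_of_fls_def puiseux_coeff.abs_eq[OF puiseux_rel_refl] by (simp add: max_def)

lemma linear_puiseux_coeff: "linear (puiseux_coeff r :: 'a::real_field puiseux \<Rightarrow> 'a)"
proof (rule linearI)
  fix x y :: "'a puiseux" and c :: real
  obtain m f where m: "m > 0" "\<And>i. i \<in> UNIV \<Longrightarrow> case_bool x y i = puiseux_of_fls m (f i)"
    by (rule puiseux_common_denominator[of UNIV "case_bool x y"]) auto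
  have x: "x = puiseux_of_fls m (f True)" and y: "y = puiseux_of_fls m (f False)"
    using m(2)[of True] m(2)[of False] by simp_all
  show "puiseux_coeff r (x + y) = puiseux_coeff r x + puiseux_coeff r y"
    using m(1) by (simp add: x y puiseux_of_fls_add puiseux_coeff_of_fls)
  show "puiseux_coeff r (c *\<^sub>R x) = c *\<^sub>R puiseux_coeff r x"
    unfolding x scaleR_puiseux_of_fls using m(1) by (simp add: puiseux_coeff_of_fls scaleR_conv_of_real)
qed

lemma puiseux_coeff_val: "x \<noteq> 0 \<Longrightarrow> puiseux_coeff (puiseux_val x) x \<noteq> (0 :: 'a::field)"
  by (cases x rule: puiseux_cases) (simp add: puiseux_coeff_of_fls puiseux_val_of_fls)

lemma puiseux_coeff_less_val: "r < puiseux_val x \<Longrightarrow> puiseux_coeff r x = (0 :: 'a::field)"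
proof (cases x rule: puiseux_cases)
  fix m f assume m: "m > 0" "x = puiseux_of_fls m f" and "r < puiseux_val x"
  then have "r * m < fls_subdegree f" by (simp add: puiseux_val_of_fls field_simps)
  then show ?thesis using m by (simp add: puiseux_coeff_of_fls floor_less_iff)
qed

lemma puiseux_coeff_val_mult:
  fixes x y :: "'a::field puiseux"
  assumes "x \<noteq> 0" "y \<noteq> 0"
  shows "puiseux_coeff (puiseux_val (x * y)) (x * y) = puiseux_coeff (puiseux_val x) x * puiseux_coeff (puiseux_val y) y"
proof -
  obtain m f where m: "m > 0" "\<And>i. i \<in> UNIV \<Longrightarrow> case_bool x y i = puiseux_of_fls m (f i)"
    by (rule puiseux_common_denominator[of UNIV "case_bool x y"]) auto
  have xy: "x = puiseux_of_fls m (f True)" "y = puiseux_of_fls m (f False)"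
    using m(2)[of True] m(2)[of False] by simp_all
  then have "f True \<noteq> 0" "f False \<noteq> 0" using assms by auto
  then show ?thesis using m(1)
    by (simp add: xy puiseux_of_fls_mult puiseux_val_of_fls puiseux_coeff_of_fls fls_subdegree_mult fls_times_base)
qed

lemma puiseux_val_rational: "puiseux_val (x :: 'a::field puiseux) \<in> \<rat>"
  by (cases x rule: puiseux_cases) (simp add: puiseux_val_of_fls)

section \<open>Tropicalizations\<close>

lemma val_tropical_condition:
  fixes L :: "(real ^ 'i) set" and p :: "complex puiseux ^ 'i"
  assumes L: "subspace L" and p: "p \<in> extend_field L" "\<And>i. p $ i \<noteq> 0"
  shows "tropical_condition L (\<lambda>i. puiseux_val (p $ i))"
  unfolding tropical_condition_def
proof
  fix e
  let ?c = "puiseux_coeff (puiseux_val (p $ e)) :: complex puiseux \<Rightarrow> complex"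
  have lin: "linear (Re \<circ> ?c)" "linear (Im \<circ> ?c)"
    using linear_puiseux_coeff
    by (intro linear_compose bounded_linear.linear bounded_linear_Re bounded_linear_Im; assumption)+
  have z: "?c (p $ f) = 0" if "puiseux_val (p $ e) < puiseux_val (p $ f)" for f
    using puiseux_coeff_less_val[OF that] .
  have "?c (p $ e) \<noteq> 0" using puiseux_coeff_val p(2) by blast
  then consider "Re (?c (p $ e)) \<noteq> 0" | "Im (?c (p $ e)) \<noteq> 0" by (auto simp: complex_eq_iff)
  then show "\<exists>z\<in>L. z $ e \<noteq> 0 \<and> (\<forall>f. puiseux_val (p $ e) < puiseux_val (p $ f) \<longrightarrow> z $ f = 0)"
  proof cases
    case 1
    then show ?thesis
      using real_linear_image_extend_field[OF L lin(1) p(1)] z by (intro bexI) auto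
  next
    case 2
    then show ?thesis
      using real_linear_image_extend_field[OF L lin(2) p(1)] z by (intro bexI) auto
  qed
qed

lemma (in linear_model_loc) tropicalization_A:
  assumes "q \<in> tropicalization A"
  shows "tropical_condition (model_cone X) (case_option 0 (($) q))"
proof -
  obtain x where x: "\<And>k. x k \<in> {val_vec p | p. p \<in> (extend_field A :: (complex puiseux ^ 'n) set) \<and> (\<forall>i. p $ i \<noteq> 0)}"
    "x \<longlonglongrightarrow> q"
    using assms unfolding tropicalization_def closure_sequential by blast
  have "tropical_condition (model_cone X) (case_option 0 (($) (x k)))" for k
  proof -
    obtain p :: "complex puiseux ^ 'n" where p: "x k = val_vec p" "p \<in> extend_field A" "\<And>i. p $ i \<noteq> 0"
      using x(1)[of k] by blast
    let ?p = "\<chi> k. case k of None \<Rightarrow> 1 | Some i \<Rightarrow> p $ i"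
    have v1: "puiseux_val (1 :: complex puiseux) = 0"
      using puiseux_val_of_fls[of 1 "1 :: complex fls"] by simp
    have "tropical_condition (model_cone X) (\<lambda>k. puiseux_val (?p $ k))"
      using p(2,3) by (intro val_tropical_condition subspace_model_cone)
        (auto simp: extend_cone_iff split: option.split)
    moreover have "(\<lambda>k. puiseux_val (?p $ k)) = case_option 0 (($) (x k))"
      by (auto simp: p(1) val_vec_def v1 fun_eq_iff split: option.split)
    ultimately show ?thesis by simp
  qed
  moreover have "(\<lambda>k. case_option 0 (($) (x k)) e) \<longlonglongrightarrow> case_option 0 (($) q) e" for e
    using tendsto_vec_nth[OF x(2)] by (cases e) auto
  ultimately show ?thesis by (rule tropical_condition_closed[rotated])
qed

lemma (in linear_model_loc) tropicalization_Y:
  assumes "q \<in> tropicalization Y"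
  shows "tropical_condition Y (($) q)"
proof -
  obtain x where x: "\<And>k. x k \<in> {val_vec p | p. p \<in> (extend_field Y :: (complex puiseux ^ 'n) set) \<and> (\<forall>i. p $ i \<noteq> 0)}"
    "x \<longlonglongrightarrow> q"
    using assms unfolding tropicalization_def closure_sequential by blast
  have "tropical_condition Y (($) (x k))" for k
  proof -
    obtain p :: "complex puiseux ^ 'n" where p: "x k = val_vec p" "p \<in> extend_field Y" "\<And>i. p $ i \<noteq> 0"
      using x(1)[of k] by blast
    have "tropical_condition Y (\<lambda>i. puiseux_val (p $ i))"
      by (intro val_tropical_condition subspace_Y p)
    moreover have "(\<lambda>i. puiseux_val (p $ i)) = ($) (x k)"
      by (simp add: p(1) val_vec_def fun_eq_iff)
    ultimately show ?thesis by simp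
  qed
  moreover have "(\<lambda>k. x k $ e) \<longlonglongrightarrow> q $ e" for e
    using tendsto_vec_nth[OF x(2)] .
  ultimately show ?thesis by (rule tropical_condition_closed[rotated])
qed

section \<open>Hensel lifting\<close>

lemma fps_mult_nth_cong:
  "(\<And>i. i \<le> n \<Longrightarrow> fps_nth f i = fps_nth f' i) \<Longrightarrow> (\<And>i. i \<le> n \<Longrightarrow> fps_nth g i = fps_nth g' i) \<Longrightarrow>
    fps_nth (f * g) n = fps_nth (f' * g') n"
  unfolding fps_mult_nth by (intro sum.cong) auto

lemma fps_mult_monom_nth:
  fixes g :: "'a::comm_ring_1 fps"
  shows "fps_nth (g * (fps_const c * fps_X ^ n)) k = (if k < n then 0 else fps_nth g (k - n) * c)"
  by (simp add: mult.assoc[symmetric] fps_mult_right_const_nth flip: fps_X_power_mult_right_nth)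
   (simp add: fps_X_power_mult_right_nth fps_mult_right_const_nth)

text \<open>A bilinear system whose linearization at the constant terms is the incidence system of the
  level sets of \<open>a\<close> and \<open>b\<close>: it is solved one coefficient at a time.\<close>

lemma bilinear_hensel:
  fixes a :: "'n option \<Rightarrow> real" and b :: "'n \<Rightarrow> real"
    and G :: "'n option \<Rightarrow> real \<Rightarrow> 'a::field fps" and H :: "'n \<Rightarrow> real \<Rightarrow> 'a fps"
  assumes fin: "finite R" "finite S" and aR: "\<And>k. a k \<in> R" and bS: "\<And>e. b e \<in> S"
    and G0: "\<And>k r. r \<in> R \<Longrightarrow> r \<noteq> a k \<Longrightarrow> fps_nth (G k r) 0 = 0"
    and H0: "\<And>e s. s \<in> S \<Longrightarrow> s \<noteq> b e \<Longrightarrow> fps_nth (H e s) 0 = 0"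
    and lead: "\<And>e. fps_nth (G (Some e) (a (Some e))) 0 * x0 (a (Some e)) * (fps_nth (H e (b e)) 0 * y0 (b e)) = fps_nth (U e) 0"
    and U0: "\<And>e. fps_nth (U e) 0 \<noteq> 0"
    and lead1: "fps_nth (G None (a None)) 0 * x0 (a None) = 1"
    and solve: "\<And>(c0 :: 'a) c. \<exists>\<alpha> \<beta>. \<alpha> (a None) = c0 \<and> (\<forall>e. c e = \<alpha> (a (Some e)) + \<beta> (b e))"
  obtains X Y where "\<And>r. fps_nth (X r) 0 = x0 r" "\<And>s. fps_nth (Y s) 0 = y0 s"
    "(\<Sum>r\<in>R. G None r * X r) = 1"
    "\<And>e. (\<Sum>r\<in>R. G (Some e) r * X r) * (\<Sum>s\<in>S. H e s * Y s) = U e"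
proof -
  define P where "P = (\<lambda>X k. \<Sum>r\<in>R. G k r * X r)"
  define Q where "Q = (\<lambda>Y e. \<Sum>s\<in>S. H e s * Y s)"
  define I where "I = (\<lambda>n (X, Y). (\<forall>r. fps_nth (X r) 0 = x0 r) \<and> (\<forall>s. fps_nth (Y s) 0 = y0 s) \<and>
    (\<forall>k\<le>n. fps_nth (P X None) k = fps_nth 1 k \<and> (\<forall>e. fps_nth (P X (Some e) * Q Y e) k = fps_nth (U e) k)))"
  define T where "T = (\<lambda>n :: nat. \<lambda>(X :: real \<Rightarrow> 'a fps, Y :: real \<Rightarrow> 'a fps) (X' :: real \<Rightarrow> 'a fps, Y' :: real \<Rightarrow> 'a fps). (\<forall>r. \<forall>k\<le>n. fps_nth (X' r) k = fps_nth (X r) k) \<and>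
    (\<forall>s. \<forall>k\<le>n. fps_nth (Y' s) k = fps_nth (Y s) k))"
  have P0: "fps_nth (P X k) 0 = fps_nth (G k (a k)) 0 * fps_nth (X (a k)) 0" for X k
  proof -
    have "fps_nth (P X k) 0 = (\<Sum>r\<in>R. if r = a k then fps_nth (G k (a k)) 0 * fps_nth (X (a k)) 0 else 0)"
      unfolding P_def fps_sum_nth using G0 by (intro sum.cong) auto
    then show ?thesis using fin aR by simp
  qed
  have Q0: "fps_nth (Q Y e) 0 = fps_nth (H e (b e)) 0 * fps_nth (Y (b e)) 0" for Y e
  proof -
    have "fps_nth (Q Y e) 0 = (\<Sum>s\<in>S. if s = b e then fps_nth (H e (b e)) 0 * fps_nth (Y (b e)) 0 else 0)"
      unfolding Q_def fps_sum_nth using H0 by (intro sum.cong) auto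
    then show ?thesis using fin bS by simp
  qed
  have Pcong: "fps_nth (P X k) n = fps_nth (P X' k) n" if "\<And>r i. i \<le> n \<Longrightarrow> fps_nth (X r) i = fps_nth (X' r) i" for X X' k n
    unfolding P_def fps_sum_nth using that by (intro sum.cong fps_mult_nth_cong) auto
  have Qcong: "fps_nth (Q Y e) n = fps_nth (Q Y' e) n" if "\<And>s i. i \<le> n \<Longrightarrow> fps_nth (Y s) i = fps_nth (Y' s) i" for Y Y' e n
    unfolding Q_def fps_sum_nth using that by (intro sum.cong fps_mult_nth_cong) auto
  have "I 0 (\<lambda>r. fps_const (x0 r), \<lambda>s. fps_const (y0 s))"
    using lead lead1 by (simp add: I_def P0 Q0)
  moreover have "\<exists>Z'. I (Suc n) Z' \<and> T n Z Z'" if "I n Z" for n Z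
  proof -
    obtain X Y where Z: "Z = (X, Y)" by (cases Z)
    have X0: "\<And>r. fps_nth (X r) 0 = x0 r" and Y0: "\<And>s. fps_nth (Y s) 0 = y0 s"
      and eq1: "\<And>k. k \<le> n \<Longrightarrow> fps_nth (P X None) k = fps_nth 1 k"
      and eq2: "\<And>k e. k \<le> n \<Longrightarrow> fps_nth (P X (Some e) * Q Y e) k = fps_nth (U e) k"
      using that by (auto simp: I_def Z)
    let ?N = "Suc n"
    obtain \<alpha> \<beta> where \<alpha>: "\<alpha> (a None) = - fps_nth (P X None) ?N"
      and \<alpha>\<beta>: "\<And>e. (fps_nth (U e) ?N - fps_nth (P X (Some e) * Q Y e) ?N) / fps_nth (U e) 0 = \<alpha> (a (Some e)) + \<beta> (b e)"
      using solve[of "- fps_nth (P X None) ?N" "\<lambda>e. (fps_nth (U e) ?N - fps_nth (P X (Some e) * Q Y e) ?N) / fps_nth (U e) 0"]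
      by blast
    define X' where "X' = (\<lambda>r. X r + fps_const (x0 r * \<alpha> r) * fps_X ^ ?N)"
    define Y' where "Y' = (\<lambda>s. Y s + fps_const (y0 s * \<beta> s) * fps_X ^ ?N)"
    have X'n: "fps_nth (X' r) k = fps_nth (X r) k" if "k \<le> n" for r k
      using that fps_mult_monom_nth[of 1 "x0 r * \<alpha> r" ?N k] by (simp add: X'_def del: power_Suc)
    have Y'n: "fps_nth (Y' s) k = fps_nth (Y s) k" if "k \<le> n" for s k
      using that fps_mult_monom_nth[of 1 "y0 s * \<beta> s" ?N k] by (simp add: Y'_def del: power_Suc)
    define g where "g = (\<lambda>k. fps_nth (G k (a k)) 0 * x0 (a k))"
    define h where "h = (\<lambda>e. fps_nth (H e (b e)) 0 * y0 (b e))"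
    have PX': "P X' k = P X k + (\<Sum>r\<in>R. G k r * (fps_const (x0 r * \<alpha> r) * fps_X ^ ?N))" for k
      by (simp add: P_def X'_def distrib_left sum.distrib)
    have QY': "Q Y' e = Q Y e + (\<Sum>s\<in>S. H e s * (fps_const (y0 s * \<beta> s) * fps_X ^ ?N))" for e
      by (simp add: Q_def Y'_def distrib_left sum.distrib)
    have PN: "fps_nth (P X' k) ?N = fps_nth (P X k) ?N + g k * \<alpha> (a k)" for k
    proof -
      have "fps_nth (\<Sum>r\<in>R. G k r * (fps_const (x0 r * \<alpha> r) * fps_X ^ ?N)) ?N
          = (\<Sum>r\<in>R. if r = a k then g k * \<alpha> (a k) else 0)"
        unfolding fps_sum_nth fps_mult_monom_nth using G0 by (intro sum.cong) (auto simp: g_def mult.assoc)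
      then show ?thesis unfolding PX' using fin aR by simp
    qed
    have QN: "fps_nth (Q Y' e) ?N = fps_nth (Q Y e) ?N + h e * \<beta> (b e)" for e
    proof -
      have "fps_nth (\<Sum>s\<in>S. H e s * (fps_const (y0 s * \<beta> s) * fps_X ^ ?N)) ?N
          = (\<Sum>s\<in>S. if s = b e then h e * \<beta> (b e) else 0)"
        unfolding fps_sum_nth fps_mult_monom_nth using H0 by (intro sum.cong) (auto simp: h_def mult.assoc)
      then show ?thesis unfolding QY' using fin bS by simp
    qed
    have Plow: "fps_nth (P X' k) i = fps_nth (P X k) i" if "i \<le> n" for k i
      using that X'n by (intro Pcong) auto
    have Qlow: "fps_nth (Q Y' e) i = fps_nth (Q Y e) i" if "i \<le> n" for e i
      using that Y'n by (intro Qcong) auto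
    have g0: "fps_nth (P X k) 0 = g k" for k by (simp add: P0 X0 g_def)
    have h0: "fps_nth (Q Y e) 0 = h e" for e by (simp add: Q0 Y0 h_def)
    have gh: "g (Some e) * h e = fps_nth (U e) 0" for e using lead[of e] by (simp add: g_def h_def)
    have "fps_nth (P X' (Some e) * Q Y' e) ?N = fps_nth (U e) ?N" for e
    proof -
      have split: "fps_nth (p * q) ?N = fps_nth p 0 * fps_nth q ?N + (\<Sum>i=1..n. fps_nth p i * fps_nth q (?N - i)) + fps_nth p ?N * fps_nth q 0"
        for p q :: "'a fps"
      proof -
        have "{0..?N} = insert 0 (insert ?N {1..n})" by auto
        then show ?thesis unfolding fps_mult_nth by (simp add: algebra_simps)
      qed
      have mid: "(\<Sum>i=1..n. fps_nth (P X' (Some e)) i * fps_nth (Q Y' e) (?N - i)) =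
          (\<Sum>i=1..n. fps_nth (P X (Some e)) i * fps_nth (Q Y e) (?N - i))"
        using Plow Qlow by (intro sum.cong) auto
      have "fps_nth (P X' (Some e) * Q Y' e) ?N = fps_nth (P X (Some e) * Q Y e) ?N
          + g (Some e) * h e * (\<alpha> (a (Some e)) + \<beta> (b e))"
        unfolding split mid PN QN Plow[OF le0] Qlow[OF le0] g0 h0 by (simp add: algebra_simps)
      also have "\<dots> = fps_nth (U e) ?N" unfolding gh \<alpha>\<beta>[symmetric] using U0[of e] by simp
      finally show ?thesis .
    qed
    moreover have "fps_nth (P X' None) ?N = 0" using PN[of None] \<alpha> lead1 by (simp add: g_def)
    moreover have "fps_nth (P X' (Some e) * Q Y' e) k = fps_nth (U e) k" if "k \<le> n" for e k
      unfolding eq2[OF that, symmetric] using that Plow Qlow by (intro fps_mult_nth_cong) auto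
    moreover have "fps_nth (P X' None) k = fps_nth 1 k" if "k \<le> n" for k
      unfolding Plow[OF that] by (rule eq1[OF that])
    ultimately have "I ?N (X', Y')"
      using X0 Y0 X'n[of 0] Y'n[of 0] by (auto simp: I_def le_Suc_eq)
    then show ?thesis using X'n Y'n by (intro exI[of _ "(X', Y')"]) (auto simp: T_def Z)
  qed
  ultimately obtain Z where Z: "\<And>n. I n (Z n)" "\<And>n. T n (Z n) (Z (Suc n))"
    using dependent_nat_choice[of I T] by metis
  define XX where "XX = (\<lambda>n. fst (Z n))"
  define YY where "YY = (\<lambda>n. snd (Z n))"
  have stepX: "fps_nth (XX (Suc n) r) k = fps_nth (XX n r) k" if "k \<le> n" for n r k
    using Z(2)[of n] that by (auto simp: T_def XX_def split: prod.splits)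
  have stepY: "fps_nth (YY (Suc n) r) k = fps_nth (YY n r) k" if "k \<le> n" for n r k
    using Z(2)[of n] that by (auto simp: T_def YY_def split: prod.splits)
  define X where "X = (\<lambda>r. Abs_fps (\<lambda>n. fps_nth (XX n r) n))"
  define Y where "Y = (\<lambda>s. Abs_fps (\<lambda>n. fps_nth (YY n s) n))"
  have Xn: "fps_nth (X r) k = fps_nth (XX n r) k" if "k \<le> n" for r k n
    using that
  proof (induction n rule: dec_induct)
    case base
    then show ?case by (simp add: X_def)
  next
    case (step n)
    then show ?case using stepX[of k n r] by simp
  qed
  have Yn: "fps_nth (Y r) k = fps_nth (YY n r) k" if "k \<le> n" for r k n
    using that
  proof (induction n rule: dec_induct)
    case base
    then show ?case by (simp add: Y_def)
  next
    case (step n)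
    then show ?case using stepY[of k n r] by simp
  qed
  have I: "I n (XX n, YY n)" for n using Z(1)[of n] by (simp add: XX_def YY_def)
  have "fps_nth (X r) 0 = x0 r" "fps_nth (Y s) 0 = y0 s" for r s
    using I[of 0] Xn[of 0 0] Yn[of 0 0] by (auto simp: I_def)
  moreover have "P X None = 1"
  proof (rule fps_ext)
    fix n
    have "fps_nth (P X None) n = fps_nth (P (XX n) None) n" by (intro Pcong Xn)
    then show "fps_nth (P X None) n = fps_nth 1 n" using I[of n] by (auto simp: I_def)
  qed
  moreover have "P X (Some e) * Q Y e = U e" for e
  proof (rule fps_ext)
    fix n
    have "fps_nth (P X (Some e) * Q Y e) n = fps_nth (P (XX n) (Some e) * Q (YY n) e) n"
      by (intro fps_mult_nth_cong Pcong Qcong Xn Yn) auto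
    then show "fps_nth (P X (Some e) * Q Y e) n = fps_nth (U e) n" using I[of n] by (auto simp: I_def)
  qed
  ultimately show ?thesis using that[of X Y] by (simp add: P_def Q_def)
qed

context generic_tropical_point
begin

lemma level_equations_field:
  fixes c :: "'n \<Rightarrow> 'f::real_field"
  shows "\<exists>\<alpha> \<beta>. \<alpha> (a None) = c0 \<and> (\<forall>e. c e = \<alpha> (a (Some e)) + \<beta> (b e))"
proof -
  have "\<forall>i. \<exists>\<alpha> \<beta>. \<alpha> 0 = 0 \<and> (\<forall>e. (if e = i then 1 else 0 :: real) = \<alpha> (a (Some e)) + \<beta> (b e) )"
  proof
    fix i show "\<exists>\<alpha> \<beta>. \<alpha> 0 = 0 \<and> (\<forall>e. (if e = i then 1 else 0 :: real) = \<alpha> (a (Some e)) + \<beta> (b e))"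
      by (rule level_equations[of "\<lambda>e. if e = i then 1 else 0"]) blast
  qed
  then obtain \<alpha> \<beta> where ab: "\<And>i. \<alpha> i 0 = 0" "\<And>i e. (if e = i then 1 else 0 :: real) = \<alpha> i (a (Some e)) + \<beta> i (b e)"
    by metis
  have "(\<Sum>i\<in>UNIV. (c i - c0) * of_real (\<alpha> i (a (Some e)))) + (\<Sum>i\<in>UNIV. (c i - c0) * of_real (\<beta> i (b e))) = c e - c0" for e
  proof -
    have "(\<Sum>i\<in>UNIV. (c i - c0) * of_real (\<alpha> i (a (Some e)))) + (\<Sum>i\<in>UNIV. (c i - c0) * of_real (\<beta> i (b e)))
        = (\<Sum>i\<in>UNIV. (c i - c0) * of_real (\<alpha> i (a (Some e)) + \<beta> i (b e)))"
      by (simp add: sum.distrib distrib_left)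
    also have "\<dots> = (\<Sum>i\<in>UNIV. if i = e then c e - c0 else 0)"
      unfolding ab(2)[symmetric] by (intro sum.cong) auto
    finally show ?thesis by simp
  qed
  then show ?thesis
    using ab(1) a_None
    by (intro exI[of _ "\<lambda>x. c0 + (\<Sum>i\<in>UNIV. (c i - c0) * of_real (\<alpha> i x))"]
        exI[of _ "\<lambda>x. \<Sum>i\<in>UNIV. (c i - c0) * of_real (\<beta> i x)"]) (simp add: add.assoc)
qed

lemma leading_coefficients_complex:
  assumes "\<kappa> \<noteq> 0" "\<And>e. c e \<noteq> 0"
  shows "\<exists>x y :: real \<Rightarrow> complex. x (a None) = \<kappa> \<and> (\<forall>e. x (a (Some e)) * y (b e) = c e)"
proof -
  obtain \<alpha> \<beta> where "\<alpha> (a None) = Ln \<kappa>" "\<And>e. Ln (c e) = \<alpha> (a (Some e)) + \<beta> (b e)"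
    using level_equations_field[of "Ln \<kappa>" "\<lambda>e. Ln (c e)"] by blast
  then have "exp (\<alpha> (a None)) = \<kappa>" "exp (\<alpha> (a (Some e))) * exp (\<beta> (b e)) = c e" for e
    using assms by (simp_all flip: exp_add) (metis exp_Ln)
  then show ?thesis by (intro exI[of _ "\<lambda>r. exp (\<alpha> r)"] exI[of _ "\<lambda>r. exp (\<beta> r)"]) simp
qed

lemma leading_coefficients_real:
  fixes \<kappa> :: real and c :: "'n \<Rightarrow> real"
  assumes "\<kappa> \<noteq> 0" "\<And>e. c e \<noteq> 0"
  shows "\<exists>x y :: real \<Rightarrow> real. x (a None) = \<kappa> \<and> (\<forall>e. x (a (Some e)) * y (b e) = c e)"
proof -
  obtain x y :: "real \<Rightarrow> complex" where x0: "x (a None) = of_real \<kappa>"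
    and xy: "\<And>e. x (a (Some e)) * y (b e) = of_real (c e)"
    using leading_coefficients_complex[of "of_real \<kappa>" "\<lambda>e. of_real (c e)"] assms by auto
  have nz: "x (a (Some e)) \<noteq> 0" "y (b e) \<noteq> 0" for e using xy[of e] assms(2)[of e] by auto
  have iff: "x (a (Some e)) \<in> \<real> \<longleftrightarrow> y (b e) \<in> \<real>" for e
  proof -
    have "x (a (Some e)) = of_real (c e) / y (b e)" "y (b e) = of_real (c e) / x (a (Some e))"
      using xy[of e] nz[of e] by (simp_all add: field_simps)
    then show ?thesis by (metis Reals_divide Reals_of_real)
  qed
  have "x 0 \<in> \<real>" using x0 a_None by simp
  from connected[of "\<lambda>r. x r \<in> \<real>" "\<lambda>r. y r \<in> \<real>", OF this iff]
  have xr: "x (a k) \<in> \<real>" for k .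
  then have yr: "y (b e) \<in> \<real>" for e using iff by blast
  have "Re (x (a None)) = \<kappa>" using x0 by simp
  moreover have "Re (x (a (Some e))) * Re (y (b e)) = c e" for e
  proof -
    have "Re (x (a (Some e)) * y (b e)) = c e" unfolding xy by simp
    then show ?thesis using xr[of "Some e"] by (simp add: complex_is_Real_iff)
  qed
  ultimately show ?thesis by (intro exI[of _ "\<lambda>r. Re (x r)"] exI[of _ "\<lambda>r. Re (y r)"]) simp
qed

lemma levels_rational:
  assumes "\<And>e. a (Some e) + b e \<in> \<rat>"
  shows "a k \<in> \<rat>"
proof (rule connected[of "\<lambda>r. r \<in> \<rat>" "\<lambda>r. r \<in> \<rat>"])
  fix e
  have "b e = (a (Some e) + b e) - a (Some e)" "a (Some e) = (a (Some e) + b e) - b e" by simp_all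
  then show "a (Some e) \<in> \<rat> \<longleftrightarrow> b e \<in> \<rat>" using assms[of e] by (metis Rats_diff)
qed simp

end

lemma ex_puiseux_val:
  assumes "r \<in> \<rat>"
  shows "\<exists>x :: 'f::field puiseux. x \<noteq> 0 \<and> puiseux_val x = r \<and> puiseux_coeff r x = 1"
proof -
  obtain i n where n: "n \<noteq> 0" "r = real_of_int i / real n" using assms unfolding Rats_eq_int_div_nat by blast
  have "puiseux_val (puiseux_of_fls n (fls_X_intpow i :: 'f fls)) = r"
    using n by (simp add: puiseux_val_of_fls)
  moreover have "puiseux_coeff r (puiseux_of_fls n (fls_X_intpow i :: 'f fls)) = 1"
    using n by (simp add: puiseux_coeff_of_fls)
  moreover have "puiseux_of_fls n (fls_X_intpow i :: 'f fls) \<noteq> 0" by simp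
  ultimately show ?thesis by blast
qed

lemma fps_to_fls_sum: "fps_to_fls (\<Sum>k\<in>K. f k) = (\<Sum>k\<in>K. fps_to_fls (f k))"
  by (induction K rule: infinite_finite_induct) simp_all

lemma fls_X_intpow_times_fps:
  "fls_X_intpow i * fps_to_fls (fps_const c * fps_X ^ nat (j - i) * f) = fls_X_intpow j * fps_to_fls f * fls_const (c :: 'a::field)"
  if "i \<le> j"
proof -
  have "fps_to_fls (fps_X ^ nat (j - i)) = (fls_X_intpow (j - i) :: 'a fls)"
    using that by (simp add: fps_to_fls_power fls_X_power_conv_shift_1)
  then have "fls_X_intpow i * fps_to_fls (fps_const c * fps_X ^ nat (j - i) * f)
      = (fls_X_intpow i * fls_X_intpow (j - i)) * fps_to_fls f * fls_const c"
    by (simp add: fls_times_fps_to_fls mult_ac)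
  also have "fls_X_intpow i * fls_X_intpow (j - i) = (fls_X_intpow j :: 'a fls)"
    by (subst fls_X_intpow_times_fls_X_intpow) simp
  finally show ?thesis .
qed

context generic_tropical_point
begin

proposition critical_point_lift:
  fixes u :: "'f::real_field puiseux ^ 'n"
  assumes u: "\<And>e. u $ e \<noteq> 0" "\<And>e. puiseux_val (u $ e) = a (Some e) + b e"
    and lead: "\<And>\<kappa> c. \<kappa> \<noteq> 0 \<Longrightarrow> (\<And>e. c e \<noteq> 0) \<Longrightarrow>
      \<exists>x y :: real \<Rightarrow> 'f. x (a None) = \<kappa> \<and> (\<forall>e. x (a (Some e)) * y (b e) = c e)"
  obtains p where "p \<in> critical_points X u" "\<And>i. puiseux_val (p $ i) = a (Some i)"
proof -
  have "a (Some e) + b e \<in> \<rat>" for e unfolding u(2)[symmetric] by (rule puiseux_val_rational)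
  then have "a k \<in> \<rat>" for k by (rule levels_rational)
  then have "\<forall>k. \<exists>x :: 'f puiseux. x \<noteq> 0 \<and> puiseux_val x = a k" using ex_puiseux_val by blast
  then obtain t :: "'n option \<Rightarrow> 'f puiseux" where t: "\<And>k. t k \<noteq> 0" "\<And>k. puiseux_val (t k) = a k" by metis
  obtain m F where m: "m > 0" and F: "\<And>i. i \<in> UNIV \<Longrightarrow> case_sum t (($) u) i = puiseux_of_fls m (F i)"
    by (rule puiseux_common_denominator[of UNIV "case_sum t (($) u)"]) auto
  have Ft: "t k = puiseux_of_fls m (F (Inl k))" and Fu: "u $ e = puiseux_of_fls m (F (Inr e))" for k e
    using F[of "Inl k"] F[of "Inr e"] by simp_all
  define ia where "ia = (\<lambda>k. fls_subdegree (F (Inl k)))"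
  define iw where "iw = (\<lambda>e. fls_subdegree (F (Inr e)))"
  have ia: "of_int (ia k) = m * a k" for k
    using t(2)[of k] m unfolding Ft by (simp add: puiseux_val_of_fls ia_def field_simps)
  have iw: "of_int (iw e) = m * (a (Some e) + b e)" for e
    using u(2)[of e] m unfolding Fu by (simp add: puiseux_val_of_fls iw_def field_simps)
  define J where "J = (\<lambda>r. \<lfloor>real m * r\<rfloor>)"
  have Ja: "J (a k) = ia k" for k unfolding J_def ia[symmetric] by simp
  have Jb: "J (b e) = iw e - ia (Some e)" for e
  proof -
    have "real m * b e = of_int (iw e - ia (Some e))" by (simp add: iw ia distrib_left)
    then show ?thesis unfolding J_def by (metis floor_of_int)
  qed
  have J_mono: "J r \<le> J s" if "r \<le> s" for r s unfolding J_def using that m by (intro floor_mono mult_left_mono) auto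
  have Ja_less: "J (a k) < J (a l)" if "a k < a l" for k l
  proof -
    have "real m * a k < real m * a l" using that m by simp
    then show ?thesis unfolding Ja by (simp flip: ia)
  qed
  have Jb_less: "J (b k) < J (b l)" if "b k < b l" for k l
  proof -
    have "real m * b e = of_int (iw e - ia (Some e))" for e by (simp add: iw ia distrib_left)
    moreover have "real m * b k < real m * b l" using that m by simp
    ultimately show ?thesis unfolding Jb by (metis of_int_less_iff)
  qed
  obtain z where z: "\<And>r. z r \<in> model_cone X" "\<And>r e. r \<in> range a \<Longrightarrow> r < a e \<Longrightarrow> z r $ e = 0"
    "\<And>e. z (a e) $ e \<noteq> 0"
    by (rule basis_a) (rule that)
  obtain y where y: "\<And>r. y r \<in> Y" "\<And>r e. r \<in> range b \<Longrightarrow> r < b e \<Longrightarrow> y r $ e = 0"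
    "\<And>e. y (b e) $ e \<noteq> 0"
    by (rule basis_b) (rule that)
  define G :: "'n option \<Rightarrow> real \<Rightarrow> 'f fps" where "G = (\<lambda>k r. fps_const (of_real (z r $ k)) * fps_X ^ nat (J r - J (a k)))"
  define H :: "'n \<Rightarrow> real \<Rightarrow> 'f fps" where "H = (\<lambda>e s. fps_const (of_real (y s $ e)) * fps_X ^ nat (J s - J (b e)))"
  define U where "U = (\<lambda>e. fls_base_factor_to_fps (F (Inr e)))"
  have F0: "F (Inr e) \<noteq> 0" for e using u(1)[of e] unfolding Fu by simp
  have U0: "fps_nth (U e) 0 \<noteq> 0" for e
    using F0[of e] by (simp add: U_def)
  have UF: "fls_X_intpow (iw e) * fps_to_fls (U e) = F (Inr e)" for e
    unfolding U_def iw_def fls_X_intpow_times_conv_shift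
    by (rule fls_conv_base_factor_to_fps_shift_subdegree[symmetric])
  have Gdiag: "fps_nth (G k (a k)) 0 = of_real (z (a k) $ k)" for k by (simp add: G_def)
  have Hdiag: "fps_nth (H e (b e)) 0 = of_real (y (b e) $ e)" for e by (simp add: H_def)
  obtain x0 y0 :: "real \<Rightarrow> 'f" where x0: "x0 (a None) = 1 / of_real (z (a None) $ None)"
    and xy0: "\<And>e. x0 (a (Some e)) * y0 (b e) = fps_nth (U e) 0 / (of_real (z (a (Some e)) $ Some e) * of_real (y (b e) $ e))"
    using lead[of "1 / of_real (z (a None) $ None)" "\<lambda>e. fps_nth (U e) 0 / (of_real (z (a (Some e)) $ Some e) * of_real (y (b e) $ e))"]
      z(3) y(3) U0 by auto
  obtain S T where S0: "\<And>r. fps_nth (S r) 0 = x0 r" and T0: "\<And>s. fps_nth (T s) 0 = y0 s"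
    and S1: "(\<Sum>r\<in>range a. G None r * S r) = 1"
    and ST: "\<And>e. (\<Sum>r\<in>range a. G (Some e) r * S r) * (\<Sum>s\<in>range b. H e s * T s) = U e"
  proof (rule bilinear_hensel[of "range a" "range b" a b G H x0 y0 U])
    show "fps_nth (G k r) 0 = 0" if "r \<in> range a" "r \<noteq> a k" for k r
    proof (cases "r < a k")
      case True
      then show ?thesis using z(2) that by (simp add: G_def)
    next
      case False
      then have "J (a k) < J r" using that Ja_less by (auto simp: less_le)
      then show ?thesis by (simp add: G_def)
    qed
    show "fps_nth (H e s) 0 = 0" if "s \<in> range b" "s \<noteq> b e" for e s
    proof (cases "s < b e")
      case True
      then show ?thesis using y(2) that by (simp add: H_def)
    next
      case False
      then have "J (b e) < J s" using that Jb_less by (auto simp: less_le)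
      then show ?thesis by (simp add: H_def)
    qed
    show "fps_nth (G (Some e) (a (Some e))) 0 * x0 (a (Some e)) * (fps_nth (H e (b e)) 0 * y0 (b e)) = fps_nth (U e) 0" for e
    proof -
      have "fps_nth (G (Some e) (a (Some e))) 0 * x0 (a (Some e)) * (fps_nth (H e (b e)) 0 * y0 (b e))
          = of_real (z (a (Some e)) $ Some e) * of_real (y (b e) $ e) * (x0 (a (Some e)) * y0 (b e))"
        by (simp add: Gdiag Hdiag mult_ac)
      then show ?thesis using z(3)[of "Some e"] y(3)[of e] unfolding xy0 by simp
    qed
    show "fps_nth (G None (a None)) 0 * x0 (a None) = 1" using z(3)[of None] by (simp add: Gdiag x0)
    show "\<exists>\<alpha> \<beta>. \<alpha> (a None) = c0 \<and> (\<forall>e. c e = \<alpha> (a (Some e)) + \<beta> (b e))" for c0 :: 'f and c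
      by (rule level_equations_field)
  qed (use U0 in auto)
  define ph where "ph = (\<lambda>k. puiseux_of_fls m (fls_X_intpow (J (a k)) * fps_to_fls (\<Sum>r\<in>range a. G k r * S r)))"
  define qh where "qh = (\<lambda>e. puiseux_of_fls m (fls_X_intpow (J (b e)) * fps_to_fls (\<Sum>s\<in>range b. H e s * T s)))"
  have ph: "ph k = (\<Sum>r\<in>range a. puiseux_of_fls m (fls_X_intpow (J r) * fps_to_fls (S r)) * of_real (z r $ k))" for k
  proof -
    have "fls_X_intpow (J (a k)) * fps_to_fls (G k r * S r) = fls_X_intpow (J r) * fps_to_fls (S r) * fls_const (of_real (z r $ k))"
      if r: "r \<in> range a" for r
    proof (cases "r < a k")
      case True
      then show ?thesis using z(2)[OF r] by (simp add: G_def)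
    next
      case False
      then have "J (a k) \<le> J r" by (intro J_mono) simp
      then show ?thesis unfolding G_def by (rule fls_X_intpow_times_fps)
    qed
    then show ?thesis unfolding ph_def
      by (simp add: fps_to_fls_sum sum_distrib_left puiseux_of_fls_sum of_real_puiseux[of _ m] puiseux_of_fls_mult)
  qed
  have qh: "qh e = (\<Sum>s\<in>range b. puiseux_of_fls m (fls_X_intpow (J s) * fps_to_fls (T s)) * of_real (y s $ e))" for e
  proof -
    have "fls_X_intpow (J (b e)) * fps_to_fls (H e s * T s) = fls_X_intpow (J s) * fps_to_fls (T s) * fls_const (of_real (y s $ e))"
      if s: "s \<in> range b" for s
    proof (cases "s < b e")
      case True
      then show ?thesis using y(2)[OF s] by (simp add: H_def)
    next
      case False
      then have "J (b e) \<le> J s" by (intro J_mono) simp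
      then show ?thesis unfolding H_def by (rule fls_X_intpow_times_fps)
    qed
    then show ?thesis unfolding qh_def
      by (simp add: fps_to_fls_sum sum_distrib_left puiseux_of_fls_sum of_real_puiseux[of _ m] puiseux_of_fls_mult)
  qed
  have "(\<chi> k. ph k) \<in> extend_field (model_cone X)"
    unfolding ph by (rule extend_field_combination[OF subspace_model_cone z(1)])
  moreover have "ph None = 1" using a_None S1 by (simp add: ph_def J_def)
  then have "(\<chi> k. ph k) = (\<chi> k. case k of None \<Rightarrow> 1 | Some i \<Rightarrow> (\<chi> i. ph (Some i)) $ i)"
    by (simp add: vec_eq_iff split: option.split)
  ultimately have "(\<chi> k. case k of None \<Rightarrow> 1 | Some i \<Rightarrow> (\<chi> i. ph (Some i)) $ i) \<in> extend_field (model_cone X)"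
    by (simp only:)
  then have pA: "(\<chi> i. ph (Some i)) \<in> extend_field A" unfolding extend_cone_iff .
  have qY: "(\<chi> e. qh e) \<in> extend_field Y"
    unfolding qh by (rule extend_field_combination[OF subspace_Y y(1)])
  have prod: "ph (Some e) * qh e = u $ e" for e
  proof -
    have "ph (Some e) * qh e = puiseux_of_fls m ((fls_X_intpow (J (a (Some e))) * fls_X_intpow (J (b e))) *
        fps_to_fls ((\<Sum>r\<in>range a. G (Some e) r * S r) * (\<Sum>s\<in>range b. H e s * T s)))"
      by (simp add: ph_def qh_def puiseux_of_fls_mult fls_times_fps_to_fls mult_ac)
    also have "fls_X_intpow (J (a (Some e))) * fls_X_intpow (J (b e)) = (fls_X_intpow (iw e) :: 'f fls)"
      by (subst fls_X_intpow_times_fls_X_intpow) (simp add: Ja Jb)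
    finally show ?thesis unfolding ST UF Fu[symmetric] .
  qed
  have pnz: "ph (Some e) \<noteq> 0" for e using prod[of e] u(1)[of e] by auto
  have val: "puiseux_val (ph (Some e)) = a (Some e)" for e
  proof -
    let ?P = "\<Sum>r\<in>range a. G (Some e) r * S r"
    have "fps_nth ?P 0 \<noteq> 0" using arg_cong[OF ST[of e], of "\<lambda>f. fps_nth f 0"] U0[of e] by auto
    then have "fls_subdegree (fps_to_fls ?P) = 0" "?P \<noteq> 0"
      by (auto simp: fls_subdegree_fls_to_fps subdegree_eq_0)
    then have "fls_subdegree (fls_X_intpow (J (a (Some e))) * fps_to_fls ?P) = J (a (Some e))"
      by (subst fls_subdegree_mult) auto
    then show ?thesis using m by (simp add: ph_def puiseux_val_of_fls Ja ia)
  qed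
  have "qh e = u $ e / ph (Some e)" for e using prod[of e] pnz[of e] by (simp add: field_simps)
  then have "(\<chi> i. ph (Some i)) \<in> critical_points X u"
    using pA qY pnz by (simp add: critical_points_iff)
  then show ?thesis using that val by simp
qed

end

section \<open>Signs over the real Puiseux series\<close>

abbreviation puiseux_lead :: "'a::field puiseux \<Rightarrow> 'a" where
  "puiseux_lead x \<equiv> puiseux_coeff (puiseux_val x) x"

lemma puiseux_lead_divide:
  fixes x y :: "'a::field puiseux"
  assumes "x \<noteq> 0" "y \<noteq> 0"
  shows "puiseux_lead (x / y) = puiseux_lead x / puiseux_lead y"
  using puiseux_coeff_val_mult[of "x / y" y] assms puiseux_coeff_val[OF assms(2)] by (simp add: field_simps)

lemma puiseux_sum_positive_eq_0:
  fixes x :: "'k \<Rightarrow> real puiseux"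
  assumes fin: "finite K" and pos: "\<And>k. k \<in> K \<Longrightarrow> x k \<noteq> 0 \<Longrightarrow> puiseux_lead (x k) > 0"
    and sum: "(\<Sum>k\<in>K. x k) = 0" and k: "k \<in> K"
  shows "x k = 0"
proof (rule ccontr)
  assume nz: "x k \<noteq> 0"
  let ?N = "{k \<in> K. x k \<noteq> 0}"
  define r where "r = Min ((\<lambda>k. puiseux_val (x k)) ` ?N)"
  have ne: "(\<lambda>k. puiseux_val (x k)) ` ?N \<noteq> {}" using nz k by auto
  then have "r \<in> (\<lambda>k. puiseux_val (x k)) ` ?N" unfolding r_def using fin by (intro Min_in) auto
  then obtain l where l: "l \<in> K" "x l \<noteq> 0" "r = puiseux_val (x l)" by auto
  have lin: "linear (puiseux_coeff r :: real puiseux \<Rightarrow> real)" by (rule linear_puiseux_coeff)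
  have nonneg: "puiseux_coeff r (x j) \<ge> 0" if j: "j \<in> K" for j
  proof (cases "x j = 0")
    case True
    then show ?thesis using linear_0[OF lin] by simp
  next
    case False
    then have "r \<le> puiseux_val (x j)" unfolding r_def using fin j by (intro Min_le) auto
    then consider "r < puiseux_val (x j)" | "r = puiseux_val (x j)" by linarith
    then show ?thesis using puiseux_coeff_less_val[of r "x j"] pos[OF j False] by cases auto
  qed
  have "(\<Sum>j\<in>K. puiseux_coeff r (x j)) = 0"
    using arg_cong[OF sum, of "puiseux_coeff r"] by (simp add: linear_sum[OF lin] linear_0[OF lin])
  then have "puiseux_coeff r (x l) = 0"
    using nonneg fin l(1) by (subst (asm) sum_nonneg_eq_0_iff) auto
  then show False using pos[OF l(1,2)] l(3) by simp
qed

lemma extend_field_real_signs: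
  fixes L :: "(real ^ 'i) set" and p :: "real puiseux ^ 'i"
  assumes L: "subspace L" and p: "p \<in> extend_field L" "\<And>i. p $ i \<noteq> 0"
  shows "\<exists>x\<in>L. \<forall>i. x $ i \<noteq> 0 \<and> (0 < x $ i \<longleftrightarrow> 0 < puiseux_lead (p $ i))"
proof -
  define V where "V = range (\<lambda>i. puiseux_val (p $ i))"
  have finV: "finite V" by (simp add: V_def)
  define c where "c = (\<lambda>r. \<chi> i. puiseux_coeff r (p $ i))"
  have c: "c r \<in> L" for r
    unfolding c_def by (rule real_linear_image_extend_field[OF L linear_puiseux_coeff p(1)])
  define x where "x = (\<lambda>k :: nat. \<Sum>r\<in>V. exp (- real k * r) *\<^sub>R c r)"
  have xL: "x k \<in> L" for k unfolding x_def by (intro subspace_sum subspace_scale L c)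
  have lim: "(\<lambda>k. exp (real k * puiseux_val (p $ i)) * x k $ i) \<longlonglongrightarrow> puiseux_lead (p $ i)" for i
  proof -
    let ?v = "puiseux_val (p $ i)"
    have eq: "exp (real k * ?v) * x k $ i = (\<Sum>r\<in>V. exp (- real k * (r - ?v)) * puiseux_coeff r (p $ i))" for k
      unfolding x_def by (simp add: sum_distrib_left c_def algebra_simps exp_diff exp_minus field_simps flip: exp_add)
    have "(\<lambda>k. \<Sum>r\<in>V. exp (- real k * (r - ?v)) * puiseux_coeff r (p $ i)) \<longlonglongrightarrow>
        (\<Sum>r\<in>V. if r = ?v then puiseux_lead (p $ i) else 0)"
    proof (intro tendsto_sum)
      fix r assume "r \<in> V"
      consider "r < ?v" | "r = ?v" | "?v < r" by linarith
      then show "(\<lambda>k. exp (- real k * (r - ?v)) * puiseux_coeff r (p $ i)) \<longlonglongrightarrow> (if r = ?v then puiseux_lead (p $ i) else 0)"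
      proof cases
        case 1
        then show ?thesis by (simp add: puiseux_coeff_less_val)
      next
        case 3
        have "filterlim (\<lambda>k. (r - ?v) * real k) at_top sequentially"
          using 3 by (intro filterlim_tendsto_pos_mult_at_top[OF tendsto_const _ filterlim_real_sequentially]) simp
        then have "filterlim (\<lambda>k. - ((r - ?v) * real k)) at_bot sequentially"
          by (simp only: filterlim_uminus_at_top[symmetric] filterlim_uminus_at_bot minus_minus)
        then have "(\<lambda>k. exp (- ((r - ?v) * real k))) \<longlonglongrightarrow> 0" by (rule filterlim_compose[OF exp_at_bot])
        from tendsto_mult_right[OF this, of "puiseux_coeff r (p $ i)"] show ?thesis
          using 3 by (simp add: mult.commute)
      qed simp
    qed
    moreover have "(\<Sum>r\<in>V. if r = ?v then puiseux_lead (p $ i) else 0) = puiseux_lead (p $ i)"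
      using finV by (simp add: V_def)
    ultimately show ?thesis unfolding eq by simp
  qed
  have "\<forall>\<^sub>F k in sequentially. \<forall>i\<in>UNIV. x k $ i \<noteq> 0 \<and> (0 < x k $ i \<longleftrightarrow> 0 < puiseux_lead (p $ i))"
  proof (intro eventually_ball_finite ballI)
    fix i
    have "puiseux_lead (p $ i) \<noteq> 0" using puiseux_coeff_val p(2) by blast
    then consider "puiseux_lead (p $ i) > 0" | "puiseux_lead (p $ i) < 0" by linarith
    then show "\<forall>\<^sub>F k in sequentially. x k $ i \<noteq> 0 \<and> (0 < x k $ i \<longleftrightarrow> 0 < puiseux_lead (p $ i))"
    proof cases
      case 1
      from order_tendstoD(1)[OF lim this] show ?thesis
        by eventually_elim (use 1 in \<open>auto simp: zero_less_mult_iff\<close>)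
    next
      case 2
      from order_tendstoD(2)[OF lim this] show ?thesis
        by eventually_elim (use 2 in \<open>auto simp: mult_less_0_iff\<close>)
    qed
  qed simp
  then obtain k where "\<forall>i. x k $ i \<noteq> 0 \<and> (0 < x k $ i \<longleftrightarrow> 0 < puiseux_lead (p $ i))"
    by (auto simp: eventually_sequentially)
  then show ?thesis using xL by blast
qed

context linear_model_loc
begin

lemma puiseux_signs_bounded:
  fixes p u :: "real puiseux ^ 'n"
  assumes u: "\<And>i. u $ i \<noteq> 0" "\<And>i. puiseux_lead (u $ i) > 0" and p: "p \<in> critical_points X u"
  shows "(\<lambda>i. 0 < puiseux_lead (p $ i)) \<in> bounded_signs X"
proof -
  have pA: "p \<in> extend_field A" and pnz: "\<And>i. p $ i \<noteq> 0" and pY: "(\<chi> i. u $ i / p $ i) \<in> extend_field Y"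
    using p by (auto simp: critical_points_iff)
  let ?p = "(\<chi> k. case k of None \<Rightarrow> 1 | Some i \<Rightarrow> p $ i) :: real puiseux ^ 'n option"
  have "?p \<in> extend_field (model_cone X)" using pA by (simp add: extend_cone_iff)
  moreover have "?p $ k \<noteq> 0" for k using pnz by (auto split: option.split)
  ultimately obtain x where x: "x \<in> model_cone X"
    "\<And>k. x $ k \<noteq> 0 \<and> (0 < x $ k \<longleftrightarrow> 0 < puiseux_lead (?p $ k))"
    using extend_field_real_signs[OF subspace_model_cone] by blast
  have "puiseux_lead (1 :: real puiseux) = 1"
    using puiseux_val_of_fls[of 1 "1 :: real fls"] puiseux_coeff_of_fls[of 1 0 "1 :: real fls"] by simp
  then have x0: "x $ None > 0" using x(2)[of None] by simp
  define x' where "x' = (1 / x $ None) *\<^sub>R (\<chi> i. x $ Some i)"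
  have "x' \<in> A"
    using x(1) x0 subspace_scale[OF subspace_X, of "\<chi> i. x $ Some i" "1 / x $ None"]
    by (simp add: x'_def affine_model_def model_cone_def flip: sum_divide_distrib)
  moreover have "x' $ i \<noteq> 0 \<and> (0 < x' $ i \<longleftrightarrow> 0 < puiseux_lead (p $ i))" for i
    using x(2)[of "Some i"] x0 by (simp add: x'_def zero_less_divide_iff)
  moreover obtain y where y: "y \<in> Y" "\<And>i. y $ i \<noteq> 0 \<and> (0 < y $ i \<longleftrightarrow> 0 < puiseux_lead (u $ i / p $ i))"
    using extend_field_real_signs[OF subspace_Y pY] u(1) pnz by auto
  moreover have "0 < puiseux_lead (u $ i / p $ i) \<longleftrightarrow> 0 < puiseux_lead (p $ i)" for i
    using u(2)[of i] puiseux_coeff_val[OF pnz[of i]]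
    by (auto simp: puiseux_lead_divide[OF u(1) pnz] zero_less_divide_iff)
  ultimately show ?thesis unfolding bounded_signs_def by blast
qed

lemma puiseux_critical_unique:
  fixes p p' u :: "real puiseux ^ 'n"
  assumes u: "\<And>i. u $ i \<noteq> 0" "\<And>i. puiseux_lead (u $ i) > 0"
    and p: "p \<in> critical_points X u" and p': "p' \<in> critical_points X u"
    and signs: "\<And>i. 0 < puiseux_lead (p $ i) \<longleftrightarrow> 0 < puiseux_lead (p' $ i)"
  shows "p = p'"
proof -
  have nz: "p $ i \<noteq> 0" "p' $ i \<noteq> 0" for i using p p' by (auto simp: critical_points_iff)
  let ?q = "(\<chi> i. u $ i / p' $ i) - (\<chi> i. u $ i / p $ i)"
  have "?q \<in> extend_field Y" "p - p' \<in> extend_field X0"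
    using p p' by (auto simp: critical_points_iff intro!: extend_field_diff[OF subspace_Y] diff_extend_affine)
  from pairing_zero[OF this(2,1)]
  have sum: "(\<Sum>i\<in>UNIV. (u $ i / p' $ i - u $ i / p $ i) * (p $ i - p' $ i)) = 0" by simp
  have eq: "(u $ i / p' $ i - u $ i / p $ i) * (p $ i - p' $ i)
      = u $ i * ((p $ i - p' $ i) * (p $ i - p' $ i)) / (p $ i * p' $ i)" for i
    using nz[of i] by (simp add: field_simps)
  have "(u $ i / p' $ i - u $ i / p $ i) * (p $ i - p' $ i) = 0" for i
  proof (rule puiseux_sum_positive_eq_0[OF finite _ sum UNIV_I])
    fix i assume "(u $ i / p' $ i - u $ i / p $ i) * (p $ i - p' $ i) \<noteq> 0"
    then have d: "p $ i - p' $ i \<noteq> 0" by auto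
    have "puiseux_lead (p $ i) * puiseux_lead (p' $ i) > 0"
      using signs[of i] puiseux_coeff_val[OF nz(1)[of i]] puiseux_coeff_val[OF nz(2)[of i]]
      by (metis linorder_neqE_linordered_idom mult_neg_neg mult_pos_pos)
    moreover have "puiseux_lead (p $ i - p' $ i) * puiseux_lead (p $ i - p' $ i) > 0"
      using puiseux_coeff_val[OF d] by (simp add: zero_less_mult_iff linorder_neq_iff) linarith
    ultimately show "puiseux_lead ((u $ i / p' $ i - u $ i / p $ i) * (p $ i - p' $ i)) > 0"
      using u[of i] d nz[of i] unfolding eq
      by (simp add: puiseux_lead_divide puiseux_coeff_val_mult)
  qed
  then have "u $ i * ((p $ i - p' $ i) * (p $ i - p' $ i)) / (p $ i * p' $ i) = 0" for i unfolding eq .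
  then have "p $ i = p' $ i" for i using u(1)[of i] nz[of i]
    by (metis divide_eq_0_iff eq_iff_diff_eq_0 mult_eq_0_iff)
  then show ?thesis by (simp add: vec_eq_iff)
qed

proposition card_tropical_points_le:
  assumes w: "w \<notin> \<Union>bad_spaces" and rat: "\<And>i. w $ i \<in> \<rat>"
  shows "finite (tropical_points X w)" "card (tropical_points X w) \<le> card (bounded_signs X)"
proof -
  obtain u :: "real puiseux ^ 'n" where u: "\<And>i. u $ i \<noteq> 0" "\<And>i. puiseux_val (u $ i) = w $ i"
    "\<And>i. puiseux_lead (u $ i) > 0"
  proof -
    have "\<forall>i. \<exists>x :: real puiseux. x \<noteq> 0 \<and> puiseux_val x = w $ i \<and> puiseux_coeff (w $ i) x = 1"
      using ex_puiseux_val rat by blast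
    then obtain x where "\<And>i. x i \<noteq> 0 \<and> puiseux_val (x i) = w $ i \<and> puiseux_coeff (w $ i) (x i) = (1 :: real)"
      by metis
    then show ?thesis using that[of "\<chi> i. x i"] by simp
  qed
  have "\<forall>q. \<exists>p. q \<in> tropical_points X w \<longrightarrow> p \<in> critical_points X u \<and> (\<forall>i. puiseux_val (p $ i) = q $ i)"
  proof (rule allI)
    fix q :: "real ^ 'n"
    show "\<exists>p. q \<in> tropical_points X w \<longrightarrow> p \<in> critical_points X u \<and> (\<forall>i. puiseux_val (p $ i) = q $ i)"
    proof (cases "q \<in> tropical_points X w")
      case True
      interpret generic_tropical_point X d "case_option 0 (($) q)" "\<lambda>i. w $ i - q $ i"
        by (rule generic_tropical_pointI[OF True w])
      obtain p where "p \<in> critical_points X u" "\<And>i. puiseux_val (p $ i) = case_option 0 (($) q) (Some i)"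
        by (rule critical_point_lift[of u]) (use u leading_coefficients_real in auto)
      then show ?thesis by auto
    qed simp
  qed
  then obtain p where p: "\<And>q. q \<in> tropical_points X w \<Longrightarrow> p q \<in> critical_points X u"
    "\<And>q i. q \<in> tropical_points X w \<Longrightarrow> puiseux_val (p q $ i) = q $ i" by metis
  let ?s = "\<lambda>q i. 0 < puiseux_lead (p q $ i)"
  have inj: "inj_on ?s (tropical_points X w)"
  proof (rule inj_onI)
    fix q q' assume q: "q \<in> tropical_points X w" "q' \<in> tropical_points X w" "?s q = ?s q'"
    have "p q = p q'"
      by (rule puiseux_critical_unique[OF u(1,3) p(1)[OF q(1)] p(1)[OF q(2)]]) (use q(3) in \<open>metis\<close>)
    then show "q = q'" using p(2)[OF q(1)] p(2)[OF q(2)] by (simp add: vec_eq_iff)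
  qed
  have sub: "?s ` tropical_points X w \<subseteq> bounded_signs X"
    using puiseux_signs_bounded[OF u(1,3)] p(1) by blast
  show "finite (tropical_points X w)" using inj by (rule finite_imageD[rotated]) (rule finite)
  show "card (tropical_points X w) \<le> card (bounded_signs X)"
    using card_inj_on_le[OF inj sub] by simp
qed

lemma tropical_critical_points_eq:
  fixes u :: "real puiseux ^ 'n"
  assumes u: "\<And>i. u $ i \<noteq> 0" and w: "w = val_vec u" "w \<notin> \<Union>bad_spaces"
  shows "tropical_critical_points X u = tropical_points X w"
    "tropicalization A \<inter> {w - y | y. y \<in> tropicalization Y} = tropical_points X w"
proof -
  let ?u = "(\<chi> i. puiseux_of_real (u $ i)) :: complex puiseux ^ 'n"
  have unz: "?u $ i \<noteq> 0" for i using u[of i] by (simp add: puiseux_of_real_nonzero)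
  have uval: "puiseux_val (?u $ i) = w $ i" for i by (simp add: w(1) val_vec_def puiseux_val_of_real)
  have 1: "tropical_critical_points X u \<subseteq> tropicalization A \<inter> {w - y | y. y \<in> tropicalization Y}"
  proof
    fix q assume "q \<in> tropical_critical_points X u"
    then obtain p where p: "p \<in> critical_points X ?u" "q = val_vec p"
      by (auto simp: tropical_critical_points_def)
    have pA: "p \<in> extend_field A" and pnz: "\<And>i. p $ i \<noteq> 0" and pY: "(\<chi> i. ?u $ i / p $ i) \<in> extend_field Y"
      using p(1) by (auto simp: critical_points_iff)
    have "q \<in> tropicalization A"
      unfolding tropicalization_def using p(2) pA pnz by (intro closure_subset[THEN subsetD]) blast
    moreover have "val_vec (\<chi> i. ?u $ i / p $ i) \<in> tropicalization Y"
    proof -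
      have "\<forall>i. (\<chi> i. ?u $ i / p $ i) $ i \<noteq> 0" using unz pnz by simp
      then show ?thesis
        unfolding tropicalization_def using pY by (intro closure_subset[THEN subsetD]) blast
    qed
    moreover have "q = w - val_vec (\<chi> i. ?u $ i / p $ i)"
    proof -
      have "puiseux_val (?u $ i / p $ i) = w $ i - puiseux_val (p $ i)" for i
        unfolding puiseux_val_divide[OF unz pnz] uval ..
      then show ?thesis by (simp add: vec_eq_iff val_vec_def p(2))
    qed
    ultimately show "q \<in> tropicalization A \<inter> {w - y | y. y \<in> tropicalization Y}" by blast
  qed
  have 2: "tropicalization A \<inter> {w - y | y. y \<in> tropicalization Y} \<subseteq> tropical_points X w"
    using tropicalization_A tropicalization_Y by (auto simp: tropical_points_def)
  have 3: "tropical_points X w \<subseteq> tropical_critical_points X u"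
  proof
    fix q assume q: "q \<in> tropical_points X w"
    interpret generic_tropical_point X d "case_option 0 (($) q)" "\<lambda>i. w $ i - q $ i"
      by (rule generic_tropical_pointI[OF q w(2)])
    obtain p where "p \<in> critical_points X ?u" "\<And>i. puiseux_val (p $ i) = case_option 0 (($) q) (Some i)"
      by (rule critical_point_lift[of ?u]) (use unz uval leading_coefficients_complex in auto)
    then have "p \<in> critical_points X ?u" "val_vec p = q" by (auto simp: val_vec_def vec_eq_iff)
    then show "q \<in> tropical_critical_points X u" unfolding tropical_critical_points_def by blast
  qed
  show "tropical_critical_points X u = tropical_points X w"
    "tropicalization A \<inter> {w - y | y. y \<in> tropicalization Y} = tropical_points X w"
    using 1 2 3 by blast+
qed

end

theorem theorem7p1:
  fixes X :: "(real ^ 'n) set" and d :: nat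
  assumes "linear_model d X"
  shows "\<exists>H. finite H \<and> (\<forall>V\<in>H. subspace V \<and> V \<noteq> (UNIV :: (real ^ 'n) set)) \<and>
    (\<forall>(u :: real puiseux ^ 'n) w.
       (\<forall>i. u $ i \<noteq> 0) \<and> w = val_vec u \<and> w \<notin> \<Union>H \<longrightarrow>
         finite (tropical_critical_points X u) \<and>
         card (tropical_critical_points X u) = MLdegree X \<and>
         tropical_critical_points X u =
           tropicalization (affine_model X) \<inter>
             {w - y | y. y \<in> tropicalization (model_perp X)})"
proof -
  interpret linear_model_loc X d by unfold_locales (rule assms)
  have "finite (tropical_critical_points X u) \<and> card (tropical_critical_points X u) = MLdegree X \<and>
      tropical_critical_points X u = tropicalization A \<inter> {w - y | y. y \<in> tropicalization Y}"
    if u: "\<forall>i. u $ i \<noteq> 0" and w: "w = val_vec u" "w \<notin> \<Union>bad_spaces" for u :: "real puiseux ^ 'n" and w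
  proof -
    have unz: "u $ i \<noteq> 0" for i using u by blast
    have rat: "w $ i \<in> \<rat>" for i by (simp add: w(1) val_vec_def puiseux_val_rational)
    note T = tropical_critical_points_eq[OF unz w]
    show ?thesis
      unfolding T MLdegree_eq
      using card_tropical_points_le[OF w(2) rat] card_bounded_signs_le[OF w(2)] by simp
  qed
  moreover have "\<forall>V\<in>bad_spaces. subspace V \<and> V \<noteq> (UNIV :: (real ^ 'n) set)"
    by (auto simp: bad_spaces_def subspace_level_space)
  ultimately show ?thesis
    by (intro exI[of _ bad_spaces] conjI finite_bad_spaces) blast+
qed

end
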